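(* Let $\lambda_0\in\mathbb R$ and let $v$ satisfy Assumptions A and B at $\lambda_0$ (see context). Let $w$ be a measurable function on $\mathbb R$, bounded on bounded sets, which on some open interval containing $[x_-(\lambda_0),x_+(\lambda_0)]$ is differentiable except at a finite number of points with bounded derivative $w'$, and such that for some $N$ and $C_0$ $$|w(x)|\le C_0\,q(x;\lambda_0)\Big|\int_0^x|q(y;\lambda_0)|^{1/2}dy\Big|^N\qquad\text{for all sufficiently large }|x|.$$ Then there are a neighborhood $U$ of $\lambda_0$ and constants $\hbar_0,C>0$ such that for every $\hbar\in(0,\hbar_0]$ and every eigenvalue $\lambda=\lambda(\hbar)\in U$ of $H_\hbar$ with real normalized eigenfunction $\psi(x;\lambda,\hbar)$ (i.e. $\int_{-\infty}^\infty\psi^2dx=1$), $$\left|\int_{-\infty}^\infty w(x)\psi^2(x;\lambda,\hbar)\,dx-\frac{\int_{x_-(\lambda)}^{x_+(\lambda)}w(x)(\lambda-v(x))^{-1/2}dx}{\int_{x_-(\lambda)}^{x_+(\lambda)}(\lambda-v(x))^{-1/2}dx}\right|\le C\hbar^{1/3}.$$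
   Context: Let $v:\mathbb R\to\mathbb R$ and, for $\lambda\in\mathbb R$, $q(x)=q(x;\lambda)=v(x)-\lambda$. Assumption A at $\lambda$: $v\in C^2(\mathbb R)$ and, for some $\rho_0>1$, the function $\big(|q(x)|^{-3}q'(x)^2+q(x)^{-2}|q''(x)|\big)\big|\int_0^x|q(y)|^{1/2}dy\big|^{\rho_0}$ is bounded for sufficiently large $|x|$. Assumption B at $\lambda$: the equation $v(x)=\lambda$ has exactly two solutions $x_-(\lambda)<x_+(\lambda)$; $v(x)<\lambda$ for $x\in(x_-(\lambda),x_+(\lambda))$, $v(x)>\lambda$ for $x\notin[x_-(\lambda),x_+(\lambda)]$, $\liminf_{|x|\to\infty}v(x)>\lambda$; $v$ is of class $C^3$ in some neighborhoods of $x_\pm(\lambda)$ and $\pm v'(x_\pm(\lambda))>0$. (If B holds at $\lambda_0$, it holds for all $\lambda$ in a neighborhood of $\lambda_0$.) $H_\hbar=-\hbar^2\frac{d^2}{dx^2}+v(x)$ is the Schrödinger operator in $L^2(\mathbb R)$, $\hbar>0$; $\lambda$ is an eigenvalue if $-\hbar^2\psi''+v\psi=\lambda\psi$ has a nonzero solution $\psi\in L^2(\mathbb R)$. *)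

theory Defs
  imports "HOL-Analysis.Analysis"
begin

text \<open>\<open>C\<^sup>k\<close> on a set \<open>S\<close>, intended for open \<open>S\<close> only.\<close>

definition Ck_on :: "nat \<Rightarrow> (real \<Rightarrow> real) \<Rightarrow> real set \<Rightarrow> bool" where
  "Ck_on k f S \<longleftrightarrow>
     (\<forall>j<k. \<forall>x\<in>S. (deriv ^^ j) f field_differentiable (at x)) \<and> continuous_on S ((deriv ^^ k) f)"

definition qfun :: "(real \<Rightarrow> real) \<Rightarrow> real \<Rightarrow> real \<Rightarrow> real" where
  "qfun v l x = v x - l"

definition qphase :: "(real \<Rightarrow> real) \<Rightarrow> real \<Rightarrow> real \<Rightarrow> real" where
  "qphase v l x = \<bar>LBINT y=0..ereal x. sqrt \<bar>qfun v l y\<bar>\<bar>"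

text \<open>The requirement that \<open>q\<close> does not vanish for large \<open>\<bar>x\<bar>\<close>, implicit in the negative powers
  of \<open>\<bar>q\<bar>\<close>, is explicit here because division by zero is total in HOL.\<close>

definition assumption_A :: "(real \<Rightarrow> real) \<Rightarrow> real \<Rightarrow> bool" where
  "assumption_A v l \<longleftrightarrow>
     Ck_on 2 v UNIV \<and>
     (\<forall>\<^sub>F x in at_infinity. qfun v l x \<noteq> 0) \<and>
     (\<exists>\<rho>>1. Bfun (\<lambda>x. ((deriv (qfun v l) x)\<^sup>2 / \<bar>qfun v l x\<bar> ^ 3
                         + \<bar>deriv (deriv (qfun v l)) x\<bar> / (qfun v l x)\<^sup>2)
                       * qphase v l x powr \<rho>) at_infinity)"

text \<open>The turning points; meaningful when \<open>v x = l\<close> has exactly two solutions, as required by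
  \<open>assumption_B\<close>.\<close>

definition x_minus :: "(real \<Rightarrow> real) \<Rightarrow> real \<Rightarrow> real" where
  "x_minus v l = Min {x. v x = l}"

definition x_plus :: "(real \<Rightarrow> real) \<Rightarrow> real \<Rightarrow> real" where
  "x_plus v l = Max {x. v x = l}"

definition assumption_B :: "(real \<Rightarrow> real) \<Rightarrow> real \<Rightarrow> bool" where
  "assumption_B v l \<longleftrightarrow>
     card {x. v x = l} = 2 \<and>
     (\<forall>x\<in>{x_minus v l<..<x_plus v l}. v x < l) \<and>
     (\<forall>x. x \<notin> {x_minus v l..x_plus v l} \<longrightarrow> v x > l) \<and>
     Liminf at_infinity (\<lambda>x. ereal (v x)) > ereal l \<and>
     (\<exists>S. open S \<and> x_minus v l \<in> S \<and> Ck_on 3 v S) \<and>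
     (\<exists>S. open S \<and> x_plus v l \<in> S \<and> Ck_on 3 v S) \<and>
     deriv v (x_minus v l) < 0 \<and>
     deriv v (x_plus v l) > 0"

text \<open>Classical solutions: for continuous \<open>v\<close> every \<open>L\<^sup>2\<close> solution has a unique \<open>C\<^sup>2\<close>
  representative.  The codomain is left open so that both complex and real-valued eigenfunctions
  are covered.\<close>

definition eigenfunction ::
  "(real \<Rightarrow> real) \<Rightarrow> real \<Rightarrow> real \<Rightarrow> (real \<Rightarrow> 'a::real_normed_vector) \<Rightarrow> bool" where
  "eigenfunction v h l \<psi> \<longleftrightarrow>
     (\<exists>\<psi>' \<psi>''. \<forall>x. (\<psi> has_vector_derivative \<psi>' x) (at x) \<and>
                   (\<psi>' has_vector_derivative \<psi>'' x) (at x) \<and>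
                   - (h\<^sup>2 *\<^sub>R \<psi>'' x) + v x *\<^sub>R \<psi> x = l *\<^sub>R \<psi> x) \<and>
     integrable lebesgue (\<lambda>x. (norm (\<psi> x))\<^sup>2) \<and>
     (\<exists>x. \<psi> x \<noteq> 0)"

definition is_eigenvalue :: "(real \<Rightarrow> real) \<Rightarrow> real \<Rightarrow> real \<Rightarrow> bool" where
  "is_eigenvalue v h l \<longleftrightarrow> (\<exists>\<psi> :: real \<Rightarrow> complex. eigenfunction v h l \<psi>)"

end

theory Submission
  imports Defs
begin

text \<open>
  The argument is elementary and avoids Airy functions.  With \<open>p = l - v\<close> and \<open>E = h\<^sup>2 \<psi>'\<^sup>2 + p \<psi>\<^sup>2\<close> one has
  \<open>E' = p' \<psi>\<^sup>2\<close> and \<open>p \<psi>\<^sup>2 = E / 2 - h\<^sup>2 (\<psi> \<psi>')' / 2\<close>.  Integrating the oscillating term \<open>(\<psi> \<psi>')'\<close> by parts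
  shows that \<open>G = E / \<surd>p\<close> is constant up to a relative error \<open>h d\<^sup>-\<^sup>3\<^sup>/\<^sup>2\<close> at distance \<open>d\<close> from the turning point,
  and that the primitive of \<open>\<psi>\<^sup>2 - G(m) / (2 \<surd>p)\<close> is \<open>O(h / d)\<close>; and for \<open>d\<close> of order \<open>h\<^sup>2\<^sup>/\<^sup>3\<close> this is
  \<open>O(h\<^sup>1\<^sup>/\<^sup>3)\<close>.  Piecewise Lipschitz observables are then handled by a further integration by parts.
  Within \<open>h\<^sup>2\<^sup>/\<^sup>3\<close> of the turning point \<open>E\<close> is \<open>O(h\<^sup>1\<^sup>/\<^sup>3)\<close>, decreases outwards, and its loss bounds the mass of
  \<open>\<psi>\<^sup>2\<close>.  In the forbidden region \<open>\<psi> \<psi>' \<le> 0\<close>, and multiplying the equation by \<open>P\<^sup>n \<psi>\<close>, where \<open>P\<close> is the phase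
  integral, gives polynomially weighted tail bounds of order \<open>h\<^sup>2\<close>.  The left half-line follows by reflection,
  and the observable \<open>w = 1\<close> identifies the constant \<open>G(m) / 2\<close>.

  Throughout \<open>\<eta>\<close> stands for \<open>h\<^sup>1\<^sup>/\<^sup>3\<close>.
\<close>

section \<open>The classically allowed region\<close>

text \<open>The exponent 1/3 is a balance. If a strip of width d at the turning point is cut off,
  averaging up to the strip costs h / d, while the WKB mass of the strip is of order sqrt d; the two
  agree at d of order h^(2/3). At this scale the relative error of \<open>G\<close> is of order one,
  so there \<open>G\<close> is only controlled up to a factor of two, which suffices for a bound on
  \<open>E\<close>. No connection formula and no quantization condition enters: both half-lines
  refer to the value of \<open>G\<close> at the same interior point \<open>m\<close>, and a priori
  this value is merely bounded, through the normalization. Eigenvalues move with h, so every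
  constant must survive small changes of the energy and of its turning point; hence the long
  parameter list. The two gaps of width \<open>\<gamma>\<close> beyond \<open>b\<close> serve
  different ends: the first gives a bound on \<psi> \<psi>' from \<open>b1\<close> onwards that does
  not depend on h, the second turns the mass beyond \<open>b1\<close> into a pointwise bound on
  \<psi>^2 at \<open>b2\<close>, where the loss of \<open>E\<close> is evaluated.\<close>

text \<open>\<open>b\<close> is the right turning point at energy \<open>l\<close>, and \<open>m\<close> a point of the well.  All constants except
  \<open>b\<close> and \<open>l\<close> will be chosen independently of the energy.\<close>

locale right_well =
  fixes v v1 v2 :: "real \<Rightarrow> real" and m b l \<kappa> M L b1 b2 \<delta> \<gamma> k :: real
  assumes v: "\<And>x. (v has_real_derivative v1 x) (at x)"
    and v1: "\<And>x. (v1 has_real_derivative v2 x) (at x)"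
    and \<kappa>: "\<kappa> > 0" and M: "M > 0"
    and mb: "m < b" and L: "b - m \<le> L"
    and p_lower: "\<And>x. m \<le> x \<Longrightarrow> x \<le> b \<Longrightarrow> \<kappa>\<^sup>2 * (b - x) \<le> l - v x"
    and p_upper: "\<And>x. m \<le> x \<Longrightarrow> x \<le> b \<Longrightarrow> l - v x \<le> M * (b - x)"
    and v1_bd: "\<And>x. m \<le> x \<Longrightarrow> x \<le> b \<Longrightarrow> \<bar>v1 x\<bar> \<le> M"
    and v2_bd: "\<And>x. m \<le> x \<Longrightarrow> x \<le> b \<Longrightarrow> \<bar>v2 x\<bar> \<le> M"
    and \<delta>: "0 < \<delta>" "2 * \<delta> \<le> b - m" and \<gamma>: "0 < \<gamma>" "b + \<gamma> \<le> b1" "b1 + \<gamma> \<le> b2"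
    and k: "0 < k"
    and v1_lower: "\<And>x. b - \<delta> \<le> x \<Longrightarrow> x \<le> b2 \<Longrightarrow> k \<le> v1 x"
    and q_pos: "\<And>x. b < x \<Longrightarrow> l < v x"
    and q_lower: "\<And>x. b1 \<le> x \<Longrightarrow> k \<le> v x - l"
    and q_upper: "v b2 - l \<le> M"
    and vb: "v b = l"

text \<open>\<open>f\<close> solves \<open>- h\<^sup>2 f'' + v f = l f\<close>, with \<open>f' = f1\<close>.\<close>

locale half_well = right_well +
  fixes f f1 :: "real \<Rightarrow> real" and h :: real
  assumes f: "\<And>x. (f has_real_derivative f1 x) (at x)"
    and f1: "\<And>x. (f1 has_real_derivative (v x - l) * f x / h\<^sup>2) (at x)"
    and h: "h > 0"
begin

definition "s x = sqrt (l - v x)"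
definition "r x = sqrt (b - x)"
definition "E x = h\<^sup>2 * (f1 x)\<^sup>2 + (l - v x) * (f x)\<^sup>2"
definition "G x = E x / s x"
text \<open>Half the derivative of \<open>f\<^sup>2\<close>. In the well it carries the oscillation;
  beyond \<open>b\<close> it is the slope of a convex function.\<close>

definition "S x = f x * f1 x"

lemma E_deriv: "(E has_real_derivative - v1 x * (f x)\<^sup>2) (at x)"
  unfolding E_def[abs_def]
  apply (rule derivative_eq_intros v f f1 refl)+
  using h by (simp add: field_simps power2_eq_square)

lemma S_deriv: "(S has_real_derivative (f1 x)\<^sup>2 + (v x - l) * (f x)\<^sup>2 / h\<^sup>2) (at x)"
  unfolding S_def[abs_def]
  apply (rule derivative_eq_intros v f f1 refl)+
  using h by (simp add: field_simps power2_eq_square)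

lemma pos:
  assumes "m \<le> x" "x < b"
  shows "l - v x > 0" "s x > 0" "r x > 0" "\<kappa> * r x \<le> s x" "(s x)\<^sup>2 = l - v x" "(r x)\<^sup>2 = b - x" "(r x)\<^sup>2 \<le> L"
proof -
  have "0 < \<kappa>\<^sup>2 * (b - x)" using \<kappa> assms by simp
  then show "l - v x > 0" using p_lower[OF _ less_imp_le] assms by (meson less_le_trans)
  then show "s x > 0" "(s x)\<^sup>2 = l - v x" by (simp_all add: s_def)
  show "r x > 0" "(r x)\<^sup>2 = b - x" using assms by (simp_all add: r_def)
  then show "(r x)\<^sup>2 \<le> L" using L assms by simp
  have "sqrt (\<kappa>\<^sup>2 * (b - x)) \<le> s x" unfolding s_def
    using p_lower[of x] assms by (intro real_sqrt_le_mono) auto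
  then show "\<kappa> * r x \<le> s x" using \<kappa> by (simp add: r_def real_sqrt_mult)
qed

lemma s_deriv:
  assumes "m \<le> x" "x < b"
  shows "(s has_real_derivative - v1 x / (2 * s x)) (at x)"
proof -
  have "(s has_real_derivative inverse (sqrt (l - v x)) / 2 * (0 - v1 x)) (at x)"
    unfolding s_def[abs_def]
    by (rule DERIV_chain2[OF DERIV_real_sqrt[OF pos(1)[OF assms]] DERIV_diff[OF DERIV_const v]])
  moreover have "inverse (sqrt (l - v x)) / 2 * (0 - v1 x) = - v1 x / (2 * s x)"
    by (simp add: s_def inverse_eq_divide)
  ultimately show ?thesis by (simp only:)
qed

lemma r_deriv:
  assumes "m \<le> x" "x < b"
  shows "(r has_real_derivative - 1 / (2 * r x)) (at x)"
proof -
  have "b - x > 0" using assms by simp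
  then have "(r has_real_derivative inverse (sqrt (b - x)) / 2 * (0 - 1)) (at x)"
    unfolding r_def[abs_def]
    by (rule DERIV_chain2[OF DERIV_real_sqrt DERIV_diff[OF DERIV_const DERIV_ident]])
  moreover have "inverse (sqrt (b - x)) / 2 * (0 - 1) = - 1 / (2 * r x)"
    by (simp add: r_def inverse_eq_divide)
  ultimately show ?thesis by (simp only:)
qed

text \<open>Error terms are measured in powers of \<open>1 / r\<close>, because these have explicit
  primitives: each integration up to the turning point lowers the exponent by two, from 5 to 3 for
  \<open>G\<close> and from 4 to 2 for the mass.\<close>

lemma r_inv_deriv:
  assumes "m \<le> x" "x < b"
  shows "((\<lambda>x. c / r x ^ n) has_real_derivative (c * n / 2) / r x ^ (n + 2)) (at x)"
proof (cases n)
  case (Suc k)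
  have r: "r x > 0" using pos[OF assms] by simp
  have "((\<lambda>x. c / r x ^ n) has_real_derivative
      (0 * r x ^ n - c * (of_nat n * (- 1 / (2 * r x) * r x ^ (n - Suc 0)))) / (r x ^ n * r x ^ n)) (at x)"
    using r by (intro DERIV_divide DERIV_const DERIV_power r_deriv assms) simp
  also have "(0 * r x ^ n - c * (of_nat n * (- 1 / (2 * r x) * r x ^ (n - Suc 0)))) / (r x ^ n * r x ^ n)
     = (c * n / 2) / r x ^ (n + 2)"
    using r Suc by (simp add: divide_simps power2_eq_square)
  finally show ?thesis .
qed simp

lemma E_nonneg: assumes "m \<le> x" "x < b" shows "E x \<ge> 0"
  using pos(1)[OF assms] by (simp add: E_def)

lemma G_nonneg: assumes "m \<le> x" "x < b" shows "G x \<ge> 0"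
  using pos(2)[OF assms] E_nonneg[OF assms] by (simp add: G_def)

text \<open>\<open>E\<close> is the sum of the squares of \<open>h * f1\<close> and
  \<open>s * f\<close>, so this is the arithmetic-geometric mean inequality. A factor
  \<open>h\<^sup>2\<close> in front of \<open>S\<close> thus leaves a term of order h.\<close>

lemma S_bd: assumes "m \<le> x" "x < b" shows "\<bar>S x\<bar> \<le> G x / (2 * h)"
proof -
  note P = pos[OF assms]
  have "2 * \<bar>(h * f1 x) * (s x * f x)\<bar> \<le> (h * f1 x)\<^sup>2 + (s x * f x)\<^sup>2"
    using sum_squares_bound[of "\<bar>h * f1 x\<bar>" "\<bar>s x * f x\<bar>"] by (simp add: abs_mult power_mult_distrib mult_ac)
  also have "\<dots> = E x" using P by (simp add: E_def power_mult_distrib)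
  also have "2 * \<bar>(h * f1 x) * (s x * f x)\<bar> = 2 * h * s x * \<bar>S x\<bar>"
    using h P by (simp add: S_def abs_mult)
  finally have "2 * h * s x * \<bar>S x\<bar> \<le> E x" .
  then show ?thesis using h P by (simp add: G_def field_simps)
qed

text \<open>The oscillating part of \<open>G\<close> is removed, so that the derivative of \<open>Gh\<close> is of order \<open>h\<close>.\<close>

definition "Gh x = G x - h\<^sup>2 / 2 * (v1 x / (s x)^3) * S x"

text \<open>The last factor is the derivative of \<open>S\<close>. Hence the derivative of
  \<open>G\<close> is a total derivative up to the slowly varying coefficient
  \<open>v1 / s ^ 3\<close>, which is what the correction in \<open>Gh\<close> exploits.\<close>

lemma G_deriv:
  assumes "m \<le> x" "x < b"
  shows "(G has_real_derivative h\<^sup>2 / 2 * (v1 x / (s x)^3) * ((f1 x)\<^sup>2 + (v x - l) * (f x)\<^sup>2 / h\<^sup>2)) (at x)"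
proof -
  note P = pos[OF assms]
  define \<sigma> where "\<sigma> = s x"
  have \<sigma>: "\<sigma> > 0" using P by (simp add: \<sigma>_def)
  have vx: "v x - l = - \<sigma>\<^sup>2" "l - v x = \<sigma>\<^sup>2" using P by (simp_all add: \<sigma>_def)
  have "(G has_real_derivative (- v1 x * (f x)\<^sup>2 * s x - E x * (- v1 x / (2 * s x))) / (s x * s x)) (at x)"
    unfolding G_def[abs_def] using P by (intro DERIV_divide E_deriv s_deriv assms) simp
  also have "(- v1 x * (f x)\<^sup>2 * s x - E x * (- v1 x / (2 * s x))) / (s x * s x)
     = h\<^sup>2 / 2 * (v1 x / (s x)^3) * ((f1 x)\<^sup>2 + (v x - l) * (f x)\<^sup>2 / h\<^sup>2)"
    unfolding E_def vx \<sigma>_def[symmetric] using \<sigma> h by (simp add: field_simps power2_eq_square power3_eq_cube)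
  finally show ?thesis .
qed

lemma \<theta>_deriv:
  assumes "m \<le> x" "x < b"
  shows "((\<lambda>x. v1 x / (s x)^3) has_real_derivative v2 x / (s x)^3 + 3 * (v1 x)\<^sup>2 / (2 * (s x)^5)) (at x)"
proof -
  have s: "s x > 0" using pos[OF assms] by simp
  have "((\<lambda>x. v1 x / (s x)^3) has_real_derivative
      (v2 x * (s x)^3 - v1 x * (of_nat 3 * (- v1 x / (2 * s x) * s x ^ (3 - Suc 0)))) / ((s x)^3 * (s x)^3)) (at x)"
    using s by (intro DERIV_divide DERIV_power v1 s_deriv assms) simp
  also have "(v2 x * (s x)^3 - v1 x * (of_nat 3 * (- v1 x / (2 * s x) * s x ^ (3 - Suc 0)))) / ((s x)^3 * (s x)^3)
    = v2 x / (s x)^3 + 3 * (v1 x)\<^sup>2 / (2 * (s x)^5)"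
    using s by (simp add: divide_simps power2_eq_square eval_nat_numeral) (simp add: algebra_simps)?
  finally show ?thesis .
qed

lemma Gh_deriv:
  assumes "m \<le> x" "x < b"
  shows "(Gh has_real_derivative
     - h\<^sup>2 / 2 * (v2 x / (s x)^3 + 3 * (v1 x)\<^sup>2 / (2 * (s x)^5)) * S x) (at x)"
proof -
  have "(Gh has_real_derivative
     h\<^sup>2 / 2 * (v1 x / (s x)^3) * ((f1 x)\<^sup>2 + (v x - l) * (f x)\<^sup>2 / h\<^sup>2) -
     (h\<^sup>2 / 2 * (v2 x / (s x)^3 + 3 * (v1 x)\<^sup>2 / (2 * (s x)^5)) * S x +
      ((f1 x)\<^sup>2 + (v x - l) * (f x)\<^sup>2 / h\<^sup>2) * (h\<^sup>2 / 2 * (v1 x / (s x)^3)))) (at x)"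
    unfolding Gh_def[abs_def] by (intro DERIV_diff DERIV_mult DERIV_cmult G_deriv \<theta>_deriv S_deriv assms)
  then show ?thesis by (simp add: mult_ac)
qed

text \<open>\<open>A1\<close> measures the correction \<open>Gh - G\<close>, \<open>A2\<close> the
  derivative of \<open>Gh\<close>. The factor \<open>L\<close> in \<open>A2\<close> comes from
  trading \<open>r\<^sup>2 \<le> L\<close> for two powers of \<open>r\<close>, so that both of its
  terms are of the form \<open>1 / r ^ 5\<close>. In \<open>A\<close> the correction counts twice,
  once for each endpoint.\<close>

definition "A1 = M / (4 * \<kappa>^3)"
definition "A2 = M * L / \<kappa>^3 + 3 * M\<^sup>2 / (2 * \<kappa>^5)"
definition "A = 2 * A1 + A2"

lemma L_pos: "L > 0" using mb L by linarith
lemma A1_pos: "A1 > 0" using M \<kappa> by (simp add: A1_def)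
lemma A2_pos: "A2 > 0" using M \<kappa> L_pos by (simp add: A2_def add_pos_pos)

lemma inv_s_pow: assumes "m \<le> x" "x < b" shows "1 / s x ^ n \<le> 1 / (\<kappa> ^ n * r x ^ n)"
proof -
  note P = pos[OF assms]
  have "(\<kappa> * r x) ^ n \<le> s x ^ n" using P \<kappa> by (intro power_mono) auto
  then show ?thesis using P \<kappa> by (intro frac_le) (auto simp: power_mult_distrib)
qed

lemma Gh_G: assumes "m \<le> x" "x < b" shows "\<bar>Gh x - G x\<bar> \<le> h * A1 * G x / r x ^ 3"
proof -
  note P = pos[OF assms]
  have "\<bar>Gh x - G x\<bar> = h\<^sup>2 / 2 * (\<bar>v1 x\<bar> * (1 / s x ^ 3)) * \<bar>S x\<bar>"
    using P by (simp add: Gh_def abs_mult)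
  also have "\<dots> \<le> h\<^sup>2 / 2 * (M * (1 / (\<kappa> ^ 3 * r x ^ 3))) * (G x / (2 * h))"
    using P h M \<kappa> G_nonneg[OF assms] v1_bd[of x] assms
    by (intro mult_mono inv_s_pow S_bd) auto
  also have "\<dots> = h * A1 * G x / r x ^ 3"
    using h by (simp add: A1_def field_simps power2_eq_square)
  finally show ?thesis .
qed

lemma Gh'_bd: assumes "m \<le> x" "x < b"
  shows "\<bar>- h\<^sup>2 / 2 * (v2 x / (s x)^3 + 3 * (v1 x)\<^sup>2 / (2 * (s x)^5)) * S x\<bar> \<le> h * A2 / 4 * G x / r x ^ 5"
proof -
  note P = pos[OF assms]
  have "\<bar>v2 x / (s x)^3 + 3 * (v1 x)\<^sup>2 / (2 * (s x)^5)\<bar> \<le> \<bar>v2 x\<bar> * (1 / s x ^ 3) + (3 / 2 * \<bar>v1 x\<bar>\<^sup>2) * (1 / s x ^ 5)"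
    using P by (intro order_trans[OF abs_triangle_ineq]) (simp add: abs_mult)
  also have "\<dots> \<le> M * (1 / (\<kappa> ^ 3 * r x ^ 3)) + (3 / 2 * M\<^sup>2) * (1 / (\<kappa> ^ 5 * r x ^ 5))"
    using P M v1_bd[of x] v2_bd[of x] assms
    by (intro add_mono mult_mono inv_s_pow) (auto intro: abs_le_square_iff[THEN iffD1] power_mono)
  also have "M * (1 / (\<kappa> ^ 3 * r x ^ 3)) = M * (r x)\<^sup>2 / (\<kappa> ^ 3 * r x ^ 5)"
    using P by (simp add: field_simps eval_nat_numeral)
  also have "\<dots> \<le> M * L / (\<kappa> ^ 3 * r x ^ 5)"
    using P M \<kappa> by (intro divide_right_mono mult_left_mono) auto
  also have "M * L / (\<kappa> ^ 3 * r x ^ 5) + (3 / 2 * M\<^sup>2) * (1 / (\<kappa> ^ 5 * r x ^ 5)) = A2 / r x ^ 5"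
    using P \<kappa> by (simp add: A2_def field_simps)
  finally have 1: "\<bar>v2 x / (s x)^3 + 3 * (v1 x)\<^sup>2 / (2 * (s x)^5)\<bar> \<le> A2 / r x ^ 5" by simp
  have "\<bar>- h\<^sup>2 / 2 * (v2 x / (s x)^3 + 3 * (v1 x)\<^sup>2 / (2 * (s x)^5)) * S x\<bar>
    = h\<^sup>2 / 2 * \<bar>v2 x / (s x)^3 + 3 * (v1 x)\<^sup>2 / (2 * (s x)^5)\<bar> * \<bar>S x\<bar>"
    by (simp add: abs_mult)
  also have "\<dots> \<le> h\<^sup>2 / 2 * (A2 / r x ^ 5) * (G x / (2 * h))"
    using P h 1 A2_pos by (intro mult_mono S_bd assms) auto
  also have "\<dots> = h * A2 / 4 * G x / r x ^ 5"
    using h by (simp add: field_simps power2_eq_square)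
  finally show ?thesis .
qed

end

text \<open>Both \<open>g - F\<close> and \<open>g + F\<close> are nondecreasing. This integrates an
  inequality between derivatives that are known only pointwise.\<close>

lemma majorant_bound:
  fixes F g :: "real \<Rightarrow> real"
  assumes "a \<le> c" and F: "\<And>x. a \<le> x \<Longrightarrow> x \<le> c \<Longrightarrow> (F has_real_derivative F' x) (at x)"
    and g: "\<And>x. a \<le> x \<Longrightarrow> x \<le> c \<Longrightarrow> (g has_real_derivative g' x) (at x)"
    and le: "\<And>x. a \<le> x \<Longrightarrow> x \<le> c \<Longrightarrow> \<bar>F' x\<bar> \<le> g' x"
  shows "\<bar>F c - F a\<bar> \<le> g c - g a"
proof -
  have "(\<lambda>x. g x - F x) a \<le> (\<lambda>x. g x - F x) c"
    by (rule DERIV_nonneg_imp_nondecreasing[OF assms(1)])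
       (use le in \<open>force intro!: derivative_eq_intros F g\<close>)
  moreover have "(\<lambda>x. g x + F x) a \<le> (\<lambda>x. g x + F x) c"
    by (rule DERIV_nonneg_imp_nondecreasing[OF assms(1)])
       (use le in \<open>force intro!: derivative_eq_intros F g\<close>)
  ultimately show ?thesis by simp
qed

section \<open>Near-constancy of \<open>G\<close> up to the turning point\<close>

context half_well
begin

lemma r_antimono: "x \<le> y \<Longrightarrow> r y \<le> r x" by (simp add: r_def)

lemma G_cont: assumes "x < b" shows "continuous_on {m..x} G"
  unfolding G_def[abs_def]
  by (rule continuous_at_imp_continuous_on, intro ballI continuous_divide
      DERIV_isCont[OF E_deriv] DERIV_isCont[OF s_deriv])
     (use assms pos in \<open>force+\<close>)

text \<open>The bound \<open>g\<close> enters linearly, so that it can later be absorbed. Since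
  \<open>r\<close> decreases, the errors at \<open>m\<close> and at \<open>x\<close> are both
  dominated by the error at \<open>x\<close>.\<close>

lemma G_variation:
  assumes x: "m \<le> x" "x < b" and gm: "\<And>t. m \<le> t \<Longrightarrow> t \<le> x \<Longrightarrow> G t \<le> g"
  shows "\<bar>G x - G m\<bar> \<le> h * A * g / r x ^ 3"
proof -
  note P = pos[OF x]
  have g0: "g \<ge> 0" using gm[of m] G_nonneg[of m] x by linarith
  have rd: "((\<lambda>t. h * A2 * g / 6 / r t ^ 3) has_real_derivative h * A2 / 4 * g / r t ^ 5) (at t)"
    if "m \<le> t" "t \<le> x" for t
    using r_inv_deriv[of t "h * A2 * g / 6" 3] that x by (simp add: mult_ac)
  have "\<bar>Gh x - Gh m\<bar> \<le> h * A2 * g / 6 / r x ^ 3 - h * A2 * g / 6 / r m ^ 3"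
  proof (rule majorant_bound[where F' = "\<lambda>x. - h\<^sup>2 / 2 * (v2 x / (s x)^3 + 3 * (v1 x)\<^sup>2 / (2 * (s x)^5)) * S x" and g' = "\<lambda>t. h * A2 / 4 * g / r t ^ 5"])
    fix t assume t: "m \<le> t" "t \<le> x"
    show "(Gh has_real_derivative - h\<^sup>2 / 2 * (v2 t / (s t)^3 + 3 * (v1 t)\<^sup>2 / (2 * (s t)^5)) * S t) (at t)"
      using t x by (intro Gh_deriv) auto
    have "\<bar>- h\<^sup>2 / 2 * (v2 t / (s t)^3 + 3 * (v1 t)\<^sup>2 / (2 * (s t)^5)) * S t\<bar> \<le> h * A2 / 4 * G t / r t ^ 5"
      using t x by (intro Gh'_bd) auto
    also have "\<dots> \<le> h * A2 / 4 * g / r t ^ 5"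
      using t x pos[of t] h A2_pos gm[of t] by (intro divide_right_mono mult_left_mono) auto
    finally show "\<bar>- h\<^sup>2 / 2 * (v2 t / (s t)^3 + 3 * (v1 t)\<^sup>2 / (2 * (s t)^5)) * S t\<bar> \<le> h * A2 / 4 * g / r t ^ 5" .
  qed (use x rd in auto)
  moreover have "0 \<le> h * A2 * g / 6 / r m ^ 3" using h A2_pos g0 pos[of m] mb by simp
  moreover have "\<bar>Gh t - G t\<bar> \<le> h * A1 * g / r x ^ 3" if t: "m \<le> t" "t \<le> x" for t
  proof -
    have "\<bar>Gh t - G t\<bar> \<le> h * A1 * G t / r t ^ 3" using t x by (intro Gh_G) auto
    also have "\<dots> \<le> h * A1 * g / r x ^ 3"
      using t x h A1_pos gm[of t] g0 P r_antimono[of t x] by (intro frac_le mult_left_mono power_mono) auto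
    finally show ?thesis .
  qed
  from this[of m] this[of x] have "\<bar>Gh m - G m\<bar> \<le> h * A1 * g / r x ^ 3" "\<bar>Gh x - G x\<bar> \<le> h * A1 * g / r x ^ 3"
    using x by auto
  moreover have "h * A * g / r x ^ 3 = 2 * (h * A1 * g / r x ^ 3) + 6 * (h * A2 * g / 6 / r x ^ 3)"
    by (simp add: A_def algebra_simps add_divide_distrib)
  moreover have "0 \<le> h * A2 * g / 6 / r x ^ 3" using h A2_pos g0 P by simp
  ultimately show ?thesis by linarith
qed

lemma A_pos: "A > 0" using A1_pos A2_pos by (simp add: A_def)

text \<open>Comparing with the maximum of \<open>G\<close> on \<open>{m..x}\<close> replaces a Gronwall argument for \<open>ln Gh\<close>, which would
  need \<open>Gh > 0\<close>.\<close>

lemma G_close: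
  assumes x: "m \<le> x" "x < b" and small: "2 * h * A \<le> r x ^ 3"
  shows "G x \<le> 2 * G m" "\<bar>G x - G m\<bar> \<le> 2 * h * A * G m / r x ^ 3"
proof -
  have "compact {m..x}" "{m..x} \<noteq> {}" using x by auto
  from continuous_attains_sup[OF this G_cont[OF x(2)]]
  obtain z where z: "m \<le> z" "z \<le> x" and zm: "\<And>t. m \<le> t \<Longrightarrow> t \<le> x \<Longrightarrow> G t \<le> G z" by auto
  note P = pos[OF x]
  have Gz: "0 \<le> G z" using z x by (intro G_nonneg) auto
  have "\<bar>G z - G m\<bar> \<le> h * A * G z / r z ^ 3" using z x zm by (intro G_variation) auto
  also have "\<dots> \<le> h * A * G z / r x ^ 3"
    using P h A_pos Gz r_antimono[of z x] z by (intro divide_left_mono power_mono mult_pos_pos) (auto intro!: zero_less_power)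
  also have "\<dots> = (2 * h * A / r x ^ 3) * (G z / 2)" by simp
  also have "\<dots> \<le> 1 * (G z / 2)" using small P Gz by (intro mult_right_mono) (auto simp: divide_le_eq)
  finally have 1: "G z \<le> 2 * G m" by linarith
  then show "G x \<le> 2 * G m" using zm[of x] x by linarith
  have "\<bar>G x - G m\<bar> \<le> h * A * (2 * G m) / r x ^ 3"
    using x zm 1 by (intro G_variation) (auto intro: order_trans)
  then show "\<bar>G x - G m\<bar> \<le> 2 * h * A * G m / r x ^ 3" by (simp add: mult_ac)
qed

section \<open>Averaging the density over its oscillations\<close>

definition "B = A / \<kappa> + M / (2 * \<kappa>^4) + 1 / \<kappa>\<^sup>2"

lemma B_pos: "B > 0" using A_pos \<kappa> M by (simp add: B_def add_pos_pos)

lemma mass_deriv: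
  assumes "m \<le> x" "x < b"
  shows "((\<lambda>x. h\<^sup>2 * S x / (2 * (s x)\<^sup>2)) has_real_derivative
     - ((f x)\<^sup>2 - G x / (2 * s x)) + h\<^sup>2 * S x * v1 x / (2 * (s x)^4)) (at x)"
proof -
  note P = pos[OF assms]
  define \<sigma> where "\<sigma> = s x"
  have \<sigma>: "\<sigma> > 0" using P by (simp add: \<sigma>_def)
  have vx: "v x - l = - \<sigma>\<^sup>2" "l - v x = \<sigma>\<^sup>2" using P by (simp_all add: \<sigma>_def)
  have "((\<lambda>x. h\<^sup>2 * S x / (2 * (s x)\<^sup>2)) has_real_derivative
     (h\<^sup>2 * ((f1 x)\<^sup>2 + (v x - l) * (f x)\<^sup>2 / h\<^sup>2) * (2 * (s x)\<^sup>2)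
      - h\<^sup>2 * S x * (2 * (2 * s x * (- v1 x / (2 * s x))))) / ((2 * (s x)\<^sup>2) * (2 * (s x)\<^sup>2))) (at x)"
  proof -
    have "((\<lambda>x. 2 * (s x)\<^sup>2) has_real_derivative 2 * (2 * s x * (- v1 x / (2 * s x)))) (at x)"
      using DERIV_cmult[OF DERIV_power[OF s_deriv[OF assms], of 2], of 2] P(2) by (simp add: mult_ac)
    moreover have "2 * (s x)\<^sup>2 \<noteq> 0" using P(2) by simp
    ultimately show ?thesis by (rule DERIV_divide[OF DERIV_cmult[OF S_deriv]])
  qed
  also have "(h\<^sup>2 * ((f1 x)\<^sup>2 + (v x - l) * (f x)\<^sup>2 / h\<^sup>2) * (2 * (s x)\<^sup>2)
      - h\<^sup>2 * S x * (2 * (2 * s x * (- v1 x / (2 * s x))))) / ((2 * (s x)\<^sup>2) * (2 * (s x)\<^sup>2))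
    = - ((f x)\<^sup>2 - G x / (2 * s x)) + h\<^sup>2 * S x * v1 x / (2 * (s x)^4)"
    unfolding G_def E_def vx \<sigma>_def[symmetric] using \<sigma> h by (simp add: field_simps power2_eq_square eval_nat_numeral)
  finally show ?thesis .
qed

lemma mass_estimate:
  assumes x: "m \<le> x" "x < b" and small: "2 * h * A \<le> r x ^ 3"
  shows "\<bar>integral {m..x} (\<lambda>t. (f t)\<^sup>2 - G m / (2 * s t))\<bar> \<le> B * h * G m / (r x)\<^sup>2"
proof -
  note P = pos[OF x]
  define \<phi> where "\<phi> t = (f t)\<^sup>2 - G m / (2 * s t)" for t
  define T where "T t = h\<^sup>2 * S t / (2 * (s t)\<^sup>2)" for t
  have G0: "G m \<ge> 0" using G_nonneg[of m] mb by simp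
  \<comment> \<open>\<open>B0\<close> collects the two interior errors, from replacing
    \<open>G t\<close> by \<open>G m\<close> and from the derivative of
    \<open>1 / s\<^sup>2\<close>. The remaining summand of \<open>B\<close> pays for the two
    boundary values of \<open>T\<close>.\<close>
  define B0 where "B0 = A / \<kappa> + M / (2 * \<kappa>^4)"
  have cont: "isCont \<phi> t" if "m \<le> t" "t \<le> x" for t
    unfolding \<phi>_def using that x pos[of t] DERIV_isCont[OF f, of t] DERIV_isCont[OF s_deriv, of t]
    by (intro continuous_intros) auto
  have sm: "2 * h * A \<le> r t ^ 3" if "m \<le> t" "t \<le> x" for t
  proof -
    have "r x ^ 3 \<le> r t ^ 3" using r_antimono[of t x] that P by (intro power_mono) auto
    then show ?thesis using small by linarith
  qed
  have Td: "(T has_real_derivative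
      - ((f t)\<^sup>2 - G t / (2 * s t)) + h\<^sup>2 * S t * v1 t / (2 * (s t)^4)) (at t within {m..x})"
    if "t \<in> {m..x}" for t
  proof -
    have "m \<le> t" "t < b" using that x by auto
    from has_field_derivative_at_within[OF mass_deriv[OF this]] show ?thesis
      unfolding T_def[abs_def] .
  qed
  have phi: "(\<phi> has_integral integral {m..x} \<phi>) {m..x}"
    by (intro integrable_integral integrable_continuous_interval continuous_at_imp_continuous_on ballI cont) auto
  have Ti: "((\<lambda>t. - ((f t)\<^sup>2 - G t / (2 * s t)) + h\<^sup>2 * S t * v1 t / (2 * (s t)^4)) has_integral (T x - T m)) {m..x}"
    using Td x by (intro fundamental_theorem_of_calculus) (auto simp: has_real_derivative_iff_has_vector_derivative)
  have sum: "((\<lambda>t. \<phi> t + (- ((f t)\<^sup>2 - G t / (2 * s t)) + h\<^sup>2 * S t * v1 t / (2 * (s t)^4)))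
     has_integral (integral {m..x} \<phi> + (T x - T m))) {m..x}"
    by (rule has_integral_add[OF phi Ti])
  have rd: "((\<lambda>t. h * G m * B0 / (r t)\<^sup>2) has_real_derivative h * G m * B0 / r t ^ 4) (at t within {m..x})"
    if "t \<in> {m..x}" for t
  proof -
    have "m \<le> t" "t < b" using that x by auto
    moreover have "h * G m * B0 * real 2 / 2 / r t ^ (2 + 2) = h * G m * B0 / r t ^ 4" by simp
    ultimately show ?thesis
      using has_field_derivative_at_within[OF r_inv_deriv[of t "h * G m * B0" 2]] by metis
  qed
  have maj: "((\<lambda>t. h * G m * B0 / r t ^ 4) has_integral (h * G m * B0 / (r x)\<^sup>2 - h * G m * B0 / (r m)\<^sup>2)) {m..x}"
    using rd x by (intro fundamental_theorem_of_calculus) (auto simp: has_real_derivative_iff_has_vector_derivative)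
  have le: "norm (\<phi> t + (- ((f t)\<^sup>2 - G t / (2 * s t)) + h\<^sup>2 * S t * v1 t / (2 * (s t)^4))) \<le> h * G m * B0 / r t ^ 4"
    if t: "t \<in> {m..x}" for t
  proof -
    have t': "m \<le> t" "t < b" "t \<le> x" using t x by auto
    note Q = pos[OF t'(1,2)] note GC = G_close[OF t'(1,2) sm[OF t'(1,3)]]
    \<comment> \<open>Adding the derivative of \<open>T\<close> to \<open>\<phi>\<close> cancels the
      oscillation. Both remainders are of size h times \<open>1 / r ^ 4\<close>: the first is a
      relative error of order \<open>1 / r ^ 3\<close> times \<open>1 / s\<close>, the second is
      controlled by \<open>S_bd\<close>.\<close>
    have eq: "\<phi> t + (- ((f t)\<^sup>2 - G t / (2 * s t)) + h\<^sup>2 * S t * v1 t / (2 * (s t)^4))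
       = (G t - G m) / 2 * (1 / s t ^ 1) + h\<^sup>2 / 2 * S t * v1 t * (1 / s t ^ 4)"
      using Q by (simp add: \<phi>_def field_simps)
    have "norm ((G t - G m) / 2 * (1 / s t ^ 1) + h\<^sup>2 / 2 * S t * v1 t * (1 / s t ^ 4))
        \<le> \<bar>G t - G m\<bar> / 2 * (1 / s t ^ 1) + h\<^sup>2 / 2 * \<bar>S t\<bar> * \<bar>v1 t\<bar> * (1 / s t ^ 4)"
      unfolding real_norm_def using Q by (intro order_trans[OF abs_triangle_ineq]) (simp add: abs_mult)
    also have "\<dots> \<le> (2 * h * A * G m / r t ^ 3) / 2 * (1 / (\<kappa> ^ 1 * r t ^ 1))
       + h\<^sup>2 / 2 * ((2 * G m) / (2 * h)) * M * (1 / (\<kappa> ^ 4 * r t ^ 4))"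
    proof (rule add_mono)
      have "\<bar>S t\<bar> \<le> G t / (2 * h)" by (rule S_bd[OF t'(1,2)])
      also have "\<dots> \<le> 2 * G m / (2 * h)" using h GC by (intro divide_right_mono) auto
      finally have "h\<^sup>2 / 2 * \<bar>S t\<bar> \<le> h\<^sup>2 / 2 * (2 * G m / (2 * h))" by (intro mult_left_mono) auto
      moreover have "\<bar>v1 t\<bar> \<le> M" using t' by (intro v1_bd) auto
      moreover have "0 \<le> h\<^sup>2 / 2 * (2 * G m / (2 * h))" using h G0 by simp
      ultimately have "h\<^sup>2 / 2 * \<bar>S t\<bar> * \<bar>v1 t\<bar> \<le> h\<^sup>2 / 2 * ((2 * G m) / (2 * h)) * M"
        by (rule mult_mono) simp
      moreover have "0 \<le> h\<^sup>2 / 2 * ((2 * G m) / (2 * h)) * M" using h G0 M by simp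
      moreover have "0 \<le> 1 / s t ^ 4" by simp
      ultimately show "h\<^sup>2 / 2 * \<bar>S t\<bar> * \<bar>v1 t\<bar> * (1 / s t ^ 4)
          \<le> h\<^sup>2 / 2 * ((2 * G m) / (2 * h)) * M * (1 / (\<kappa> ^ 4 * r t ^ 4))"
        using inv_s_pow[OF t'(1,2), of 4] by - (rule mult_mono)
      have "\<bar>G t - G m\<bar> / 2 \<le> (2 * h * A * G m / r t ^ 3) / 2" using GC(2) by (intro divide_right_mono) auto
      moreover have "0 \<le> (2 * h * A * G m / r t ^ 3) / 2" using Q h A_pos G0 by simp
      moreover have "0 \<le> 1 / s t ^ 1" using Q by simp
      ultimately show "\<bar>G t - G m\<bar> / 2 * (1 / s t ^ 1) \<le> (2 * h * A * G m / r t ^ 3) / 2 * (1 / (\<kappa> ^ 1 * r t ^ 1))"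
        using inv_s_pow[OF t'(1,2), of 1] by - (rule mult_mono)
    qed
    also have "\<dots> = h * G m * B0 / r t ^ 4"
      using Q(3) h \<kappa> by (simp add: B0_def field_simps eval_nat_numeral)
    finally show ?thesis unfolding eq .
  qed
  have "norm (integral {m..x} \<phi> + (T x - T m)) \<le> h * G m * B0 / (r x)\<^sup>2 - h * G m * B0 / (r m)\<^sup>2"
    using integral_norm_bound_integral[OF has_integral_integrable[OF sum] has_integral_integrable[OF maj] le]
      integral_unique[OF sum] integral_unique[OF maj] by simp
  moreover have "0 \<le> h * G m * B0 / (r m)\<^sup>2"
    using h G0 A_pos \<kappa> M by (auto simp: B0_def)
  moreover have T: "\<bar>T t\<bar> \<le> h * G m / (2 * \<kappa>\<^sup>2 * (r x)\<^sup>2)" if t: "m \<le> t" "t \<le> x" for t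
  proof -
    have t': "m \<le> t" "t < b" using t x by auto
    note Q = pos[OF t'] note GC = G_close[OF t' sm[OF t]]
    have "\<bar>T t\<bar> = h\<^sup>2 / 2 * \<bar>S t\<bar> * (1 / s t ^ 2)" using Q(2) by (simp add: T_def abs_mult)
    also have "\<dots> \<le> h\<^sup>2 / 2 * ((2 * G m) / (2 * h)) * (1 / (\<kappa> ^ 2 * r x ^ 2))"
    proof (rule mult_mono)
      have "\<bar>S t\<bar> \<le> G t / (2 * h)" by (rule S_bd[OF t'])
      also have "\<dots> \<le> 2 * G m / (2 * h)" using h GC by (intro divide_right_mono) auto
      finally show "h\<^sup>2 / 2 * \<bar>S t\<bar> \<le> h\<^sup>2 / 2 * (2 * G m / (2 * h))" by (intro mult_left_mono) auto
      have "1 / s t ^ 2 \<le> 1 / (\<kappa> ^ 2 * r t ^ 2)" by (rule inv_s_pow[OF t'])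
      also have "\<dots> \<le> 1 / (\<kappa> ^ 2 * r x ^ 2)" using P(3) \<kappa> r_antimono[of t x] t Q(3)
        by (intro divide_left_mono mult_left_mono power_mono mult_pos_pos) auto
      finally show "1 / s t ^ 2 \<le> 1 / (\<kappa> ^ 2 * r x ^ 2)" .
      show "0 \<le> h\<^sup>2 / 2 * (2 * G m / (2 * h))" using h G0 by simp
    qed simp
    also have "\<dots> = h * G m / (2 * \<kappa>\<^sup>2 * (r x)\<^sup>2)" using h by (simp add: field_simps power2_eq_square)
    finally show ?thesis .
  qed
  moreover have "B * h * G m / (r x)\<^sup>2 = h * G m * B0 / (r x)\<^sup>2 + 2 * (h * G m / (2 * \<kappa>\<^sup>2 * (r x)\<^sup>2))"
    using \<kappa> P(3) by (simp add: B_def B0_def field_simps)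
  ultimately have "\<bar>integral {m..x} \<phi>\<bar> \<le> B * h * G m / (r x)\<^sup>2"
    using T[of m] T[of x] x by (smt (verit) real_norm_def)
  then show ?thesis by (simp add: \<phi>_def[abs_def])
qed

end

section \<open>Two integration lemmas\<close>

text \<open>Integration by parts on each piece where \<open>w\<close> is differentiable: the
  boundary terms cost \<open>2 * W * \<epsilon>\<close> per piece, the interior
  \<open>D * \<epsilon>\<close> per unit length. The power of two counts the pieces crudely, since
  the induction on \<open>F\<close> treats both sides of a removed point with the same remaining
  set.\<close>

lemma integral_against_small_primitive:
  fixes w \<phi> :: "real \<Rightarrow> real"
  assumes \<phi>: "continuous_on {a..c} \<phi>"
    and small: "\<And>x. a \<le> x \<Longrightarrow> x \<le> c \<Longrightarrow> \<bar>integral {a..x} \<phi>\<bar> \<le> \<epsilon>"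
    and int: "(\<lambda>x. w x * \<phi> x) integrable_on {a..c}"
    and W: "\<And>x. a \<le> x \<Longrightarrow> x \<le> c \<Longrightarrow> \<bar>w x\<bar> \<le> W"
    and D: "D \<ge> 0"
    and F: "finite F" "a \<le> s" "s \<le> t" "t \<le> c"
      "\<And>x. s < x \<Longrightarrow> x < t \<Longrightarrow> x \<notin> F \<Longrightarrow> w field_differentiable (at x) \<and> \<bar>deriv w x\<bar> \<le> D"
  shows "\<bar>integral {s..t} (\<lambda>x. w x * \<phi> x)\<bar> \<le> \<epsilon> * (2 * W * 2 ^ card F + D * (t - s))"
  using F
proof (induction F arbitrary: s t rule: finite_induct)
  case (insert z F)
  have \<epsilon>: "\<epsilon> \<ge> 0" using small[of a] insert.prems by force
  have W0: "W \<ge> 0" using W[of a] insert.prems by force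
  show ?case
  proof (cases "s < z \<and> z < t")
    case False
    have "\<bar>integral {s..t} (\<lambda>x. w x * \<phi> x)\<bar> \<le> \<epsilon> * (2 * W * 2 ^ card F + D * (t - s))"
      using False insert.prems by (intro insert.IH) auto
    also have "\<dots> \<le> \<epsilon> * (2 * W * 2 ^ card (insert z F) + D * (t - s))"
      using insert.hyps \<epsilon> W0 by (intro mult_left_mono add_right_mono power_increasing) auto
    finally show ?thesis .
  next
    case True
    have "integral {s..t} (\<lambda>x. w x * \<phi> x) = integral {s..z} (\<lambda>x. w x * \<phi> x) + integral {z..t} (\<lambda>x. w x * \<phi> x)"
      using True insert.prems
      by (intro Henstock_Kurzweil_Integration.integral_combine[symmetric] integrable_on_subinterval[OF int]) auto
    also have "\<bar>\<dots>\<bar> \<le> \<epsilon> * (2 * W * 2 ^ card F + D * (z - s)) + \<epsilon> * (2 * W * 2 ^ card F + D * (t - z))"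
      using True insert.prems by (intro order_trans[OF abs_triangle_ineq] add_mono insert.IH) auto
    also have "\<dots> = \<epsilon> * (2 * W * 2 ^ card (insert z F) + D * (t - s))"
      using insert.hyps by (simp add: algebra_simps)
    finally show ?thesis .
  qed
next
  case empty
  have \<epsilon>: "\<epsilon> \<ge> 0" using small[of a] empty.prems by force
  have W0: "W \<ge> 0" using W[of a] empty.prems by force
  define J where "J x = integral {a..x} (\<lambda>x. w x * \<phi> x)" for x
  define \<Phi> where "\<Phi> x = integral {a..x} \<phi>" for x
  have J: "integral {x..y} (\<lambda>x. w x * \<phi> x) = J y - J x" if "a \<le> x" "x \<le> y" "y \<le> c" for x y
    using that Henstock_Kurzweil_Integration.integral_combine[of a x y "\<lambda>x. w x * \<phi> x"] integrable_on_subinterval[OF int, of a y]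
    by (simp add: J_def)
  \<comment> \<open>\<open>w\<close> may jump at \<open>s\<close> and \<open>t\<close>, so the parts
    formula is first used on closed subintervals of the open interval; continuity of
    \<open>J\<close> then carries the bound to the endpoints.\<close>
  have inner: "\<bar>J y - J x\<bar> \<le> \<epsilon> * (2 * W + D * (t - s))" if xy: "s < x" "x \<le> y" "y < t" for x y
  proof -
    have sub: "{x..y} \<subseteq> {a..c}" using xy empty.prems by auto
    have dw: "w field_differentiable (at u)" "\<bar>deriv w u\<bar> \<le> D" if "u \<in> {x..y}" for u
      using empty.prems(4)[of u] that xy by auto
    have wc: "continuous_on {x..y} w"
      using dw(1) by (intro continuous_at_imp_continuous_on ballI field_differentiable_imp_continuous_at) auto
    have d\<Phi>: "(\<Phi> has_real_derivative \<phi> u) (at u within {x..y})" if "u \<in> {x..y}" for u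
      using integral_has_real_derivative[OF \<phi>, of u] that sub unfolding \<Phi>_def[abs_def]
      by (intro DERIV_subset[OF _ sub]) auto
    have "((\<lambda>u. w u * \<Phi> u) has_real_derivative deriv w u * \<Phi> u + \<phi> u * w u) (at u within {x..y})"
      if "u \<in> {x..y}" for u
      by (rule DERIV_mult[OF has_field_derivative_at_within d\<Phi>[OF that]])
         (rule dw(1)[OF that, THEN field_differentiable_derivI])
    then have 1: "((\<lambda>u. deriv w u * \<Phi> u + \<phi> u * w u) has_integral (w y * \<Phi> y - w x * \<Phi> x)) {x..y}"
      using xy by (intro fundamental_theorem_of_calculus)
        (auto simp: has_real_derivative_iff_has_vector_derivative)
    have "((\<lambda>u. w u * \<phi> u) has_integral (J y - J x)) {x..y}"
      using J[of x y] integrable_on_subinterval[OF int, of x y] sub xy empty.prems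
      by (auto simp: has_integral_iff)
    \<comment> \<open>Integrability of \<open>deriv w * \<Phi>\<close> is obtained as a difference:
      the derivative of the product is gauge integrable by the fundamental theorem, and
      \<open>w * \<phi>\<close> is integrable by assumption.\<close>
    from has_integral_diff[OF 1 this]
    have 2: "((\<lambda>u. deriv w u * \<Phi> u) has_integral (w y * \<Phi> y - w x * \<Phi> x - (J y - J x))) {x..y}"
      by (simp add: mult.commute)
    have \<Phi>: "\<bar>\<Phi> u\<bar> \<le> \<epsilon>" if "u \<in> {x..y}" for u
      using small[of u] that sub by (auto simp: \<Phi>_def)
    have "norm (w y * \<Phi> y - w x * \<Phi> x - (J y - J x)) \<le> (D * \<epsilon>) * measure lborel (cbox x y)"
      using D \<epsilon> dw(2) \<Phi> 2
      by (intro has_integral_bound[where f = "\<lambda>u. deriv w u * \<Phi> u"]) (auto simp: abs_mult intro!: mult_mono)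
    also have "\<dots> = D * \<epsilon> * (y - x)" using xy by simp
    also have "\<dots> \<le> D * \<epsilon> * (t - s)" using xy D \<epsilon> by (intro mult_left_mono) auto
    finally have 3: "\<bar>w y * \<Phi> y - w x * \<Phi> x - (J y - J x)\<bar> \<le> D * \<epsilon> * (t - s)" by simp
    have "\<bar>w u * \<Phi> u\<bar> \<le> W * \<epsilon>" if "u \<in> {x..y}" for u
      using W[of u] \<Phi>[OF that] that sub W0 unfolding abs_mult by (intro mult_mono) auto
    from this[of x] this[of y] have 4: "\<bar>w x * \<Phi> x\<bar> \<le> W * \<epsilon>" "\<bar>w y * \<Phi> y\<bar> \<le> W * \<epsilon>" using xy by auto
    have "\<epsilon> * (2 * W + D * (t - s)) = 2 * (W * \<epsilon>) + D * \<epsilon> * (t - s)" by (simp add: algebra_simps)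
    then show ?thesis using 3 4 by linarith
  qed
  show ?case
  proof (cases "s = t")
    case False
    then have st: "s < t" using empty.prems by simp
    \<comment> \<open>The factor 1/2 keeps \<open>s + d n\<close> to the left of
      \<open>t - d n\<close>.\<close>
    define d where "d n = (t - s) / 2 * inverse (real (Suc n))" for n
    have d: "0 < d n" "d n \<le> (t - s) / 2" for n
      using st mult_left_mono[of "inverse (real (Suc n))" 1 "(t - s) / 2"]
      by (auto simp: d_def inverse_le_1_iff)
    have d0: "d \<longlonglongrightarrow> 0"
      unfolding d_def by (rule tendsto_mult_right_zero[OF LIMSEQ_inverse_real_of_nat])
    have Jc: "continuous_on {a..c} J"
      unfolding J_def by (rule indefinite_integral_continuous_1[OF int])
    have mem: "t - d n \<in> {a..c}" "s + d n \<in> {a..c}" for n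
      using d[of n] empty.prems by (auto simp: field_simps)
    have "(\<lambda>n. t - d n) \<longlonglongrightarrow> t - 0" "(\<lambda>n. s + d n) \<longlonglongrightarrow> s + 0"
      by (intro tendsto_intros d0)+
    then have lim: "(\<lambda>n. t - d n) \<longlonglongrightarrow> t" "(\<lambda>n. s + d n) \<longlonglongrightarrow> s" by simp_all
    have "(\<lambda>n. J (t - d n)) \<longlonglongrightarrow> J t"
      using empty.prems
      by (intro continuous_on_tendsto_compose[OF Jc lim(1)] always_eventually allI mem) auto
    moreover have "(\<lambda>n. J (s + d n)) \<longlonglongrightarrow> J s"
      using empty.prems
      by (intro continuous_on_tendsto_compose[OF Jc lim(2)] always_eventually allI mem) auto
    ultimately have "(\<lambda>n. \<bar>J (t - d n) - J (s + d n)\<bar>) \<longlonglongrightarrow> \<bar>J t - J s\<bar>"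
      by (intro tendsto_intros)
    moreover have "\<bar>J (t - d n) - J (s + d n)\<bar> \<le> \<epsilon> * (2 * W + D * (t - s))" for n
      using d[of n] by (intro inner) (auto simp: field_simps)
    ultimately have "\<bar>J t - J s\<bar> \<le> \<epsilon> * (2 * W + D * (t - s))"
      by (intro LIMSEQ_le_const2) auto
    then show ?thesis using J[of s t] empty.prems by simp
  qed (use \<epsilon> W0 in simp)
qed

text \<open>Every partial integral is at most \<open>F (a + n) - F a\<close>, hence at most
  \<open>- F a\<close>, and monotone convergence does the rest. Integrability on the half-line is
  thus a conclusion, which matters for weights that grow.\<close>

lemma nonneg_tail_integrable:
  fixes g F :: "real \<Rightarrow> real"
  assumes g: "continuous_on {a..} g" "\<And>x. a \<le> x \<Longrightarrow> 0 \<le> g x"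
    and F: "\<And>x. a \<le> x \<Longrightarrow> (F has_real_derivative F' x) (at x)" "\<And>x. a \<le> x \<Longrightarrow> g x \<le> F' x"
    and neg: "\<And>x. a \<le> x \<Longrightarrow> F x \<le> 0"
  shows "g absolutely_integrable_on {a..}" "integral {a..} g \<le> - F a"
proof -
  define I where "I n = integral {a..a + real n} g" for n
  have gi: "g absolutely_integrable_on {a..a + real n}" for n
    by (intro absolutely_integrable_continuous_real continuous_on_subset[OF g(1)]) auto
  have bd: "I n \<le> - F a" for n
  proof -
    have F': "(F' has_integral (F (a + real n) - F a)) {a..a + real n}"
      using F(1) by (intro fundamental_theorem_of_calculus)
        (auto simp: has_real_derivative_iff_has_vector_derivative[symmetric] intro: has_field_derivative_at_within)
    have "I n \<le> F (a + real n) - F a"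
      unfolding I_def using F(2) set_lebesgue_integral_eq_integral(1)[OF gi]
      by (intro has_integral_le[OF integrable_integral F']) auto
    then show ?thesis using neg[of "a + real n"] by simp
  qed
  have mono: "incseq I"
    unfolding I_def incseq_def using g(2) set_lebesgue_integral_eq_integral(1)[OF gi]
    by (auto intro!: Henstock_Kurzweil_Integration.integral_subset_le)
  obtain x where x: "I \<longlonglongrightarrow> x" "\<forall>n. I n \<le> x"
    using incseq_convergent[OF mono, of "- F a"] bd by blast
  define G where "G n t = indicator {a..a + real n} t *\<^sub>R g t" for n t
  have Gi: "integrable lebesgue (G n)" "integral\<^sup>L lebesgue (G n) = I n" for n
    using gi[of n] set_lebesgue_integral_eq_integral(2)[OF gi[of n]]
    by (simp_all add: G_def[abs_def] I_def set_integrable_def set_lebesgue_integral_def)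
  have lim: "(\<lambda>n. G n t) \<longlonglongrightarrow> indicator {a..} t *\<^sub>R g t" for t
  proof (rule tendsto_eventually, rule eventually_sequentiallyI)
    fix n assume "nat \<lceil>t - a\<rceil> \<le> n"
    then have "t \<le> a + real n" by linarith
    then show "G n t = indicator {a..} t *\<^sub>R g t" by (auto simp: G_def indicator_def)
  qed
  have mon: "mono (\<lambda>n. G n t)" for t
    using g(2) by (auto simp: mono_def G_def indicator_def)
  have lim': "(\<lambda>n. integral\<^sup>L lebesgue (G n)) \<longlonglongrightarrow> x" using x(1) Gi by simp
  have meas: "(\<lambda>t. indicator {a..} t *\<^sub>R g t) \<in> borel_measurable lebesgue"
    by (rule borel_measurable_LIMSEQ_real[OF lim]) (use Gi(1) in auto)
  have R: "integrable lebesgue (\<lambda>t. indicator {a..} t *\<^sub>R g t)"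
    "integral\<^sup>L lebesgue (\<lambda>t. indicator {a..} t *\<^sub>R g t) = x"
    using integrable_monotone_convergence[OF Gi(1) _ _ lim' meas]
      integral_monotone_convergence[OF Gi(1) _ _ lim' meas] mon lim by auto
  then show 1: "g absolutely_integrable_on {a..}" by (simp add: set_integrable_def)
  have "x \<le> - F a" using bd by (intro LIMSEQ_le_const2[OF x(1)]) auto
  then show "integral {a..} g \<le> - F a"
    using R(2) set_lebesgue_integral_eq_integral(2)[OF 1] by (simp add: set_lebesgue_integral_def)
qed

section \<open>The turning point and the forbidden region\<close>

locale half_state = half_well +
  assumes f2: "(\<lambda>x. (f x)\<^sup>2) absolutely_integrable_on UNIV" "integral UNIV (\<lambda>x. (f x)\<^sup>2) = 1"
begin

lemma q_nonneg: "b \<le> x \<Longrightarrow> l \<le> v x"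
  using q_pos[of x] vb by (cases "x = b") auto

lemma f_cont: "continuous_on X f"
  using f by (intro continuous_at_imp_continuous_on ballI DERIV_isCont) auto

lemma v_cont: "continuous_on X v"
  using v by (intro continuous_at_imp_continuous_on ballI DERIV_isCont) auto

lemma f2_on: assumes "X \<in> sets lebesgue"
  shows "(\<lambda>x. (f x)\<^sup>2) absolutely_integrable_on X" "(\<lambda>x. (f x)\<^sup>2) integrable_on X"
    "integral X (\<lambda>x. (f x)\<^sup>2) \<le> 1"
proof -
  show 1: "(\<lambda>x. (f x)\<^sup>2) absolutely_integrable_on X"
    using assms by (intro set_integrable_subset[OF f2(1)]) auto
  show 2: "(\<lambda>x. (f x)\<^sup>2) integrable_on X"
    by (rule set_lebesgue_integral_eq_integral(1)[OF 1])
  show "integral X (\<lambda>x. (f x)\<^sup>2) \<le> 1"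
    unfolding f2(2)[symmetric]
    by (rule Henstock_Kurzweil_Integration.integral_subset_le
        [OF subset_UNIV 2 set_lebesgue_integral_eq_integral(1)[OF f2(1)]]) simp
qed

lemma f2_deriv: "((\<lambda>x. (f x)\<^sup>2) has_real_derivative 2 * S x) (at x)"
  using DERIV_power[OF f, of 2] by (simp add: S_def mult_ac)

section \<open>Sign and size of \<psi> \<psi>' in the forbidden region\<close>

lemma S_mono: assumes "b \<le> x" "x \<le> y" shows "S x \<le> S y"
proof (rule DERIV_nonneg_imp_nondecreasing[OF assms(2)])
  fix t assume "x \<le> t" "t \<le> y"
  then have "0 \<le> (f1 t)\<^sup>2 + (v t - l) * (f t)\<^sup>2 / h\<^sup>2"
    using q_nonneg[of t] assms by simp
  then show "\<exists>D. (S has_real_derivative D) (at t) \<and> 0 \<le> D" using S_deriv by blast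
qed

text \<open>\<open>f\<^sup>2\<close> is convex beyond \<open>b\<close>, because its derivative
  \<open>2 * S\<close> is nondecreasing there; it therefore lies above its tangent at
  \<open>x\<close>.\<close>

lemma f2_growth: assumes "b \<le> x" "x \<le> y" shows "(f x)\<^sup>2 + 2 * S x * (y - x) \<le> (f y)\<^sup>2"
proof -
  have "(\<lambda>t. (f t)\<^sup>2 - 2 * S x * t) x \<le> (\<lambda>t. (f t)\<^sup>2 - 2 * S x * t) y"
  proof (rule DERIV_nonneg_imp_nondecreasing[OF assms(2)])
    fix t assume "x \<le> t" "t \<le> y"
    then have "0 \<le> 2 * S t - 2 * S x * 1" using S_mono[of x t] assms by simp
    then show "\<exists>D. ((\<lambda>t. (f t)\<^sup>2 - 2 * S x * t) has_real_derivative D) (at t) \<and> 0 \<le> D"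
      using DERIV_diff[OF f2_deriv DERIV_cmult[OF DERIV_ident]] by blast
  qed
  then show ?thesis by (simp add: algebra_simps)
qed

text \<open>An increasing convex \<open>f\<^sup>2\<close> would violate the normalization.\<close>

lemma S_nonpos: assumes "b \<le> x" shows "S x \<le> 0"
proof (rule ccontr)
  assume "\<not> S x \<le> 0"
  then have S: "S x > 0" by simp
  \<comment> \<open>From \<open>x + 1\<close> on, \<open>f\<^sup>2\<close> would be at least
    \<open>2 * S x\<close>; over the length \<open>1 / S x\<close> this gives mass 2, more than the
    total mass 1.\<close>
  define T where "T = 1 / S x"
  have T: "T > 0" using S by (simp add: T_def)
  have "2 * S x \<le> (f y)\<^sup>2" if "y \<in> {x + 1..x + 1 + T}" for y
  proof -
    have "2 * S x * 1 \<le> 2 * S x * (y - x)" using S that by (intro mult_left_mono) auto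
    moreover have "(f x)\<^sup>2 + 2 * S x * (y - x) \<le> (f y)\<^sup>2" using that assms by (intro f2_growth) auto
    ultimately show ?thesis using zero_le_power2[of "f x"] by linarith
  qed
  then have "integral {x + 1..x + 1 + T} (\<lambda>_. 2 * S x) \<le> integral {x + 1..x + 1 + T} (\<lambda>x. (f x)\<^sup>2)"
    by (intro integral_le f2_on(2)) auto
  moreover have "integral {x + 1..x + 1 + T} (\<lambda>_. 2 * S x) = 2" using S T by (simp add: T_def)
  ultimately show False using f2_on(3)[of "{x + 1..x + 1 + T}"] by simp
qed

lemma f2_antimono: assumes "b \<le> x" "x \<le> y" shows "(f y)\<^sup>2 \<le> (f x)\<^sup>2"
proof (rule DERIV_nonpos_imp_nonincreasing[OF assms(2)])
  fix t assume "x \<le> t" "t \<le> y"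
  then show "\<exists>D. ((\<lambda>x. (f x)\<^sup>2) has_real_derivative D) (at t) \<and> D \<le> 0"
    using f2_deriv[of t] S_nonpos[of t] assms by force
qed

lemma f2_average: assumes "b \<le> x" "x \<le> y" shows "(f y)\<^sup>2 * (y - x) \<le> integral {x..y} (\<lambda>x. (f x)\<^sup>2)"
proof -
  have "integral {x..y} (\<lambda>_. (f y)\<^sup>2) \<le> integral {x..y} (\<lambda>x. (f x)\<^sup>2)"
    using assms f2_antimono[of _ y] by (intro integral_le f2_on(2)) auto
  then show ?thesis using assms by (simp add: mult.commute)
qed

text \<open>The gap is used in two halves. On \<open>{y - \<gamma>..y - \<gamma> / 2}\<close> the
  unit mass and monotonicity bound \<open>f\<^sup>2\<close> at the midpoint \<open>c\<close>; from
  \<open>c\<close> to \<open>y\<close> the decrease of the convex \<open>f\<^sup>2\<close> cannot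
  exceed its value at \<open>c\<close>, which bounds the slope at \<open>y\<close>.\<close>

lemma S_bound: assumes "b + \<gamma> \<le> y" shows "- S y \<le> 2 / \<gamma>\<^sup>2"
proof -
  define c where "c = y - \<gamma> / 2"
  have c: "b \<le> c - \<gamma> / 2" "c \<le> y" using assms \<gamma> by (auto simp: c_def)
  have "(f c)\<^sup>2 * (c - (c - \<gamma> / 2)) \<le> integral {c - \<gamma> / 2..c} (\<lambda>x. (f x)\<^sup>2)"
    using c \<gamma> by (intro f2_average) auto
  also have "\<dots> \<le> 1" by (intro f2_on) auto
  finally have 1: "(f c)\<^sup>2 * \<gamma> \<le> 2" by simp
  have "(\<lambda>t. 2 * S y * t - (f t)\<^sup>2) c \<le> (\<lambda>t. 2 * S y * t - (f t)\<^sup>2) y"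
  proof (rule DERIV_nonneg_imp_nondecreasing[OF c(2)])
    fix t assume "c \<le> t" "t \<le> y"
    then have "0 \<le> 2 * S y * 1 - 2 * S t" using S_mono[of t y] c \<gamma> by simp
    then show "\<exists>D. ((\<lambda>t. 2 * S y * t - (f t)\<^sup>2) has_real_derivative D) (at t) \<and> 0 \<le> D"
      using DERIV_diff[OF DERIV_cmult[OF DERIV_ident] f2_deriv] by blast
  qed
  moreover have "2 * S y * y - 2 * S y * c = S y * \<gamma>" by (simp add: c_def algebra_simps)
  ultimately have "- S y * \<gamma> \<le> (f c)\<^sup>2" using zero_le_power2[of "f y"] by linarith
  then have "- S y * \<gamma> * \<gamma> \<le> (f c)\<^sup>2 * \<gamma>" using \<gamma> by (intro mult_right_mono) auto
  then have "- S y * \<gamma>\<^sup>2 \<le> 2" using 1 by (simp add: power2_eq_square mult.assoc)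
  then show ?thesis using \<gamma> by (simp add: field_simps)
qed

text \<open>The total derivative of \<open>2 h\<^sup>2 P\<^sup>n S\<close> dominates the integrand: the term from \<open>P'\<close> is absorbed
  because it carries a factor \<open>n h\<close>.  Since \<open>S \<le> 0\<close>, no exponential decay is needed.\<close>

lemma weighted_tail:
  fixes P Q :: "real \<Rightarrow> real" and n :: nat
  assumes a: "b1 \<le> a"
    and P: "\<And>x. a \<le> x \<Longrightarrow> (P has_real_derivative Q x) (at x)" "\<And>x. a \<le> x \<Longrightarrow> 1 \<le> P x"
    and Q: "\<And>x. a \<le> x \<Longrightarrow> 0 \<le> Q x \<and> (Q x)\<^sup>2 \<le> 2 * (v x - l)"
    and n: "2 * real n * h \<le> 1"
  shows "(\<lambda>x. P x ^ n * (v x - l) * (f x)\<^sup>2) absolutely_integrable_on {a..}"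
    "integral {a..} (\<lambda>x. P x ^ n * (v x - l) * (f x)\<^sup>2) \<le> 4 * h\<^sup>2 * P a ^ n / \<gamma>\<^sup>2"
proof -
  define g where "g x = P x ^ n * (v x - l) * (f x)\<^sup>2" for x
  define F where "F x = (2 * h\<^sup>2) * (P x ^ n * S x)" for x
  define F' where "F' x = (2 * h\<^sup>2) * ((of_nat n * (Q x * P x ^ (n - Suc 0))) * S x
      + ((f1 x)\<^sup>2 + (v x - l) * (f x)\<^sup>2 / h\<^sup>2) * P x ^ n)" for x
  have b: "b \<le> x" if "a \<le> x" for x using that a \<gamma> by linarith
  have gc: "continuous_on {a..} g"
    unfolding g_def
    by (intro continuous_intros f_cont v_cont continuous_at_imp_continuous_on ballI DERIV_isCont[OF P(1)]) auto
  have g0: "0 \<le> g x" if "a \<le> x" for x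
    using P(2)[OF that] q_nonneg[OF b[OF that]] by (simp add: g_def)
  have Fd: "(F has_real_derivative F' x) (at x)" if "a \<le> x" for x
    unfolding F_def[abs_def] F'_def
    by (rule DERIV_cmult[OF DERIV_mult[OF DERIV_power[OF P(1)[OF that]] S_deriv]])
  have le: "g x \<le> F' x" if "a \<le> x" for x
  proof -
    define q where "q = v x - l"
    have q: "0 \<le> q" using q_nonneg[OF b[OF that]] by (simp add: q_def)
    have P1: "1 \<le> P x" by (rule P(2)[OF that])
    define e where "e = (h * f1 x)\<^sup>2 + q * (f x)\<^sup>2"
    have e: "0 \<le> e" "q * (f x)\<^sup>2 \<le> e" using q by (simp_all add: e_def)
    have aux: "- (2 * \<alpha> * \<beta>) \<le> 2 * (\<beta>\<^sup>2 + y)" if "\<alpha>\<^sup>2 \<le> 2 * y" for \<alpha> \<beta> y :: real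
    proof -
      have "0 \<le> (\<alpha> + \<beta>)\<^sup>2" by simp
      then have "- (2 * \<alpha> * \<beta>) \<le> \<alpha>\<^sup>2 + \<beta>\<^sup>2" by (simp add: power2_sum)
      then show ?thesis using that zero_le_power2[of \<beta>] unfolding distrib_left by linarith
    qed
    have "(Q x * f x)\<^sup>2 \<le> 2 * (q * (f x)\<^sup>2)"
      using mult_right_mono[of "(Q x)\<^sup>2" "2 * q" "(f x)\<^sup>2"] Q[OF that]
      unfolding power_mult_distrib q_def by (simp only: mult.assoc zero_le_power2)
    from aux[OF this, of "h * f1 x"] have "- (2 * (Q x * f x) * (h * f1 x)) \<le> 2 * e" by (simp only: e_def)
    moreover have "2 * (Q x * f x) * (h * f1 x) = 2 * (Q x * S x * h)" by (simp add: S_def)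
    ultimately have 1: "- (Q x * S x * h) \<le> e" by linarith
    have pow: "P x ^ (n - Suc 0) \<le> P x ^ n" using P1 by (intro power_increasing) auto
    have "- (2 * h\<^sup>2) * ((of_nat n * (Q x * P x ^ (n - Suc 0))) * S x)
       = (2 * real n * h) * P x ^ (n - Suc 0) * (- (Q x * S x * h))"
      by (simp add: power2_eq_square)
    also have "\<dots> \<le> (2 * real n * h) * P x ^ (n - Suc 0) * e"
      using 1 h P1 by (intro mult_left_mono) auto
    also have "\<dots> \<le> 1 * P x ^ n * e"
      using n h P1 e(1) pow by (intro mult_mono) auto
    finally have 2: "- (2 * h\<^sup>2) * ((of_nat n * (Q x * P x ^ (n - Suc 0))) * S x) \<le> P x ^ n * e" by simp
    have "2 * h\<^sup>2 * (((f1 x)\<^sup>2 + (v x - l) * (f x)\<^sup>2 / h\<^sup>2) * P x ^ n) = 2 * (P x ^ n * e)"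
      using h by (simp add: e_def q_def power_mult_distrib distrib_left distrib_right)
    then have "F' x = 2 * (P x ^ n * e) - (- (2 * h\<^sup>2) * ((of_nat n * (Q x * P x ^ (n - Suc 0))) * S x))"
      unfolding F'_def by (simp add: distrib_left)
    then have "P x ^ n * e \<le> F' x" using 2 by linarith
    moreover have "g x \<le> P x ^ n * e"
      using e(2) P1 by (auto simp: g_def q_def mult.assoc intro!: mult_left_mono)
    ultimately show ?thesis by linarith
  qed
  have F0: "F x \<le> 0" if "a \<le> x" for x
    using P(2)[OF that] S_nonpos[OF b[OF that]] by (simp add: F_def mult_nonneg_nonpos)
  note R = nonneg_tail_integrable[OF gc g0 Fd le F0]
  show "(\<lambda>x. P x ^ n * (v x - l) * (f x)\<^sup>2) absolutely_integrable_on {a..}"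
    using R(1) by (simp add: g_def[abs_def])
  have "- F a = 2 * h\<^sup>2 * P a ^ n * (- S a)" by (simp add: F_def)
  also have "\<dots> \<le> 2 * h\<^sup>2 * P a ^ n * (2 / \<gamma>\<^sup>2)"
    using P(2)[of a] S_bound[of a] a \<gamma> by (intro mult_left_mono) auto
  finally show "integral {a..} (\<lambda>x. P x ^ n * (v x - l) * (f x)\<^sup>2) \<le> 4 * h\<^sup>2 * P a ^ n / \<gamma>\<^sup>2"
    using R(2) by (simp add: g_def[abs_def])
qed

lemma tail_mass: "integral {b1..} (\<lambda>x. (f x)\<^sup>2) \<le> 4 * h\<^sup>2 / (\<gamma>\<^sup>2 * k)"
proof -
  have Q: "0 \<le> (0::real) \<and> 0\<^sup>2 \<le> 2 * (v x - l)" if "b1 \<le> x" for x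
    using q_lower[OF that] k by simp
  \<comment> \<open>The trivial weight; \<open>q_lower\<close> then removes the factor
    \<open>v x - l\<close>.\<close>
  note R = weighted_tail[of b1 "\<lambda>_. 1" "\<lambda>_. 0" 0, OF order_refl DERIV_const order_refl Q]
  have R1: "(\<lambda>x. (v x - l) * (f x)\<^sup>2) integrable_on {b1..}"
    using set_lebesgue_integral_eq_integral(1)[OF R(1)] by simp
  have kf2: "(\<lambda>x. k * (f x)\<^sup>2) integrable_on {b1..}"
    using integrable_on_cmult_left[OF f2_on(2)[of "{b1..}"], of k] by simp
  have "integral {b1..} (\<lambda>x. k * (f x)\<^sup>2) \<le> integral {b1..} (\<lambda>x. (v x - l) * (f x)\<^sup>2)"
    using q_lower by (intro integral_le kf2 f2_on(2) R1) (auto intro: mult_right_mono)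
  also have "\<dots> \<le> 4 * h\<^sup>2 / \<gamma>\<^sup>2" using R(2) by simp
  finally show ?thesis using k \<gamma> by (simp add: field_simps)
qed

text \<open>\<open>f\<^sup>2\<close> decreases, so its value at the right end of
  \<open>{b1..b2}\<close> is below its mean there. This controls the possibly negative value of
  \<open>E\<close> at \<open>b2\<close>.\<close>

lemma f2_b2: "(f b2)\<^sup>2 \<le> 4 * h\<^sup>2 / (\<gamma>^3 * k)"
proof -
  have "(f b2)\<^sup>2 * \<gamma> \<le> (f b2)\<^sup>2 * (b2 - b1)" using \<gamma> by (intro mult_left_mono) auto
  also have "\<dots> \<le> integral {b1..b2} (\<lambda>x. (f x)\<^sup>2)" using \<gamma> by (intro f2_average) auto
  also have "\<dots> \<le> integral {b1..} (\<lambda>x. (f x)\<^sup>2)"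
    by (intro Henstock_Kurzweil_Integration.integral_subset_le f2_on(2)) auto
  also have "\<dots> \<le> 4 * h\<^sup>2 / (\<gamma>\<^sup>2 * k)" by (rule tail_mass)
  finally show ?thesis using \<gamma> k by (simp add: field_simps power2_eq_square power3_eq_cube)
qed

text \<open>\<open>E' = - v1 f\<^sup>2\<close>, so near the turning point the loss of \<open>E\<close> controls the mass.\<close>

lemma turning_mass:
  assumes x: "b - \<delta> \<le> x" "x < b"
  shows "integral {x..b2} (\<lambda>x. (f x)\<^sup>2) \<le> (G x * s x + M * (4 * h\<^sup>2 / (\<gamma>^3 * k))) / k"
proof -
  have xb: "m \<le> x" "x \<le> b2" using x \<delta> \<gamma> by auto
  have "((\<lambda>t. v1 t * (f t)\<^sup>2) has_integral (- E b2 - - E x)) {x..b2}"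
  proof (rule fundamental_theorem_of_calculus[OF xb(2)])
    fix t
    have "((\<lambda>x. - E x) has_real_derivative v1 t * (f t)\<^sup>2) (at t within {x..b2})"
      by (rule has_field_derivative_at_within[OF DERIV_cong[OF DERIV_minus[OF E_deriv]]]) simp
    then show "((\<lambda>x. - E x) has_vector_derivative v1 t * (f t)\<^sup>2) (at t within {x..b2})"
      by (simp add: has_real_derivative_iff_has_vector_derivative)
  qed
  moreover have "((\<lambda>t. k * (f t)\<^sup>2) has_integral k * integral {x..b2} (\<lambda>x. (f x)\<^sup>2)) {x..b2}"
    by (intro has_integral_mult_right integrable_integral f2_on(2)) auto
  moreover have "k * (f t)\<^sup>2 \<le> v1 t * (f t)\<^sup>2" if "t \<in> {x..b2}" for t
    by (rule mult_right_mono[OF v1_lower]) (use that x in auto)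
  ultimately have "k * integral {x..b2} (\<lambda>x. (f x)\<^sup>2) \<le> - E b2 - - E x"
    by - (rule has_integral_le)
  moreover have "- E b2 \<le> M * (f b2)\<^sup>2"
  proof -
    have "- E b2 = (v b2 - l) * (f b2)\<^sup>2 - (h * f1 b2)\<^sup>2" by (simp add: E_def algebra_simps)
    also have "\<dots> \<le> M * (f b2)\<^sup>2"
      using mult_right_mono[OF q_upper zero_le_power2[of "f b2"]] zero_le_power2[of "h * f1 b2"]
      by (meson diff_le_eq le_add_same_cancel1 order_trans)
    finally show ?thesis .
  qed
  moreover have "M * (f b2)\<^sup>2 \<le> M * (4 * h\<^sup>2 / (\<gamma>^3 * k))"
    using M by (intro mult_left_mono f2_b2) auto
  moreover have "E x = G x * s x" using pos(2)[OF xb(1) x(2)] by (simp add: G_def)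
  ultimately have "k * integral {x..b2} (\<lambda>x. (f x)\<^sup>2) \<le> G x * s x + M * (4 * h\<^sup>2 / (\<gamma>^3 * k))"
    by linarith
  then show ?thesis using k by (simp only: pos_le_divide_eq mult.commute)
qed

end

section \<open>Choice of the distance to the turning point\<close>

lemma inverse_sqrt_powr: "(x::real) \<ge> 0 \<Longrightarrow> x powr (-1/2) = 1 / sqrt x"
  by (simp add: powr_minus_divide powr_half_sqrt flip: minus_divide_left)

text \<open>The linear lower bound on \<open>l - v\<close> gives the majorant
  \<open>W / (\<kappa> * sqrt (b - x))\<close>, which has an explicit primitive. The same bound
  serves for integrability over the well and for the smallness of the strip next to
  \<open>b\<close>.\<close>

lemma inverse_sqrt_integral:
  fixes v w :: "real \<Rightarrow> real"
  assumes v: "continuous_on UNIV v" and ab: "a \<le> b" and \<kappa>: "\<kappa> > 0"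
    and vb: "v b = l" and p: "\<And>x. a \<le> x \<Longrightarrow> x \<le> b \<Longrightarrow> \<kappa>\<^sup>2 * (b - x) \<le> l - v x"
    and w: "w \<in> borel_measurable lebesgue" "\<And>x. a \<le> x \<Longrightarrow> x \<le> b \<Longrightarrow> \<bar>w x\<bar> \<le> W"
  shows "(\<lambda>x. w x * (l - v x) powr (-1/2)) absolutely_integrable_on {a..b}"
    "\<bar>integral {a..b} (\<lambda>x. w x * (l - v x) powr (-1/2))\<bar> \<le> 2 * W * sqrt (b - a) / \<kappa>"
proof -
  define g where "g x = W / \<kappa> * (1 / sqrt (b - x))" for x
  have "((\<lambda>x. 1 / sqrt (b - x)) has_integral (- 2 * sqrt (b - b) - - 2 * sqrt (b - a))) {a..b}"
  proof (rule fundamental_theorem_of_calculus_interior[OF ab])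
    show "continuous_on {a..b} (\<lambda>x. - 2 * sqrt (b - x))" by (intro continuous_intros)
    fix x assume "x \<in> {a<..<b}"
    then have "b - x > 0" by simp
    then have "((\<lambda>x. - 2 * sqrt (b - x)) has_real_derivative - 2 * (inverse (sqrt (b - x)) / 2 * (0 - 1))) (at x)"
      by (intro DERIV_cmult DERIV_chain2[OF DERIV_real_sqrt DERIV_diff[OF DERIV_const DERIV_ident]])
    moreover have "- 2 * (inverse (sqrt (b - x)) / 2 * (0 - 1)) = 1 / sqrt (b - x)"
      by (simp add: inverse_eq_divide)
    ultimately show "((\<lambda>x. - 2 * sqrt (b - x)) has_vector_derivative 1 / sqrt (b - x)) (at x)"
      by (simp only: has_real_derivative_iff_has_vector_derivative)
  qed
  from has_integral_mult_right[OF this, of "W / \<kappa>"]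
  have g: "(g has_integral (2 * W * sqrt (b - a) / \<kappa>)) {a..b}"
    unfolding g_def by (simp add: mult_ac)
  have W: "W \<ge> 0" using w(2)[of a] ab by force
  have bd: "norm (w x * (l - v x) powr (-1/2)) \<le> g x" if x: "x \<in> {a..b}" for x
  proof (cases "x = b")
    \<comment> \<open>At \<open>b\<close> both sides are 0, since \<open>0 powr _\<close> and
      \<open>1 / 0\<close> are 0.\<close>
    case True
    then show ?thesis using vb by (simp add: g_def)
  next
    case False
    then have xb: "b - x > 0" using x by simp
    then have "0 < \<kappa>\<^sup>2 * (b - x)" using \<kappa> by simp
    then have pos: "0 < l - v x" using p[of x] x by (meson atLeastAtMost_iff less_le_trans)
    have "\<kappa> * sqrt (b - x) = sqrt (\<kappa>\<^sup>2 * (b - x))" using \<kappa> by (simp add: real_sqrt_mult)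
    also have "\<dots> \<le> sqrt (l - v x)" using p[of x] x by (intro real_sqrt_le_mono) auto
    finally have le: "\<kappa> * sqrt (b - x) \<le> sqrt (l - v x)" .
    have "norm (w x * (l - v x) powr (-1/2)) = \<bar>w x\<bar> * (1 / sqrt (l - v x))"
      unfolding inverse_sqrt_powr[OF less_imp_le[OF pos]] using pos by (simp add: abs_mult)
    also have "\<dots> \<le> W * (1 / (\<kappa> * sqrt (b - x)))"
    proof (rule mult_mono)
      show "1 / sqrt (l - v x) \<le> 1 / (\<kappa> * sqrt (b - x))"
        using le xb \<kappa> pos by (intro divide_left_mono mult_pos_pos) auto
      show "\<bar>w x\<bar> \<le> W" using w(2)[of x] x by auto
    qed (use W pos in auto)
    also have "\<dots> = g x" by (simp add: g_def)
    finally show ?thesis .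
  qed
  have "(\<lambda>x. (l - v x) powr (-1/2)) \<in> borel_measurable lebesgue"
    using borel_measurable_continuous_onI[OF v]
    by (intro measurable_completion powr_real_measurable borel_measurable_diff borel_measurable_const)
       (simp_all add: measurable_lborel1)
  then have meas: "(\<lambda>x. w x * (l - v x) powr (-1/2)) \<in> borel_measurable (lebesgue_on {a..b})"
    using w(1) by (intro measurable_restrict_space1 borel_measurable_times)
  show 1: "(\<lambda>x. w x * (l - v x) powr (-1/2)) absolutely_integrable_on {a..b}"
    by (rule measurable_bounded_by_integrable_imp_absolutely_integrable[OF meas _ has_integral_integrable[OF g] bd]) auto
  have "norm (integral {a..b} (\<lambda>x. w x * (l - v x) powr (-1/2))) \<le> integral {a..b} g"
    by (rule Henstock_Kurzweil_Integration.integral_norm_bound_integral[OF set_lebesgue_integral_eq_integral(1)[OF 1] has_integral_integrable[OF g] bd])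
  then show  "\<bar>integral {a..b} (\<lambda>x. w x * (l - v x) powr (-1/2))\<bar> \<le> 2 * W * sqrt (b - a) / \<kappa>"
    using integral_unique[OF g] by simp
qed

context half_state
begin

text \<open>The cut is made at distance \<open>K\<^sup>2 * \<eta>\<^sup>2\<close> from
  \<open>b\<close>, where \<open>r\<close> equals \<open>K * \<eta>\<close>. The smallness condition
  of \<open>G_close\<close> then reads \<open>2 * A \<le> K ^ 3\<close>, which holds because
  \<open>K\<close> is at least 1 and at least \<open>2 * A\<close>.\<close>

definition "K = 1 + 2 * A"
text \<open>Threshold for h: under \<open>\<eta> * \<Lambda> \<le> 1\<close> the three summands
  yield \<open>\<eta> \<le> 1\<close>, a cut inside the zone of width \<open>\<delta>\<close>, and
  an averaging error small enough to be absorbed in \<open>G_bound\<close>.\<close>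

definition "\<Lambda> = 1 + K\<^sup>2 / \<delta> + 4 * B * sqrt (M * L) / (K\<^sup>2 * \<delta>)"
definition "\<Gamma> = 4 * sqrt (M * L) / \<delta>"

lemma K_pos: "K > 0" using A_pos by (simp add: K_def)

lemma K_cubed: "2 * A \<le> K ^ 3"
proof -
  have "K ^ 1 \<le> K ^ 3" using A_pos by (intro power_increasing) (auto simp: K_def)
  then show ?thesis by (simp add: K_def)
qed

lemma LM_sqrt_pos: "0 < sqrt (M * L)" using M L_pos by simp

context
  fixes \<eta> :: real
  assumes \<eta>: "0 < \<eta>" "h = \<eta> ^ 3" and small: "\<eta> * \<Lambda> \<le> 1"
begin

lemma small': "\<eta> \<le> 1" "K\<^sup>2 * \<eta>\<^sup>2 \<le> \<delta>" "B * \<eta> / K\<^sup>2 \<le> \<delta> / (4 * sqrt (M * L))" "h\<^sup>2 \<le> \<eta>"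
proof -
  have nn: "0 \<le> K\<^sup>2 / \<delta>" "0 \<le> 4 * B * sqrt (M * L) / (K\<^sup>2 * \<delta>)"
    using \<delta> B_pos LM_sqrt_pos by (simp_all add: less_imp_le)
  have "\<eta> * 1 \<le> \<eta> * \<Lambda>" "\<eta> * (K\<^sup>2 / \<delta>) \<le> \<eta> * \<Lambda>"
    "\<eta> * (4 * B * sqrt (M * L) / (K\<^sup>2 * \<delta>)) \<le> \<eta> * \<Lambda>"
    using \<eta>(1) nn by (intro mult_left_mono; simp add: \<Lambda>_def)+
  then have 1: "\<eta> \<le> 1" "\<eta> * (K\<^sup>2 / \<delta>) \<le> 1" "\<eta> * (4 * B * sqrt (M * L) / (K\<^sup>2 * \<delta>)) \<le> 1"
    using small by linarith+
  show "\<eta> \<le> 1" by (rule 1)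
  have "\<eta>\<^sup>2 \<le> \<eta> ^ 1" using 1(1) \<eta> by (intro power_decreasing) auto
  then have "K\<^sup>2 * \<eta>\<^sup>2 \<le> K\<^sup>2 * \<eta>" by (simp add: mult_left_mono)
  also have "\<dots> \<le> \<delta>" using 1(2) \<delta> by (simp add: field_simps)
  finally show "K\<^sup>2 * \<eta>\<^sup>2 \<le> \<delta>" .
  show "B * \<eta> / K\<^sup>2 \<le> \<delta> / (4 * sqrt (M * L))"
    using 1(3) \<delta> K_pos LM_sqrt_pos by (simp add: field_simps)
  have "h\<^sup>2 = \<eta> ^ 6" by (simp add: \<eta> flip: power_mult)
  also have "\<dots> \<le> \<eta> ^ 1" using 1(1) \<eta> by (intro power_decreasing) auto
  finally show "h\<^sup>2 \<le> \<eta>" by simp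
qed

definition "x1 = b - K\<^sup>2 * \<eta>\<^sup>2"

lemma x1: "b - \<delta> \<le> x1" "m + \<delta> \<le> x1" "m \<le> x1" "x1 < b" "r x1 = K * \<eta>"
proof -
  show 1: "b - \<delta> \<le> x1" using small'(2) by (simp add: x1_def)
  then show "m + \<delta> \<le> x1" "m \<le> x1" using \<delta> by auto
  show "x1 < b" using K_pos \<eta> by (simp add: x1_def)
  show "r x1 = K * \<eta>" using K_pos \<eta> by (simp add: x1_def r_def real_sqrt_mult)
qed

lemma r_x1: "2 * h * A \<le> r x1 ^ 3"
proof -
  have "\<eta> ^ 3 * (2 * A) \<le> \<eta> ^ 3 * K ^ 3" using \<eta> K_cubed by (intro mult_left_mono) auto
  then show ?thesis by (simp add: x1 \<eta> power_mult_distrib mult_ac)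
qed

lemma mass_small:
  assumes "m \<le> x" "x \<le> x1"
  shows "\<bar>integral {m..x} (\<lambda>t. (f t)\<^sup>2 - G m / (2 * s t))\<bar> \<le> (B * \<eta> / K\<^sup>2) * G m"
proof -
  have xb: "x < b" using x1 assms by linarith
  have rr: "r x1 \<le> r x" by (rule r_antimono[OF assms(2)])
  have r1: "0 < r x1" using x1 pos by blast
  have "r x1 ^ 3 \<le> r x ^ 3" using rr r1 by (intro power_mono) auto
  then have "2 * h * A \<le> r x ^ 3" using r_x1 by linarith
  from mass_estimate[OF assms(1) xb this]
  have "\<bar>integral {m..x} (\<lambda>t. (f t)\<^sup>2 - G m / (2 * s t))\<bar> \<le> B * h * G m / (r x)\<^sup>2" .
  also have "\<dots> \<le> B * h * G m / (r x1)\<^sup>2"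
    using rr r1 B_pos h G_nonneg[of m] mb by (intro divide_left_mono power_mono mult_pos_pos) auto
  also have "\<dots> = (B * \<eta> / K\<^sup>2) * G m"
    using \<eta> K_pos by (simp add: x1(5) field_simps power2_eq_square power3_eq_cube)
  finally show ?thesis .
qed

lemma s_le: assumes "m \<le> x" "x < b" shows "s x \<le> sqrt M * r x" "s x \<le> sqrt (M * L)"
proof -
  have "s x \<le> sqrt (M * (b - x))"
    unfolding s_def using p_upper[of x] assms by (intro real_sqrt_le_mono) auto
  then show 1: "s x \<le> sqrt M * r x" by (simp add: r_def real_sqrt_mult)
  have "M * (b - x) \<le> M * L" using M L assms by (intro mult_left_mono) auto
  then have "sqrt (M * (b - x)) \<le> sqrt (M * L)" by (rule real_sqrt_le_mono)
  then show "s x \<le> sqrt (M * L)" using 1 by (simp add: r_def real_sqrt_mult)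
qed

lemma inv_s_integrable: "(\<lambda>t. 1 / s t) integrable_on {m..x1}"
proof -
  have "isCont (\<lambda>t. 1 / s t) t" if "t \<in> {m..x1}" for t
  proof -
    have "m \<le> t" "t < b" using that x1 by auto
    from DERIV_isCont[OF s_deriv[OF this]] pos(2)[OF this] show ?thesis
      by (intro continuous_divide continuous_const) auto
  qed
  then show ?thesis by (intro integrable_continuous_interval continuous_at_imp_continuous_on) blast
qed

text \<open>The unit mass dominates the mass on \<open>{m..x1}\<close>, which is
  \<open>G m / 2\<close> times the integral of \<open>1 / s\<close> up to the averaging error. That
  integral is at least \<open>\<delta> / sqrt (M * L)\<close>, and the error is at most half of the
  resulting lower bound.\<close>

lemma G_bound: "G m \<le> \<Gamma>"
proof -
  define I where "I = integral {m..x1} (\<lambda>t. 1 / s t)"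
  have "integral {m..x1} (\<lambda>_. 1 / sqrt (M * L)) \<le> I"
    unfolding I_def
  proof (rule integral_le[OF _ inv_s_integrable])
    fix t assume "t \<in> {m..x1}"
    then have t: "m \<le> t" "t < b" using x1 by auto
    show "1 / sqrt (M * L) \<le> 1 / s t"
      using s_le(2)[OF t] pos(2)[OF t] LM_sqrt_pos by (intro divide_left_mono mult_pos_pos) auto
  qed auto
  then have 1: "(x1 - m) / sqrt (M * L) \<le> I" using x1 by simp
  have "\<delta> / sqrt (M * L) \<le> (x1 - m) / sqrt (M * L)"
    using x1(2) LM_sqrt_pos by (intro divide_right_mono) auto
  then have I: "\<delta> / sqrt (M * L) \<le> I" using 1 by linarith
  have "((\<lambda>t. (f t)\<^sup>2 - G m / 2 * (1 / s t)) has_integral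
      (integral {m..x1} (\<lambda>t. (f t)\<^sup>2) - G m / 2 * I)) {m..x1}"
    unfolding I_def
    by (intro has_integral_diff has_integral_mult_right integrable_integral inv_s_integrable f2_on(2)) auto
  then have "integral {m..x1} (\<lambda>t. (f t)\<^sup>2 - G m / 2 * (1 / s t)) = integral {m..x1} (\<lambda>t. (f t)\<^sup>2) - G m / 2 * I"
    by (rule integral_unique)
  moreover have "\<bar>integral {m..x1} (\<lambda>t. (f t)\<^sup>2 - G m / 2 * (1 / s t))\<bar> \<le> (B * \<eta> / K\<^sup>2) * G m"
    using mass_small[of x1] x1 by simp
  moreover have "integral {m..x1} (\<lambda>t. (f t)\<^sup>2) \<le> 1" by (intro f2_on(3)) auto
  ultimately have "G m / 2 * I \<le> 1 + (B * \<eta> / K\<^sup>2) * G m" by linarith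
  moreover have "(B * \<eta> / K\<^sup>2) * G m \<le> \<delta> / (4 * sqrt (M * L)) * G m"
    using small'(3) G_nonneg[of m] mb by (intro mult_right_mono) auto
  moreover have "G m / 2 * (\<delta> / sqrt (M * L)) \<le> G m / 2 * I"
    using I G_nonneg[of m] mb by (intro mult_left_mono) auto
  moreover have "G m / 2 * (\<delta> / sqrt (M * L)) = 2 * (\<delta> / (4 * sqrt (M * L)) * G m)" by simp
  ultimately have "\<delta> / (4 * sqrt (M * L)) * G m \<le> 1" by linarith
  then show ?thesis using \<delta> LM_sqrt_pos by (simp add: \<Gamma>_def field_simps)
qed

end

end

section \<open>Observables on a half-line\<close>

context half_state
begin

text \<open>The summands are, in order: the averaging error up to the cut, the WKB density dropped
  between the cut and \<open>b\<close>, the mass of \<open>f\<^sup>2\<close> from the cut to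
  \<open>b2\<close>, the mass from \<open>b2\<close> to \<open>a\<close>, and the weighted tail
  beyond \<open>a\<close>.\<close>

definition "\<Xi> W D N C = B / K\<^sup>2 * \<Gamma> * (2 * W * 2 ^ N + D * L) + \<Gamma> * W * K / \<kappa>
  + W * ((2 * \<Gamma> * (sqrt M * K) + M * (4 / (\<gamma>^3 * k))) / k) + W * (4 / (\<gamma>\<^sup>2 * k)) + C * (4 / \<gamma>\<^sup>2)"

end

text \<open>\<open>w\<close> is controlled by the constant \<open>W\<close> up to \<open>a\<close>
  and by the growth bound beyond. \<open>P\<close> stands for the phase integral at a fixed
  reference energy, whereas \<open>f\<close> belongs to the energy \<open>l\<close>; this is why
  \<open>Q\<close> is only compared with \<open>v - l\<close>, with a factor of two.\<close>

locale half_observable = half_state +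
  fixes w P Q :: "real \<Rightarrow> real" and n :: nat and a W D C0 \<eta> :: real and F :: "real set"
  assumes w_meas: "w \<in> borel_measurable lebesgue"
    and a: "b2 \<le> a"
    and W: "\<And>x. m \<le> x \<Longrightarrow> x \<le> a \<Longrightarrow> \<bar>w x\<bar> \<le> W"
    and F: "finite F" "\<And>x. m < x \<Longrightarrow> x < b \<Longrightarrow> x \<notin> F \<Longrightarrow> w field_differentiable (at x) \<and> \<bar>deriv w x\<bar> \<le> D"
    and D: "0 \<le> D"
    and P: "\<And>x. a \<le> x \<Longrightarrow> (P has_real_derivative Q x) (at x)" "\<And>x. a \<le> x \<Longrightarrow> 1 \<le> P x"
    and Q: "\<And>x. a \<le> x \<Longrightarrow> 0 \<le> Q x \<and> (Q x)\<^sup>2 \<le> 2 * (v x - l)"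
    and C0: "0 \<le> C0" "\<And>x. a \<le> x \<Longrightarrow> \<bar>w x\<bar> \<le> C0 * (P x ^ n * (v x - l))"
    and n: "2 * real n * h \<le> 1"
    and \<eta>: "0 < \<eta>" "h = \<eta> ^ 3" and small: "\<eta> * \<Lambda> \<le> 1"
begin

lemma W_nonneg: "0 \<le> W"
  using W[of m] mb \<gamma> a by linarith

lemma b1_a: "b1 \<le> a" using a \<gamma> by linarith

lemmas tail = weighted_tail[OF b1_a P Q n]

lemma w_meas_on: "X \<in> sets lebesgue \<Longrightarrow> w \<in> borel_measurable (lebesgue_on X)"
  using w_meas by (rule measurable_restrict_space1)

lemma wf_left: "(\<lambda>x. w x * (f x)\<^sup>2) absolutely_integrable_on {m..a}"
proof (rule absolutely_integrable_bounded_measurable_product_real)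
  show "bounded (w ` {m..a})" using W by (auto intro!: boundedI)
qed (auto intro: w_meas_on f2_on)

lemma wf_right: "(\<lambda>x. w x * (f x)\<^sup>2) absolutely_integrable_on {a..}"
    "\<bar>integral {a..} (\<lambda>x. w x * (f x)\<^sup>2)\<bar> \<le> C0 * (4 * h\<^sup>2 * P a ^ n / \<gamma>\<^sup>2)"
proof -
  have g: "((\<lambda>x. C0 * (P x ^ n * (v x - l) * (f x)\<^sup>2)) has_integral
      C0 * integral {a..} (\<lambda>x. P x ^ n * (v x - l) * (f x)\<^sup>2)) {a..}"
    by (intro has_integral_mult_right integrable_integral set_lebesgue_integral_eq_integral(1)[OF tail(1)])
  have bd: "norm (w x * (f x)\<^sup>2) \<le> C0 * (P x ^ n * (v x - l) * (f x)\<^sup>2)" if "x \<in> {a..}" for x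
    using mult_right_mono[OF C0(2)[of x] zero_le_power2[of "f x"]] that
    by (simp add: abs_mult mult.assoc)
  have "(\<lambda>x. w x * (f x)\<^sup>2) \<in> borel_measurable (lebesgue_on {a..})"
    by (intro borel_measurable_times w_meas_on continuous_imp_measurable_on_sets_lebesgue
        continuous_on_power f_cont) auto
  then show 1: "(\<lambda>x. w x * (f x)\<^sup>2) absolutely_integrable_on {a..}"
    by (rule measurable_bounded_by_integrable_imp_absolutely_integrable[OF _ _ has_integral_integrable[OF g] bd]) auto
  have "norm (integral {a..} (\<lambda>x. w x * (f x)\<^sup>2)) \<le> integral {a..} (\<lambda>x. C0 * (P x ^ n * (v x - l) * (f x)\<^sup>2))"
    by (rule Henstock_Kurzweil_Integration.integral_norm_bound_integral[OF set_lebesgue_integral_eq_integral(1)[OF 1] has_integral_integrable[OF g] bd])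
  also have "\<dots> = C0 * integral {a..} (\<lambda>x. P x ^ n * (v x - l) * (f x)\<^sup>2)" by (rule integral_unique[OF g])
  also have "\<dots> \<le> C0 * (4 * h\<^sup>2 * P a ^ n / \<gamma>\<^sup>2)" by (rule mult_left_mono[OF tail(2) C0(1)])
  finally show "\<bar>integral {a..} (\<lambda>x. w x * (f x)\<^sup>2)\<bar> \<le> C0 * (4 * h\<^sup>2 * P a ^ n / \<gamma>\<^sup>2)" by simp
qed

lemma half_line: "{m..} = {m..a} \<union> {a..}"
  using mb \<gamma> a by auto

lemma wf_integrable: "(\<lambda>x. w x * (f x)\<^sup>2) absolutely_integrable_on {m..}"
  unfolding half_line by (intro set_integrable_Un wf_left wf_right) auto

lemma wf_on: "m \<le> x \<Longrightarrow> y \<le> a \<Longrightarrow> (\<lambda>x. w x * (f x)\<^sup>2) integrable_on {x..y}"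
  by (rule integrable_on_subinterval[OF set_lebesgue_integral_eq_integral(1)[OF wf_left]]) auto

lemma wf_bound:
  assumes "m \<le> x" "y \<le> a"
  shows "\<bar>integral {x..y} (\<lambda>x. w x * (f x)\<^sup>2)\<bar> \<le> W * integral {x..y} (\<lambda>x. (f x)\<^sup>2)"
proof -
  have g: "((\<lambda>t. W * (f t)\<^sup>2) has_integral W * integral {x..y} (\<lambda>x. (f x)\<^sup>2)) {x..y}"
    by (intro has_integral_mult_right integrable_integral f2_on(2)) auto
  have "norm (integral {x..y} (\<lambda>x. w x * (f x)\<^sup>2)) \<le> integral {x..y} (\<lambda>t. W * (f t)\<^sup>2)"
  proof (rule Henstock_Kurzweil_Integration.integral_norm_bound_integral[OF wf_on[OF assms] has_integral_integrable[OF g]])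
    fix t assume "t \<in> {x..y}"
    then have "\<bar>w t\<bar> \<le> W" using assms by (intro W) auto
    then show "norm (w t * (f t)\<^sup>2) \<le> W * (f t)\<^sup>2" by (simp add: abs_mult mult_right_mono)
  qed
  then show ?thesis using integral_unique[OF g] by simp
qed

abbreviation "y1 \<equiv> x1 \<eta>"

lemmas y1 = x1[OF \<eta> small] and small_\<eta> = small'[OF \<eta> small] and G\<Gamma> = G_bound[OF \<eta> small]

lemma G0: "0 \<le> G m" using G_nonneg[of m] mb by simp

lemma \<Gamma>0: "0 \<le> \<Gamma>" using G0 G\<Gamma> by linarith

lemma wp_left: assumes "m \<le> x" "x \<le> b"
  shows "(\<lambda>x. w x * (l - v x) powr (-1/2)) absolutely_integrable_on {x..b}"
    "\<bar>integral {x..b} (\<lambda>x. w x * (l - v x) powr (-1/2))\<bar> \<le> 2 * W * sqrt (b - x) / \<kappa>"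
proof -
  have A: "\<And>t. x \<le> t \<Longrightarrow> t \<le> b \<Longrightarrow> \<kappa>\<^sup>2 * (b - t) \<le> l - v t"
    "\<And>t. x \<le> t \<Longrightarrow> t \<le> b \<Longrightarrow> \<bar>w t\<bar> \<le> W"
    using p_lower W assms \<gamma> a by auto
  note R = inverse_sqrt_integral[OF v_cont assms(2) \<kappa> vb A(1) w_meas A(2)]
  show "(\<lambda>x. w x * (l - v x) powr (-1/2)) absolutely_integrable_on {x..b}" by (rule R(1))
  show "\<bar>integral {x..b} (\<lambda>x. w x * (l - v x) powr (-1/2))\<bar> \<le> 2 * W * sqrt (b - x) / \<kappa>"
    by (rule R(2))
qed

text \<open>The primitive of \<open>\<phi>\<close> is small by \<open>mass_small\<close>, so
  \<open>w\<close> can be integrated against it by parts. Replacing \<open>G m\<close> by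
  \<open>\<Gamma>\<close> and the length by \<open>L\<close> removes all dependence on the state and
  the energy.\<close>

lemma bulk:
  "\<bar>integral {m..y1} (\<lambda>x. w x * (f x)\<^sup>2) - G m / 2 * integral {m..y1} (\<lambda>x. w x * (l - v x) powr (-1/2))\<bar>
    \<le> B / K\<^sup>2 * \<Gamma> * (2 * W * 2 ^ card F + D * L) * \<eta>"
proof -
  define \<phi> where "\<phi> t = (f t)\<^sup>2 - G m / (2 * s t)" for t
  have "((\<lambda>x. w x * (f x)\<^sup>2 - G m / 2 * (w x * (l - v x) powr (-1/2))) has_integral
     (integral {m..y1} (\<lambda>x. w x * (f x)\<^sup>2) - G m / 2 * integral {m..y1} (\<lambda>x. w x * (l - v x) powr (-1/2)))) {m..y1}"
    using y1 \<gamma> a mb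
    by (intro has_integral_diff has_integral_mult_right integrable_integral wf_on
        integrable_on_subinterval[OF set_lebesgue_integral_eq_integral(1)[OF wp_left(1)[of m]]]) auto
  moreover have "w x * (f x)\<^sup>2 - G m / 2 * (w x * (l - v x) powr (-1/2)) = w x * \<phi> x" if "x \<in> {m..y1}" for x
  proof -
    have "m \<le> x" "x < b" using that y1 by auto
    from inverse_sqrt_powr[OF less_imp_le[OF pos(1)[OF this]]]
    have "(l - v x) powr (-1/2) = 1 / s x" by (simp only: s_def)
    then show ?thesis by (simp only: \<phi>_def) (simp add: right_diff_distrib)
  qed
  ultimately have I: "((\<lambda>x. w x * \<phi> x) has_integral
     (integral {m..y1} (\<lambda>x. w x * (f x)\<^sup>2) - G m / 2 * integral {m..y1} (\<lambda>x. w x * (l - v x) powr (-1/2)))) {m..y1}"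
    by - (rule has_integral_eq[rotated])
  have cont: "isCont \<phi> t" if "t \<in> {m..y1}" for t
  proof -
    have t: "m \<le> t" "t < b" using that y1 by auto
    show ?thesis
      unfolding \<phi>_def using pos(2)[OF t]
      by (intro continuous_intros DERIV_isCont[OF f] DERIV_isCont[OF s_deriv[OF t]]) auto
  qed
  have "\<bar>integral {m..y1} (\<lambda>x. w x * \<phi> x)\<bar> \<le> (B * \<eta> / K\<^sup>2 * G m) * (2 * W * 2 ^ card F + D * (y1 - m))"
  proof (rule integral_against_small_primitive[where a = m and c = y1])
    show "continuous_on {m..y1} \<phi>" by (intro continuous_at_imp_continuous_on ballI cont)
    show "\<bar>integral {m..x} \<phi>\<bar> \<le> B * \<eta> / K\<^sup>2 * G m" if "m \<le> x" "x \<le> y1" for x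
      using mass_small[OF \<eta> small that] by (simp only: \<phi>_def[abs_def])
    show "\<bar>w x\<bar> \<le> W" if "m \<le> x" "x \<le> y1" for x
      using that y1 \<gamma> a by (intro W) auto
    show "w field_differentiable at x \<and> \<bar>deriv w x\<bar> \<le> D" if "m < x" "x < y1" "x \<notin> F" for x
      using that y1 by (intro F) auto
  qed (use D F y1 has_integral_integrable[OF I] in auto)
  also have "\<dots> \<le> (B * \<eta> / K\<^sup>2 * \<Gamma>) * (2 * W * 2 ^ card F + D * L)"
  proof (rule mult_mono)
    show "B * \<eta> / K\<^sup>2 * G m \<le> B * \<eta> / K\<^sup>2 * \<Gamma>"
      using B_pos \<eta> by (intro mult_left_mono G\<Gamma>) auto
    have "D * (y1 - m) \<le> D * L" using D y1 L by (intro mult_left_mono) auto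
    then show "2 * W * 2 ^ card F + D * (y1 - m) \<le> 2 * W * 2 ^ card F + D * L" by simp
  qed (use B_pos \<eta> \<Gamma>0 W_nonneg D y1 in auto)
  finally show ?thesis unfolding integral_unique[OF I] by (simp add: mult_ac)
qed

theorem half_estimate:
  "\<bar>integral {m..} (\<lambda>x. w x * (f x)\<^sup>2) - G m / 2 * integral {m..b} (\<lambda>x. w x * (l - v x) powr (-1/2))\<bar>
    \<le> \<Xi> W D (card F) (C0 * P a ^ n) * \<eta>"
proof -
  have ord: "m \<le> y1" "y1 \<le> b" "y1 \<le> b2" "b2 \<le> a" "m \<le> b2" "y1 \<le> a"
    using y1 \<gamma> a mb by auto
  let ?g = "\<lambda>x. w x * (f x)\<^sup>2" and ?p = "\<lambda>x. w x * (l - v x) powr (-1/2)"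
  have split: "integral {m..} ?g = integral {m..y1} ?g + integral {y1..b2} ?g + integral {b2..a} ?g + integral {a..} ?g"
  proof -
    have "integral {m..} ?g = integral {m..a} ?g + integral {a..} ?g"
      unfolding half_line
    proof (rule Henstock_Kurzweil_Integration.integral_Un)
      have "{m..a} \<inter> {a..} \<subseteq> {a}" by auto
      then show "negligible ({m..a} \<inter> {a..})" by (rule negligible_subset[OF negligible_sing])
    qed (use wf_left wf_right(1) set_lebesgue_integral_eq_integral(1) in blast)+
    moreover have "integral {m..y1} ?g + integral {y1..b2} ?g = integral {m..b2} ?g"
      using ord by (intro Henstock_Kurzweil_Integration.integral_combine wf_on) auto
    moreover have "integral {m..b2} ?g + integral {b2..a} ?g = integral {m..a} ?g"
      using ord by (intro Henstock_Kurzweil_Integration.integral_combine wf_on) auto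
    ultimately show ?thesis by linarith
  qed
  have psplit: "integral {m..b} ?p = integral {m..y1} ?p + integral {y1..b} ?p"
    using ord wp_left(1)[of m] mb
    by (intro Henstock_Kurzweil_Integration.integral_combine[symmetric] set_lebesgue_integral_eq_integral(1)) auto
  \<comment> \<open>The contributions of the forbidden region are of order \<open>h\<^sup>2\<close>,
    better than required, and are simply weakened to \<open>\<eta>\<close>.\<close>
  have h2: "h\<^sup>2 * c \<le> c * \<eta>" if "0 \<le> c" for c
    using mult_left_mono[OF small_\<eta>(4) that] by (simp add: mult.commute)
  have J2: "\<bar>G m / 2 * integral {y1..b} ?p\<bar> \<le> \<Gamma> * W * K / \<kappa> * \<eta>"
  proof -
    have "\<bar>integral {y1..b} ?p\<bar> \<le> 2 * W * r y1 / \<kappa>"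
      using wp_left(2)[of y1] ord by (simp add: r_def)
    then have "G m / 2 * \<bar>integral {y1..b} ?p\<bar> \<le> \<Gamma> / 2 * (2 * W * r y1 / \<kappa>)"
      using G0 G\<Gamma> \<Gamma>0 by (intro mult_mono) auto
    then show ?thesis using G0 by (simp add: abs_mult y1(5) mult_ac)
  qed
  have I2: "\<bar>integral {y1..b2} ?g\<bar> \<le> W * ((2 * \<Gamma> * (sqrt M * K) + M * (4 / (\<gamma>^3 * k))) / k) * \<eta>"
  proof -
    \<comment> \<open>This is \<open>E\<close> at the cut: \<open>G\<close> has at most doubled, and
      \<open>s\<close> is at most \<open>sqrt M * K * \<eta>\<close>. The factor
      \<open>\<eta>\<close> for the turning strip originates here.\<close>
    have "G y1 * s y1 \<le> 2 * \<Gamma> * (sqrt M * r y1)"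
      using G_close(1)[OF y1(3,4) r_x1[OF \<eta> small]] G\<Gamma> s_le(1)[OF \<eta> small y1(3,4)] pos(2)[OF y1(3,4)] \<Gamma>0
      by (intro mult_mono) auto
    moreover have "M * (4 * h\<^sup>2 / (\<gamma>^3 * k)) \<le> M * (4 / (\<gamma>^3 * k)) * \<eta>"
      using h2[of "M * (4 / (\<gamma>^3 * k))"] M \<gamma> k by (simp add: mult_ac)
    ultimately have "G y1 * s y1 + M * (4 * h\<^sup>2 / (\<gamma>^3 * k)) \<le> (2 * \<Gamma> * (sqrt M * K) + M * (4 / (\<gamma>^3 * k))) * \<eta>"
      unfolding y1(5) by (simp only: distrib_right mult.assoc)
    then have "(G y1 * s y1 + M * (4 * h\<^sup>2 / (\<gamma>^3 * k))) / k \<le> (2 * \<Gamma> * (sqrt M * K) + M * (4 / (\<gamma>^3 * k))) * \<eta> / k"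
      using k by (intro divide_right_mono) auto
    then have "integral {y1..b2} (\<lambda>x. (f x)\<^sup>2) \<le> (2 * \<Gamma> * (sqrt M * K) + M * (4 / (\<gamma>^3 * k))) * \<eta> / k"
      using turning_mass[OF y1(1,4)] by linarith
    then have "W * integral {y1..b2} (\<lambda>x. (f x)\<^sup>2) \<le> W * ((2 * \<Gamma> * (sqrt M * K) + M * (4 / (\<gamma>^3 * k))) * \<eta> / k)"
      using W_nonneg by (intro mult_left_mono) auto
    then show ?thesis using wf_bound[of y1 b2] ord by simp
  qed
  have I3: "\<bar>integral {b2..a} ?g\<bar> \<le> W * (4 / (\<gamma>\<^sup>2 * k)) * \<eta>"
  proof -
    have "integral {b2..a} (\<lambda>x. (f x)\<^sup>2) \<le> integral {b1..} (\<lambda>x. (f x)\<^sup>2)"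
      using \<gamma> by (intro Henstock_Kurzweil_Integration.integral_subset_le f2_on(2)) auto
    also have "\<dots> \<le> 4 / (\<gamma>\<^sup>2 * k) * \<eta>"
      using tail_mass h2[of "4 / (\<gamma>\<^sup>2 * k)"] k by (simp add: mult_ac)
    finally have "W * integral {b2..a} (\<lambda>x. (f x)\<^sup>2) \<le> W * (4 / (\<gamma>\<^sup>2 * k) * \<eta>)"
      using W_nonneg by (rule mult_left_mono)
    then show ?thesis using wf_bound[of b2 a] ord by simp
  qed
  have I4: "\<bar>integral {a..} ?g\<bar> \<le> C0 * P a ^ n * (4 / \<gamma>\<^sup>2) * \<eta>"
  proof -
    have "1 \<le> P a" by (rule P(2)) simp
    then have "0 \<le> C0 * P a ^ n * (4 / \<gamma>\<^sup>2)" using C0(1) by simp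
    from h2[OF this] show ?thesis using wf_right(2) by (simp add: mult_ac)
  qed
  have "\<Xi> W D (card F) (C0 * P a ^ n) * \<eta>
    = B / K\<^sup>2 * \<Gamma> * (2 * W * 2 ^ card F + D * L) * \<eta> + \<Gamma> * W * K / \<kappa> * \<eta>
      + W * ((2 * \<Gamma> * (sqrt M * K) + M * (4 / (\<gamma>^3 * k))) / k) * \<eta>
      + W * (4 / (\<gamma>\<^sup>2 * k)) * \<eta> + C0 * P a ^ n * (4 / \<gamma>\<^sup>2) * \<eta>"
    unfolding \<Xi>_def by (simp only: distrib_right)
  moreover have "G m / 2 * integral {m..b} ?p = G m / 2 * integral {m..y1} ?p + G m / 2 * integral {y1..b} ?p"
    unfolding psplit by (simp only: distrib_left)
  ultimately show ?thesis using split bulk J2 I2 I3 I4 by linarith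
qed

end

section \<open>Uniformity in the energy\<close>

text \<open>All constants are read off at \<open>l0\<close>: near \<open>xp\<close> the slope is at
  least half its value at \<open>xp\<close>, and outside that window compactness, together with
  \<open>far\<close> at infinity, keeps \<open>v\<close> away from \<open>l0\<close>. Both facts
  persist for nearby energies, whose turning point comes from the intermediate value
  theorem.\<close>

lemma right_well_uniform:
  fixes v v1 v2 :: "real \<Rightarrow> real"
  assumes v: "\<And>x. (v has_real_derivative v1 x) (at x)"
    and v1: "\<And>x. (v1 has_real_derivative v2 x) (at x)"
    and v2: "continuous_on UNIV v2"
    and mx: "m < xp" and vx: "v xp = l0"
    and below: "\<And>x. m \<le> x \<Longrightarrow> x < xp \<Longrightarrow> v x < l0"
    and above: "\<And>x. xp < x \<Longrightarrow> l0 < v x"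
    and slope: "v1 xp > 0"
    and far: "k0 > 0" "\<And>x. R \<le> x \<Longrightarrow> l0 + k0 \<le> v x"
    and e: "e > 0"
  shows "\<exists>\<epsilon> \<kappa> M L b1 b2 \<delta> \<gamma> k. \<epsilon> > 0 \<and> 2 * \<epsilon> \<le> k0 \<and> b2 \<le> xp + e \<and>
    (\<forall>l. \<bar>l - l0\<bar> < \<epsilon> \<longrightarrow> (\<exists>b. \<bar>b - xp\<bar> < e \<and> v1 b > 0 \<and> right_well v v1 v2 m b l \<kappa> M L b1 b2 \<delta> \<gamma> k))"
proof -
  have vc: "continuous_on X v" for X
    using v by (intro continuous_at_imp_continuous_on ballI DERIV_isCont) auto
  have v1c: "continuous_on X v1" for X
    using v1 by (intro continuous_at_imp_continuous_on ballI DERIV_isCont) auto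
  define \<mu> where "\<mu> = v1 xp / 2"
  have \<mu>: "\<mu> > 0" using slope by (simp add: \<mu>_def)
  obtain r0 where r0: "r0 > 0" "\<And>x. \<bar>x - xp\<bar> < r0 \<Longrightarrow> \<bar>v1 x - v1 xp\<bar> < \<mu>"
    using DERIV_isCont[OF v1, of xp] \<mu> unfolding continuous_at_eps_delta dist_real_def by blast
  \<comment> \<open>Half-width of the window: it respects continuity of the slope, the prescribed
    \<open>e\<close>, and leaves room between \<open>m\<close> and every turning point.\<close>
  define r where "r = min r0 (min e (xp - m)) / 2"
  have r: "r > 0" "r < r0" "r < e" "2 * r \<le> xp - m"
    using r0 e mx by (auto simp: r_def)
  have v1r: "\<mu> \<le> v1 x" if "xp - r \<le> x" "x \<le> xp + r" for x
    using r0(2)[of x] that r unfolding \<mu>_def abs_less_iff by auto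
  have incr: "\<mu> * (y - x) \<le> v y - v x" if "xp - r \<le> x" "x \<le> y" "y \<le> xp + r" for x y
  proof -
    have "(\<lambda>t. v t - \<mu> * t) x \<le> (\<lambda>t. v t - \<mu> * t) y"
    proof (rule DERIV_nonneg_imp_nondecreasing[OF that(2)])
      fix t assume "x \<le> t" "t \<le> y"
      then have "0 \<le> v1 t - \<mu> * 1" using v1r[of t] that by simp
      then show "\<exists>D. ((\<lambda>t. v t - \<mu> * t) has_real_derivative D) (at t) \<and> 0 \<le> D"
        using DERIV_diff[OF v DERIV_cmult[OF DERIV_ident]] by blast
    qed
    then show ?thesis by (simp add: right_diff_distrib)
  qed
  obtain c1 where c1: "c1 > 0" "\<And>x. m \<le> x \<Longrightarrow> x \<le> xp - r \<Longrightarrow> v x \<le> l0 - c1"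
  proof -
    have "compact {m..xp - r}" "{m..xp - r} \<noteq> {}" using r by auto
    from continuous_attains_sup[OF this vc] obtain z where
      z: "m \<le> z" "z \<le> xp - r" "\<And>x. m \<le> x \<Longrightarrow> x \<le> xp - r \<Longrightarrow> v x \<le> v z" by auto
    show ?thesis by (rule that[of "l0 - v z"]) (use z below[of z] r in auto)
  qed
  obtain c2 where c2: "c2 > 0" "c2 \<le> k0" "\<And>x. xp + r \<le> x \<Longrightarrow> l0 + c2 \<le> v x"
  proof -
    define R' where "R' = max R (xp + r)"
    have "compact {xp + r..R'}" "{xp + r..R'} \<noteq> {}" by (auto simp: R'_def)
    from continuous_attains_inf[OF this vc] obtain z where
      z: "xp + r \<le> z" "\<And>x. xp + r \<le> x \<Longrightarrow> x \<le> R' \<Longrightarrow> v z \<le> v x" by auto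
    have "l0 < v z" using z above[of z] r by auto
    moreover have "l0 + min k0 (v z - l0) \<le> v x" if "xp + r \<le> x" for x
      using z(2)[of x] far(2)[of x] that by (cases "x \<le> R'") (auto simp: R'_def not_le min_le_iff_disj add_increasing2 min_def)
    ultimately show ?thesis using far(1) by (intro that[of "min k0 (v z - l0)"]) auto
  qed
  \<comment> \<open>The first two terms preserve half of the gaps \<open>c1\<close> and
    \<open>c2\<close>; the third keeps the turning point within \<open>r / 2\<close> of
    \<open>xp\<close>, as \<open>v\<close> changes by at least \<open>\<mu> * r / 2\<close> on
    either side.\<close>
  define \<epsilon> where "\<epsilon> = min (min (c1 / 2) (c2 / 2)) (\<mu> * r / 4)"
  have \<epsilon>: "\<epsilon> > 0" "\<epsilon> \<le> c1 / 2" "\<epsilon> \<le> c2 / 2" "\<epsilon> \<le> \<mu> * r / 4"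
    using c1 c2 \<mu> r by (auto simp: \<epsilon>_def)
  have bound: "\<exists>C. \<forall>x\<in>{m..xp + r}. \<bar>g x\<bar> \<le> C" if "continuous_on {m..xp + r} g" for g :: "real \<Rightarrow> real"
    using compact_imp_bounded[OF compact_continuous_image[OF that compact_Icc]]
    unfolding bounded_iff by auto
  obtain M1 where M1: "\<forall>x\<in>{m..xp + r}. \<bar>v1 x\<bar> \<le> M1" using bound[OF v1c] by blast
  obtain M2 where M2: "\<forall>x\<in>{m..xp + r}. \<bar>v2 x\<bar> \<le> M2"
    using bound[OF continuous_on_subset[OF v2]] by blast
  define M where "M = max 1 (max (max M1 M2) (v (xp + r) - l0 + \<epsilon>))"
  have M: "M > 0" "M1 \<le> M" "M2 \<le> M" "v (xp + r) - l0 + \<epsilon> \<le> M" by (auto simp: M_def)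
  define L where "L = xp + r - m"
  have L: "L > 0" using mx r by (simp add: L_def)
  \<comment> \<open>The term \<open>\<mu>\<close> serves inside the window, where \<open>v\<close>
    has slope at least \<open>\<mu>\<close>. The other term serves to its left, where a gap of
    \<open>c1 / 2\<close> must dominate a linear function over the length \<open>L\<close>.\<close>
  define \<kappa> where "\<kappa> = sqrt (min \<mu> (c1 / 2 / L))"
  have \<kappa>: "\<kappa> > 0" "\<kappa>\<^sup>2 \<le> \<mu>" "\<kappa>\<^sup>2 \<le> c1 / 2 / L" using \<mu> c1 L by (auto simp: \<kappa>_def)
  define k where "k = min (min \<mu> (\<mu> * r / 4)) (c2 / 2)"
  have k: "k > 0" "k \<le> \<mu>" "k \<le> \<mu> * r / 4" "k \<le> c2 / 2" using \<mu> r c2 by (auto simp: k_def)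
  \<comment> \<open>As \<open>b\<close> lies within \<open>r / 2\<close> of \<open>xp\<close>, the
    points \<open>xp + 3 * r / 4\<close> and \<open>xp + r\<close> leave two gaps of
    \<open>r / 4\<close>, and \<open>b - r / 2\<close> stays in the window.\<close>
  have main: "\<exists>b. \<bar>b - xp\<bar> < e \<and> v1 b > 0 \<and>
      right_well v v1 v2 m b l \<kappa> M L (xp + 3 * r / 4) (xp + r) (r / 2) (r / 4) k"
    if l: "\<bar>l - l0\<bar> < \<epsilon>" for l
  proof -
    have "\<mu> * (r / 2) \<le> l0 - v (xp - r / 2)" "\<mu> * (r / 2) \<le> v (xp + r / 2) - l0"
      using incr[of "xp - r / 2" xp] incr[of xp "xp + r / 2"] r vx by auto
    moreover have "0 < \<mu> * r" using \<mu> r by simp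
    ultimately have lo: "v (xp - r / 2) < l" "l < v (xp + r / 2)" using l \<epsilon>(4) by auto
    obtain b where b: "xp - r / 2 \<le> b" "b \<le> xp + r / 2" "v b = l"
      using IVT'[of v "xp - r / 2" l "xp + r / 2"] lo r vc by auto
    have low: "l - v x \<ge> \<kappa>\<^sup>2 * (b - x)" if "m \<le> x" "x \<le> b" for x
    proof (cases "x \<le> xp - r")
      case True
      have "\<kappa>\<^sup>2 * (b - x) \<le> (c1 / 2 / L) * L"
        using \<kappa> that b L r c1 by (intro mult_mono) (auto simp: L_def)
      then have "\<kappa>\<^sup>2 * (b - x) \<le> c1 / 2" using L by simp
      then show ?thesis using c1(2)[OF that(1) True] l \<epsilon>(2) by auto
    next
      case False
      have "\<kappa>\<^sup>2 * (b - x) \<le> \<mu> * (b - x)" using \<kappa> that by (intro mult_right_mono) auto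
      then show ?thesis using incr[of x b] False that b r by auto
    qed
    have high: "\<mu> * (x - b) \<le> v x - l \<or> c2 / 2 \<le> v x - l" if "b \<le> x" for x
    proof (cases "x \<le> xp + r")
      case True
      then show ?thesis using incr[of b x] that b r by auto
    next
      case False
      then show ?thesis using c2(3)[of x] l \<epsilon>(3) by auto
    qed
    have "right_well v v1 v2 m b l \<kappa> M L (xp + 3 * r / 4) (xp + r) (r / 2) (r / 4) k"
    proof
      show "m < b" "2 * (r / 2) \<le> b - m" "b + r / 4 \<le> xp + 3 * r / 4" "b - m \<le> L"
        using b r by (auto simp: L_def)
      show "\<bar>v1 x\<bar> \<le> M" "\<bar>v2 x\<bar> \<le> M" if "m \<le> x" "x \<le> b" for x
        using bspec[OF M1, of x] bspec[OF M2, of x] M that b r by auto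
      show "l - v x \<le> M * (b - x)" if "m \<le> x" "x \<le> b" for x
      proof -
        have "(\<lambda>t. M * t - v t) x \<le> (\<lambda>t. M * t - v t) b"
        proof (rule DERIV_nonneg_imp_nondecreasing[OF that(2)])
          fix t assume "x \<le> t" "t \<le> b"
          then have "0 \<le> M * 1 - v1 t" using bspec[OF M1, of t] M(2) that b r by auto
          then show "\<exists>D. ((\<lambda>t. M * t - v t) has_real_derivative D) (at t) \<and> 0 \<le> D"
            using DERIV_diff[OF DERIV_cmult[OF DERIV_ident] v] by blast
        qed
        then show ?thesis using b(3) by (simp add: right_diff_distrib)
      qed
      show "k \<le> v1 x" if "b - r / 2 \<le> x" "x \<le> xp + r" for x
        using v1r[of x] that b k by auto
      show "l < v x" if "b < x" for x
      proof -
        have "0 < \<mu> * (x - b)" using \<mu> that by simp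
        with high[OF less_imp_le[OF that]] c2(1) show ?thesis by linarith
      qed
      show "k \<le> v x - l" if "xp + 3 * r / 4 \<le> x" for x
      proof -
        have "\<mu> * (r / 4) \<le> \<mu> * (x - b)" using \<mu> that b by (intro mult_left_mono) auto
        moreover have "b \<le> x" using that b r by auto
        ultimately show ?thesis using high[of x] k by linarith
      qed
      show "v (xp + r) - l \<le> M" using M l by auto
    qed (use v v1 \<kappa> M r k b low in auto)
    moreover have "v1 b > 0" using v1r[of b] b r \<mu> by auto
    moreover have "\<bar>b - xp\<bar> < e" using b r by auto
    ultimately show ?thesis by blast
  qed
  have "\<epsilon> > 0 \<and> 2 * \<epsilon> \<le> k0 \<and> xp + r \<le> xp + e" using \<epsilon> c2 r by auto
  with main show ?thesis by blast
qed

text \<open>In the last claim the integrand is at least \<open>sqrt k\<close> beyond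
  \<open>R\<close>, so a further distance \<open>1 / sqrt k\<close> already contributes 1. A weight
  of at least 1 is what allows exponents to be rounded up.\<close>

lemma phase_properties:
  fixes v :: "real \<Rightarrow> real" and l :: real
  assumes v: "continuous_on UNIV v"
  defines "P \<equiv> \<lambda>x. integral {0..x} (\<lambda>y. sqrt \<bar>v y - l\<bar>)"
  shows "0 \<le> x \<Longrightarrow> \<bar>LBINT y=0..ereal x. sqrt \<bar>v y - l\<bar>\<bar> = P x"
    and "0 < x \<Longrightarrow> (P has_real_derivative sqrt \<bar>v x - l\<bar>) (at x)"
    and "0 \<le> R \<Longrightarrow> 0 < k \<Longrightarrow> (\<And>y. R \<le> y \<Longrightarrow> l + k \<le> v y) \<Longrightarrow> R + 1 / sqrt k \<le> x \<Longrightarrow> 1 \<le> P x"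
proof -
  define g where "g y = sqrt \<bar>v y - l\<bar>" for y
  have g: "continuous_on X g" for X
    unfolding g_def by (intro continuous_intros continuous_on_subset[OF v]) auto
  have gi: "g integrable_on {x..y}" for x y by (intro integrable_continuous_interval g)
  have P: "P = (\<lambda>x. integral {0..x} g)" by (simp add: P_def g_def[abs_def])
  have g0: "0 \<le> g y" for y by (simp add: g_def)
  have "\<bar>LBINT y=0..ereal x. g y\<bar> = P x" if "0 \<le> x" for x
  proof -
    have "(LBINT y=ereal 0..ereal x. g y) = integral {0..x} g"
      using that by (intro interval_integral_eq_integral borel_integrable_atLeastAtMost' g)
    moreover have "0 \<le> integral {0..x} g" by (intro Henstock_Kurzweil_Integration.integral_nonneg gi g0)
    ultimately show ?thesis by (simp add: P zero_ereal_def)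
  qed
  then show "0 \<le> x \<Longrightarrow> \<bar>LBINT y=0..ereal x. sqrt \<bar>v y - l\<bar>\<bar> = P x"
    by (simp add: g_def[abs_def])
  have "(P has_real_derivative g x) (at x)" if "0 < x"
  proof -
    have "((\<lambda>x. integral {0..x} g) has_real_derivative g x) (at x within {0..x + 1})"
      using that by (intro integral_has_real_derivative g) auto
    moreover have "at x within {0..x + 1} = at x"
      using that by (intro at_within_interior) auto
    ultimately show ?thesis by (simp add: P)
  qed
  then show "0 < x \<Longrightarrow> (P has_real_derivative sqrt \<bar>v x - l\<bar>) (at x)" by (simp add: g_def)
  show "1 \<le> P x" if R: "0 \<le> R" "0 < k" "\<And>y. R \<le> y \<Longrightarrow> l + k \<le> v y" "R + 1 / sqrt k \<le> x"
  proof -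
    have Rx: "R \<le> x" using R(2,4) order_trans[of R "R + 1 / sqrt k" x] by simp
    have "sqrt k * (1 / sqrt k) \<le> sqrt k * (x - R)" using R by (intro mult_left_mono) auto
    then have "1 \<le> sqrt k * (x - R)" using R(2) by simp
    also have "\<dots> = integral {R..x} (\<lambda>_. sqrt k)" using Rx by simp
    also have "\<dots> \<le> integral {R..x} g"
    proof (rule integral_le[OF _ gi])
      fix y assume "y \<in> {R..x}"
      then have "k \<le> \<bar>v y - l\<bar>" using R(3)[of y] by auto
      then show "sqrt k \<le> g y" unfolding g_def by (rule real_sqrt_le_mono)
    qed auto
    also have "\<dots> \<le> integral {0..x} g"
      using R(1) g0 by (intro Henstock_Kurzweil_Integration.integral_subset_le gi) auto
    finally show ?thesis by (simp add: P)
  qed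
qed

lemma interval_integral_reflect_0:
  "(LBINT y=0..ereal x. g (- y)) = - (LBINT y=0..ereal (- x). g y :: real)"
proof -
  have "(LBINT y=0..ereal x. g (- y)) = (LBINT y=ereal (- x)..0. g y)"
    by (subst interval_integral_reflect) simp
  also have "\<dots> = - (LBINT y=0..ereal (- x). g y)" by (rule interval_integral_endpoints_reverse)
  finally show ?thesis .
qed

text \<open>Two-sided version by reflection. It is needed for exponent 0, since
  \<open>0 powr 0\<close> is 0 and the phase must therefore be known to be nonzero.\<close>

lemma phase_ge_1:
  fixes v :: "real \<Rightarrow> real"
  assumes v: "continuous_on UNIV v" and R: "0 \<le> R" and k: "0 < k"
    and far: "\<And>y. R \<le> \<bar>y\<bar> \<Longrightarrow> l + k \<le> v y" and x: "R + 1 / sqrt k \<le> \<bar>x\<bar>"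
  shows "1 \<le> \<bar>LBINT y=0..ereal x. sqrt \<bar>v y - l\<bar>\<bar>"
proof (cases "0 \<le> x")
  case True
  then show ?thesis
    using phase_properties(1)[OF v True, of l] phase_properties(3)[OF v R k, of l x] far x by auto
next
  case False
  have v': "continuous_on UNIV (\<lambda>x. v (- x))"
    by (rule continuous_on_compose2[OF v]) (auto intro: continuous_intros)
  have "1 \<le> \<bar>LBINT y=0..ereal (- x). sqrt \<bar>v (- y) - l\<bar>\<bar>"
    using phase_properties(1)[OF v', of "- x" l] phase_properties(3)[OF v' R k, of l "- x"] far x False by auto
  then show ?thesis
    using interval_integral_reflect_0[of "- x" "\<lambda>y. sqrt \<bar>v y - l\<bar>"] by simp
qed

section \<open>The half-line estimate, uniform in the energy\<close>

definition normalized_state :: "(real \<Rightarrow> real) \<Rightarrow> real \<Rightarrow> real \<Rightarrow> (real \<Rightarrow> real) \<Rightarrow> (real \<Rightarrow> real) \<Rightarrow> bool" where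
  "normalized_state v l h f f1 \<longleftrightarrow>
     (\<forall>x. (f has_real_derivative f1 x) (at x)) \<and>
     (\<forall>x. (f1 has_real_derivative (v x - l) * f x / h\<^sup>2) (at x)) \<and>
     (\<lambda>x. (f x)\<^sup>2) absolutely_integrable_on UNIV \<and> integral UNIV (\<lambda>x. (f x)\<^sup>2) = 1"

text \<open>The coefficient \<open>c\<close> of the WKB density \<open>c (l - v)\<^sup>-\<^sup>1\<^sup>/\<^sup>2\<close>, read off at the interior point \<open>m\<close>;
  it is invariant under reflection.\<close>

definition amplitude :: "(real \<Rightarrow> real) \<Rightarrow> real \<Rightarrow> real \<Rightarrow> (real \<Rightarrow> real) \<Rightarrow> (real \<Rightarrow> real) \<Rightarrow> real \<Rightarrow> real" where
  "amplitude v l h f f1 m = (h\<^sup>2 * (f1 m)\<^sup>2 + (l - v m) * (f m)\<^sup>2) / sqrt (l - v m) / 2"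

text \<open>The order of quantifiers is the point: \<open>\<epsilon>\<close>, \<open>\<eta>0\<close>
  and \<open>C\<close> precede the energy and the state. The sign pattern of \<open>v - l\<close> is
  recorded with \<open>b\<close> because \<open>b\<close> is only given existentially and must later
  be recognized as the turning point.\<close>

definition half_line_estimate ::
  "(real \<Rightarrow> real) \<Rightarrow> (real \<Rightarrow> real) \<Rightarrow> (real \<Rightarrow> real) \<Rightarrow>
   real \<Rightarrow> real \<Rightarrow> real \<Rightarrow> real \<Rightarrow> real \<Rightarrow> real \<Rightarrow> real \<Rightarrow> bool" where
  "half_line_estimate v v1 w l0 m xp e \<epsilon> \<eta>0 C \<longleftrightarrow> (\<forall>l. \<bar>l - l0\<bar> < \<epsilon> \<longrightarrow>
    (\<exists>b. m < b \<and> \<bar>b - xp\<bar> < e \<and> v b = l \<and> v1 b > 0 \<and>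
      (\<forall>x. m \<le> x \<longrightarrow> x < b \<longrightarrow> v x < l) \<and> (\<forall>x>b. l < v x) \<and>
      (\<lambda>x. w x * (l - v x) powr (-1/2)) absolutely_integrable_on {m..b} \<and>
      (\<forall>\<eta> f f1. 0 < \<eta> \<longrightarrow> \<eta> \<le> \<eta>0 \<longrightarrow> normalized_state v l (\<eta> ^ 3) f f1 \<longrightarrow>
         (\<lambda>x. w x * (f x)\<^sup>2) absolutely_integrable_on {m..} \<and>
         \<bar>integral {m..} (\<lambda>x. w x * (f x)\<^sup>2)
           - amplitude v l (\<eta> ^ 3) f f1 m * integral {m..b} (\<lambda>x. w x * (l - v x) powr (-1/2))\<bar> \<le> C * \<eta>)))"

lemma half_line_uniform:
  fixes v v1 v2 w :: "real \<Rightarrow> real"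
  assumes v: "\<And>x. (v has_real_derivative v1 x) (at x)"
    and v1: "\<And>x. (v1 has_real_derivative v2 x) (at x)"
    and v2: "continuous_on UNIV v2"
    and mx: "m < xp" and vx: "v xp = l0"
    and below: "\<And>x. m \<le> x \<Longrightarrow> x < xp \<Longrightarrow> v x < l0"
    and above: "\<And>x. xp < x \<Longrightarrow> l0 < v x"
    and slope: "v1 xp > 0"
    and far: "k0 > 0" "\<And>x. R \<le> x \<Longrightarrow> l0 + k0 \<le> v x"
    and e: "e > 0"
    and w_meas: "w \<in> borel_measurable lebesgue"
    and w_bdd: "\<And>S. bounded S \<Longrightarrow> bounded (w ` S)"
    and F: "finite F" "\<And>x. m < x \<Longrightarrow> x < xp + e \<Longrightarrow> x \<notin> F \<Longrightarrow> w field_differentiable (at x) \<and> \<bar>deriv w x\<bar> \<le> D"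
    and D: "0 \<le> D"
    and growth: "\<And>x. R \<le> x \<Longrightarrow> \<bar>w x\<bar> \<le> C0 * (v x - l0) * \<bar>LBINT y=0..ereal x. sqrt \<bar>v y - l0\<bar>\<bar> powr N"
  shows "\<exists>\<epsilon>>0. \<exists>\<eta>0>0. \<exists>C. half_line_estimate v v1 w l0 m xp e \<epsilon> \<eta>0 C"
proof -
  have vc: "continuous_on UNIV v"
    using v by (intro continuous_at_imp_continuous_on ballI DERIV_isCont) auto
  obtain \<epsilon> \<kappa> M L b1 b2 \<delta> \<gamma> k where \<epsilon>: "\<epsilon> > 0" "2 * \<epsilon> \<le> k0" "b2 \<le> xp + e"
    and rw: "\<And>l. \<bar>l - l0\<bar> < \<epsilon> \<Longrightarrow>
      \<exists>b. \<bar>b - xp\<bar> < e \<and> v1 b > 0 \<and> right_well v v1 v2 m b l \<kappa> M L b1 b2 \<delta> \<gamma> k"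
  proof -
    have "\<exists>\<epsilon> \<kappa> M L b1 b2 \<delta> \<gamma> k. \<epsilon> > 0 \<and> 2 * \<epsilon> \<le> k0 \<and> b2 \<le> xp + e \<and>
      (\<forall>l. \<bar>l - l0\<bar> < \<epsilon> \<longrightarrow> (\<exists>b. \<bar>b - xp\<bar> < e \<and> v1 b > 0 \<and> right_well v v1 v2 m b l \<kappa> M L b1 b2 \<delta> \<gamma> k))"
      by (rule right_well_uniform[where R = R]) (fact v v1 v2 mx vx below above slope far e)+
    then show thesis using that by blast
  qed
  define R' where "R' = max R 0"
  \<comment> \<open>Far enough out for \<open>growth\<close> and \<open>far\<close> to apply, for
    the phase to exceed 1, and to lie beyond every \<open>b\<close> and beyond
    \<open>b2\<close>.\<close>
  define a where "a = max (xp + e) (R' + max 1 (1 / sqrt k0))"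
  have a: "xp + e \<le> a" "b2 \<le> a" "R' + 1 / sqrt k0 \<le> a" "R \<le> a" "0 < a"
    using \<epsilon>(3) by (auto simp: a_def R'_def)
  define P where "P x = integral {0..x} (\<lambda>y. sqrt \<bar>v y - l0\<bar>)" for x
  define Q where "Q x = sqrt \<bar>v x - l0\<bar>" for x
  have P1: "(P has_real_derivative Q x) (at x)" if "a \<le> x" for x
    using phase_properties(2)[OF vc, of x l0] that a(5) by (simp add: P_def[abs_def] Q_def)
  have P2: "1 \<le> P x" if "a \<le> x" for x
    using phase_properties(3)[OF vc, of R' k0 l0 x] far that a(3) by (simp add: P_def[abs_def] R'_def)
  \<comment> \<open>The phase is at least 1 beyond \<open>a\<close>, so a real exponent may be
    rounded up to a natural one; a negative \<open>N\<close> gives 0.\<close>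
  define n where "n = nat \<lceil>N\<rceil>"
  \<comment> \<open>The factor 2 pays for the change of energy from \<open>v - l0\<close> to
    \<open>v - l\<close>, which is where \<open>2 * \<epsilon> \<le> k0\<close> is used.\<close>
  define C1 where "C1 = 2 * \<bar>C0\<bar>"
  have C1: "0 \<le> C1" by (simp add: C1_def)
  obtain W where W: "\<And>x. m \<le> x \<Longrightarrow> x \<le> a \<Longrightarrow> \<bar>w x\<bar> \<le> W"
  proof -
    have "bounded (w ` {m..a})" by (intro w_bdd bounded_closed_interval)
    then obtain W where "\<forall>y\<in>w ` {m..a}. norm y \<le> W" unfolding bounded_iff by blast
    then show thesis by (intro that[of W]) auto
  qed
  \<comment> \<open>The denominator combines three smallness conditions:
    \<open>\<eta> \<le> 1\<close>, the one with \<open>\<Lambda>\<close>, and the one that absorbs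
    the derivative of the weight. Seen from outside its locale, \<open>\<Lambda>\<close> depends
    only on \<open>\<kappa>\<close>, \<open>M\<close>, \<open>L\<close> and \<open>\<delta>\<close>,
    hence not on the energy; the same kind of uniformity holds for \<open>C\<close>.\<close>
  define \<eta>0 where "\<eta>0 = 1 / (1 + \<bar>half_state.\<Lambda> \<kappa> M L \<delta>\<bar> + 2 * real n)"
  have \<eta>0: "\<eta>0 > 0" by (simp add: \<eta>0_def add_pos_nonneg)
  define C where "C = half_state.\<Xi> \<kappa> M L \<delta> \<gamma> k W D (card F) (C1 * P a ^ n)"
  show ?thesis
    unfolding half_line_estimate_def
  proof (rule exI[of _ \<epsilon>], rule conjI[OF \<epsilon>(1)], rule exI[of _ \<eta>0], rule conjI[OF \<eta>0], rule exI[of _ C],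
      intro allI impI)
    fix l assume l: "\<bar>l - l0\<bar> < \<epsilon>"
    obtain b where b: "\<bar>b - xp\<bar> < e" "v1 b > 0" and rwb: "right_well v v1 v2 m b l \<kappa> M L b1 b2 \<delta> \<gamma> k"
      using rw[OF l] by blast
    interpret right_well v v1 v2 m b l \<kappa> M L b1 b2 \<delta> \<gamma> k by (rule rwb)
    have ql: "0 \<le> Q x \<and> (Q x)\<^sup>2 \<le> 2 * (v x - l)" and ql': "v x - l0 \<le> 2 * (v x - l)" "0 \<le> v x - l0"
      if "a \<le> x" for x
    proof -
      have "l0 + k0 \<le> v x" using far(2)[of x] that a by auto
      then show "v x - l0 \<le> 2 * (v x - l)" "0 \<le> v x - l0" using l \<epsilon> by auto
      then show "0 \<le> Q x \<and> (Q x)\<^sup>2 \<le> 2 * (v x - l)" by (simp add: Q_def)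
    qed
    have wC: "\<bar>w x\<bar> \<le> C1 * (P x ^ n * (v x - l))" if "a \<le> x" for x
    proof -
      have x: "R \<le> x" "0 \<le> x" using that a by auto
      note 1 = P2[OF that]
      have "P x powr N \<le> P x powr real n"
        using 1 by (intro powr_mono) (auto simp: n_def of_nat_ceiling)
      also have "\<dots> = P x ^ n" using 1 by (intro powr_realpow) simp
      finally have 2: "P x powr N \<le> P x ^ n" .
      have "\<bar>w x\<bar> \<le> C0 * (v x - l0) * P x powr N"
        using growth[OF x(1)] phase_properties(1)[OF vc x(2), of l0] by (simp add: P_def)
      also have "\<dots> \<le> \<bar>C0\<bar> * (2 * (v x - l)) * P x ^ n"
        using 2 ql'[OF that] by (intro mult_mono) auto
      also have "\<dots> = C1 * (P x ^ n * (v x - l))" by (simp add: C1_def)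
      finally show ?thesis .
    qed
    have ba: "b \<le> a" using a \<gamma> by linarith
    have "v x < l" if "m \<le> x" "x < b" for x
    proof -
      have "0 < \<kappa>\<^sup>2 * (b - x)" using \<kappa> that by simp
      then show ?thesis using p_lower[of x] that by linarith
    qed
    moreover have "(\<lambda>x. w x * (l - v x) powr (-1/2)) absolutely_integrable_on {m..b}"
      using mb p_lower W ba
      by (intro inverse_sqrt_integral(1)[OF vc _ \<kappa> vb _ w_meas, where W = W]) auto
    moreover have "(\<lambda>x. w x * (f x)\<^sup>2) absolutely_integrable_on {m..} \<and>
         \<bar>integral {m..} (\<lambda>x. w x * (f x)\<^sup>2)
           - amplitude v l (\<eta> ^ 3) f f1 m * integral {m..b} (\<lambda>x. w x * (l - v x) powr (-1/2))\<bar> \<le> C * \<eta>"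
      if \<eta>: "0 < \<eta>" "\<eta> \<le> \<eta>0"
        and f: "normalized_state v l (\<eta> ^ 3) f f1"
      for \<eta> f f1
    proof -
      have h: "\<eta> ^ 3 > 0" using \<eta> by simp
      define \<Lambda> where "\<Lambda> = half_state.\<Lambda> \<kappa> M L \<delta>"
      have "\<eta> * (1 + \<bar>\<Lambda>\<bar> + 2 * real n) \<le> \<eta>0 * (1 + \<bar>\<Lambda>\<bar> + 2 * real n)"
        using \<eta> by (intro mult_right_mono) auto
      also have "\<dots> = 1"
      proof -
        have "0 < 1 + \<bar>\<Lambda>\<bar> + 2 * real n" by (simp add: add_pos_nonneg)
        then show ?thesis unfolding \<eta>0_def \<Lambda>_def[symmetric] by simp
      qed
      finally have s: "\<eta> + \<eta> * \<bar>\<Lambda>\<bar> + \<eta> * (2 * real n) \<le> 1" by (simp add: distrib_left)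
      have nn: "0 \<le> \<eta> * \<bar>\<Lambda>\<bar>" "0 \<le> \<eta> * (2 * real n)" using \<eta> by simp_all
      have "\<eta> * \<Lambda> \<le> \<eta> * \<bar>\<Lambda>\<bar>" using \<eta> by (intro mult_left_mono) auto
      then have small: "\<eta> * half_state.\<Lambda> \<kappa> M L \<delta> \<le> 1" using s nn \<eta> unfolding \<Lambda>_def[symmetric] by linarith
      have "\<eta> \<le> 1" using s nn by linarith
      then have "\<eta> ^ 3 \<le> \<eta> ^ 1" using \<eta> by (intro power_decreasing) auto
      then have "2 * real n * \<eta> ^ 3 \<le> \<eta> * (2 * real n)"
        using mult_left_mono[of "\<eta> ^ 3" \<eta> "2 * real n"] by (simp add: mult_ac)
      then have n: "2 * real n * \<eta> ^ 3 \<le> 1" using s nn \<eta> by linarith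
      have fd: "\<And>x. (f has_real_derivative f1 x) (at x)"
          "\<And>x. (f1 has_real_derivative (v x - l) * f x / (\<eta> ^ 3)\<^sup>2) (at x)"
        and f2: "(\<lambda>x. (f x)\<^sup>2) absolutely_integrable_on UNIV" "integral UNIV (\<lambda>x. (f x)\<^sup>2) = 1"
        using f unfolding normalized_state_def by blast+
      have wd: "\<And>x. m < x \<Longrightarrow> x < b \<Longrightarrow> x \<notin> F \<Longrightarrow> w field_differentiable (at x) \<and> \<bar>deriv w x\<bar> \<le> D"
        using b by (intro F) auto
      interpret half_observable v v1 v2 m b l \<kappa> M L b1 b2 \<delta> \<gamma> k f f1 "\<eta> ^ 3" w P Q n a W D C1 \<eta> F
        by unfold_locales (fact fd h f2 w_meas a W F(1) wd D P1 P2 ql C1 wC n \<eta> refl small)+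
      have g: "amplitude v l (\<eta> ^ 3) f f1 m = G m / 2"
        by (simp add: amplitude_def G_def E_def s_def)
      show ?thesis unfolding g C_def using wf_integrable half_estimate by blast
    qed
    ultimately show "\<exists>b. m < b \<and> \<bar>b - xp\<bar> < e \<and> v b = l \<and> v1 b > 0 \<and> (\<forall>x. m \<le> x \<longrightarrow> x < b \<longrightarrow> v x < l) \<and> (\<forall>x>b. l < v x) \<and>
      (\<lambda>x. w x * (l - v x) powr (-1/2)) absolutely_integrable_on {m..b} \<and>
      (\<forall>\<eta> f f1. 0 < \<eta> \<longrightarrow> \<eta> \<le> \<eta>0 \<longrightarrow> normalized_state v l (\<eta> ^ 3) f f1 \<longrightarrow>
         (\<lambda>x. w x * (f x)\<^sup>2) absolutely_integrable_on {m..} \<and>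
         \<bar>integral {m..} (\<lambda>x. w x * (f x)\<^sup>2)
           - amplitude v l (\<eta> ^ 3) f f1 m * integral {m..b} (\<lambda>x. w x * (l - v x) powr (-1/2))\<bar> \<le> C * \<eta>)"
      using mb b vb q_pos by blast
  qed
qed

section \<open>The two-sided estimate\<close>

definition well_estimate ::
  "(real \<Rightarrow> real) \<Rightarrow> (real \<Rightarrow> real) \<Rightarrow> (real \<Rightarrow> real) \<Rightarrow>
   real \<Rightarrow> real \<Rightarrow> real \<Rightarrow> real \<Rightarrow> real \<Rightarrow> real \<Rightarrow> real \<Rightarrow> real \<Rightarrow> bool" where
  "well_estimate v v1 w l0 xm m xp e \<epsilon> \<eta>0 C \<longleftrightarrow> (\<forall>l. \<bar>l - l0\<bar> < \<epsilon> \<longrightarrow>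
    (\<exists>a b. a < m \<and> m < b \<and> \<bar>a - xm\<bar> < e \<and> \<bar>b - xp\<bar> < e \<and>
      v a = l \<and> v b = l \<and> v1 a < 0 \<and> v1 b > 0 \<and>
      (\<forall>x. a < x \<longrightarrow> x < b \<longrightarrow> v x < l) \<and> (\<forall>x. x < a \<or> b < x \<longrightarrow> l < v x) \<and>
      (\<lambda>x. w x * (l - v x) powr (-1/2)) absolutely_integrable_on {a..b} \<and>
      (\<forall>\<eta> f f1. 0 < \<eta> \<longrightarrow> \<eta> \<le> \<eta>0 \<longrightarrow> normalized_state v l (\<eta> ^ 3) f f1 \<longrightarrow>
         (\<lambda>x. w x * (f x)\<^sup>2) absolutely_integrable_on UNIV \<and>
         \<bar>integral UNIV (\<lambda>x. w x * (f x)\<^sup>2)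
           - amplitude v l (\<eta> ^ 3) f f1 m * integral {a..b} (\<lambda>x. w x * (l - v x) powr (-1/2))\<bar> \<le> C * \<eta>)))"

text \<open>The half-line estimate is applied to \<open>v\<close> and to its mirror image, starting
  from the same point \<open>m\<close>. As both use the same amplitude, the two estimates add up
  directly.\<close>

lemma two_sided_uniform:
  fixes v v1 v2 w :: "real \<Rightarrow> real"
  assumes v: "\<And>x. (v has_real_derivative v1 x) (at x)"
    and v1: "\<And>x. (v1 has_real_derivative v2 x) (at x)"
    and v2: "continuous_on UNIV v2"
    and m: "xm < m" "m < xp" and vx: "v xm = l0" "v xp = l0"
    and inside: "\<And>x. xm < x \<Longrightarrow> x < xp \<Longrightarrow> v x < l0"
    and outside: "\<And>x. x < xm \<Longrightarrow> l0 < v x" "\<And>x. xp < x \<Longrightarrow> l0 < v x"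
    and slope: "v1 xm < 0" "v1 xp > 0"
    and far: "k0 > 0" "\<And>x. R \<le> \<bar>x\<bar> \<Longrightarrow> l0 + k0 \<le> v x"
    and e: "e > 0"
    and w_meas: "w \<in> borel_measurable lebesgue"
    and w_bdd: "\<And>S. bounded S \<Longrightarrow> bounded (w ` S)"
    and F: "finite F"
      "\<And>x. xm - e < x \<Longrightarrow> x < xp + e \<Longrightarrow> x \<notin> F \<Longrightarrow> w field_differentiable (at x) \<and> \<bar>deriv w x\<bar> \<le> D"
    and D: "0 \<le> D"
    and growth: "\<And>x. R \<le> \<bar>x\<bar> \<Longrightarrow> \<bar>w x\<bar> \<le> C0 * (v x - l0) * \<bar>LBINT y=0..ereal x. sqrt \<bar>v y - l0\<bar>\<bar> powr N"
  shows "\<exists>\<epsilon>>0. \<exists>\<eta>0>0. \<exists>C. well_estimate v v1 w l0 xm m xp e \<epsilon> \<eta>0 C"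
proof -
  have right: "\<exists>\<epsilon>>0. \<exists>\<eta>0>0. \<exists>C. half_line_estimate v v1 w l0 m xp e \<epsilon> \<eta>0 C"
  proof (rule half_line_uniform)
    show "\<And>x. m \<le> x \<Longrightarrow> x < xp \<Longrightarrow> v x < l0" using inside m by auto
    show "\<And>x. m < x \<Longrightarrow> x < xp + e \<Longrightarrow> x \<notin> F \<Longrightarrow> w field_differentiable (at x) \<and> \<bar>deriv w x\<bar> \<le> D"
      using F m e by auto
    show "\<And>x. R \<le> x \<Longrightarrow> l0 + k0 \<le> v x" using far by auto
    show "\<And>x. R \<le> x \<Longrightarrow> \<bar>w x\<bar> \<le> C0 * (v x - l0) * \<bar>LBINT y=0..ereal x. sqrt \<bar>v y - l0\<bar>\<bar> powr N"
      by (rule growth) auto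
  qed (fact assms)+
  have left: "\<exists>\<epsilon>>0. \<exists>\<eta>0>0. \<exists>C. half_line_estimate (\<lambda>x. v (- x)) (\<lambda>x. - v1 (- x)) (\<lambda>x. w (- x)) l0 (- m) (- xm) e \<epsilon> \<eta>0 C"
  proof (rule half_line_uniform[where v = "\<lambda>x. v (- x)" and w = "\<lambda>x. w (- x)" and ?v1.0 = "\<lambda>x. - v1 (- x)" and ?v2.0 = "\<lambda>x. v2 (- x)"
        and R = R and F = "uminus ` F" and ?k0.0 = k0 and D = D and N = N and ?C0.0 = C0])
    show "((\<lambda>x. v (- x)) has_real_derivative - v1 (- x)) (at x)" for x
      by (rule DERIV_cong[OF DERIV_chain2[OF v DERIV_minus[OF DERIV_ident]]]) simp
    show "((\<lambda>x. - v1 (- x)) has_real_derivative v2 (- x)) (at x)" for x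
      by (rule DERIV_cong[OF DERIV_minus[OF DERIV_chain2[OF v1 DERIV_minus[OF DERIV_ident]]]]) simp
    show "continuous_on UNIV (\<lambda>x. v2 (- x))"
      by (rule continuous_on_compose2[OF v2]) (auto intro: continuous_intros)
    show "- m < - xm" "v (- (- xm)) = l0" "0 < - v1 (- (- xm))" using m vx slope by auto
    show "\<And>x. - m \<le> x \<Longrightarrow> x < - xm \<Longrightarrow> v (- x) < l0" using inside m by auto
    show "\<And>x. - xm < x \<Longrightarrow> l0 < v (- x)" using outside by auto
    show "\<And>x. R \<le> x \<Longrightarrow> l0 + k0 \<le> v (- x)" using far by auto
    show "(\<lambda>x. w (- x)) \<in> borel_measurable lebesgue"
      using measurable_compose[OF lebesgue_measurable_scaling[of "- 1"] w_meas] by simp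
    show "bounded ((\<lambda>x. w (- x)) ` S)" if "bounded S" for S
    proof -
      have "bounded (w ` uminus ` S)" by (intro w_bdd) (use that in \<open>auto simp: bounded_iff\<close>)
      then show ?thesis by (simp add: image_image)
    qed
    show "(\<lambda>x. w (- x)) field_differentiable at x \<and> \<bar>deriv (\<lambda>x. w (- x)) x\<bar> \<le> D"
      if "- m < x" "x < - xm + e" "x \<notin> uminus ` F" for x
    proof -
      have "- x \<notin> F" using that(3) by (auto simp: image_iff)
      then have w: "w field_differentiable (at (- x))" "\<bar>deriv w (- x)\<bar> \<le> D"
        using F(2)[of "- x"] that m e by auto
      have "((\<lambda>x. w (- x)) has_real_derivative deriv w (- x) * - 1) (at x)"
        by (rule DERIV_chain2[OF field_differentiable_derivI[OF w(1)] DERIV_minus[OF DERIV_ident]])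
      then show ?thesis using w(2) by (auto simp: field_differentiable_def DERIV_imp_deriv)
    qed
    show "\<bar>w (- x)\<bar> \<le> C0 * (v (- x) - l0) * \<bar>LBINT y=0..ereal x. sqrt \<bar>v (- y) - l0\<bar>\<bar> powr N" if "R \<le> x" for x
      using growth[of "- x"] interval_integral_reflect_0[of x "\<lambda>y. sqrt \<bar>v y - l0\<bar>"] that by simp
  qed (use F far e D in auto)
  obtain \<epsilon>R \<eta>R CR where R: "\<epsilon>R > 0" "\<eta>R > 0" "half_line_estimate v v1 w l0 m xp e \<epsilon>R \<eta>R CR"
    using right by blast
  obtain \<epsilon>L \<eta>L CL where L: "\<epsilon>L > 0" "\<eta>L > 0"
    "half_line_estimate (\<lambda>x. v (- x)) (\<lambda>x. - v1 (- x)) (\<lambda>x. w (- x)) l0 (- m) (- xm) e \<epsilon>L \<eta>L CL"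
    using left by blast
  show ?thesis
    unfolding well_estimate_def
  proof (rule exI[of _ "min \<epsilon>R \<epsilon>L"], rule conjI, use R L in simp, rule exI[of _ "min \<eta>R \<eta>L"], rule conjI, use R L in simp,
      rule exI[of _ "CR + CL"], intro allI impI)
    fix l assume l: "\<bar>l - l0\<bar> < min \<epsilon>R \<epsilon>L"
    let ?p = "\<lambda>x. w x * (l - v x) powr (-1/2)"
    obtain b where b: "m < b" "\<bar>b - xp\<bar> < e" "v b = l" "v1 b > 0" "\<And>x. m \<le> x \<Longrightarrow> x < b \<Longrightarrow> v x < l" "\<And>x. b < x \<Longrightarrow> l < v x"
      "?p absolutely_integrable_on {m..b}"
      and bR: "\<And>\<eta> f f1. 0 < \<eta> \<Longrightarrow> \<eta> \<le> \<eta>R \<Longrightarrow> normalized_state v l (\<eta> ^ 3) f f1 \<Longrightarrow>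
         (\<lambda>x. w x * (f x)\<^sup>2) absolutely_integrable_on {m..} \<and>
         \<bar>integral {m..} (\<lambda>x. w x * (f x)\<^sup>2) - amplitude v l (\<eta> ^ 3) f f1 m * integral {m..b} ?p\<bar> \<le> CR * \<eta>"
      using R(3)[unfolded half_line_estimate_def, rule_format, of l] l by auto
    obtain a' where a': "- m < a'" "\<bar>a' - (- xm)\<bar> < e" "v (- a') = l" "- v1 (- a') > 0"
        "\<And>x. - m \<le> x \<Longrightarrow> x < a' \<Longrightarrow> v (- x) < l" "\<And>x. a' < x \<Longrightarrow> l < v (- x)"
      "(\<lambda>x. w (- x) * (l - v (- x)) powr (-1/2)) absolutely_integrable_on {- m..a'}"
      and aL: "\<And>\<eta> f f1. 0 < \<eta> \<Longrightarrow> \<eta> \<le> \<eta>L \<Longrightarrow> normalized_state (\<lambda>x. v (- x)) l (\<eta> ^ 3) f f1 \<Longrightarrow>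
         (\<lambda>x. w (- x) * (f x)\<^sup>2) absolutely_integrable_on {- m..} \<and>
         \<bar>integral {- m..} (\<lambda>x. w (- x) * (f x)\<^sup>2) - amplitude (\<lambda>x. v (- x)) l (\<eta> ^ 3) f f1 (- m)
            * integral {- m..a'} (\<lambda>x. w (- x) * (l - v (- x)) powr (-1/2))\<bar> \<le> CL * \<eta>"
      using L(3)[unfolded half_line_estimate_def, rule_format, of l] l by auto
    define a where "a = - a'"
    have a: "a < m" "\<bar>a - xm\<bar> < e" "v a = l" "v1 a < 0" using a' by (auto simp: a_def)
    have am: "v x < l" if "a < x" "x \<le> m" for x
      using a'(5)[of "- x"] that by (simp add: a_def)
    have xa: "l < v x" if "x < a" for x
      using a'(6)[of "- x"] that by (simp add: a_def)
    have pa: "?p absolutely_integrable_on {a..m}"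
      and pa': "integral {- m..a'} (\<lambda>x. w (- x) * (l - v (- x)) powr (-1/2)) = integral {a..m} ?p"
      using has_absolute_integral_reflect_real[of "{- m..a'}" "{a..m}" ?p "integral {- m..a'} (\<lambda>x. w (- x) * (l - v (- x)) powr (-1/2))"] a'(7)
      by (auto simp: a_def)
    have "{a..b} = {a..m} \<union> {m..b}" using a(1) b(1) by auto
    then have pab: "?p absolutely_integrable_on {a..b}"
      using set_integrable_Un[OF pa b(7)] by simp
    have pint: "integral {a..b} ?p = integral {a..m} ?p + integral {m..b} ?p"
      using a(1) b(1) set_lebesgue_integral_eq_integral(1)[OF pab]
      by (intro Henstock_Kurzweil_Integration.integral_combine[symmetric]) auto
    have in_ab: "v x < l" if "a < x" "x < b" for x
      using am[of x] b(5)[of x] that by (cases "x \<le> m") auto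
    have est: "(\<lambda>x. w x * (f x)\<^sup>2) absolutely_integrable_on UNIV \<and>
         \<bar>integral UNIV (\<lambda>x. w x * (f x)\<^sup>2) - amplitude v l (\<eta> ^ 3) f f1 m * integral {a..b} ?p\<bar> \<le> (CR + CL) * \<eta>"
      if \<eta>: "0 < \<eta>" "\<eta> \<le> min \<eta>R \<eta>L" and f: "normalized_state v l (\<eta> ^ 3) f f1" for \<eta> f f1
    proof -
      let ?g = "\<lambda>x. w x * (f x)\<^sup>2"
      have 1: "?g absolutely_integrable_on {m..}"
         "\<bar>integral {m..} ?g - amplitude v l (\<eta> ^ 3) f f1 m * integral {m..b} ?p\<bar> \<le> CR * \<eta>"
        using bR[OF \<eta>(1) _ f] \<eta>(2) by auto
      have fd: "\<And>x. (f has_real_derivative f1 x) (at x)"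
          "\<And>x. (f1 has_real_derivative (v x - l) * f x / (\<eta> ^ 3)\<^sup>2) (at x)"
        and f2: "(\<lambda>x. (f x)\<^sup>2) absolutely_integrable_on UNIV \<and> integral UNIV (\<lambda>x. (f x)\<^sup>2) = 1"
        using f unfolding normalized_state_def by blast+
      have f': "normalized_state (\<lambda>x. v (- x)) l (\<eta> ^ 3) (\<lambda>x. f (- x)) (\<lambda>x. - f1 (- x))"
        unfolding normalized_state_def
      proof (intro conjI allI)
        show "((\<lambda>x. f (- x)) has_real_derivative - f1 (- x)) (at x)" for x
          by (rule DERIV_cong[OF DERIV_chain2[OF fd(1) DERIV_minus[OF DERIV_ident]]]) simp
        show "((\<lambda>x. - f1 (- x)) has_real_derivative (v (- x) - l) * f (- x) / (\<eta> ^ 3)\<^sup>2) (at x)" for x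
          by (rule DERIV_cong[OF DERIV_minus[OF DERIV_chain2[OF fd(2) DERIV_minus[OF DERIV_ident]]]]) simp
        show "(\<lambda>x. (f (- x))\<^sup>2) absolutely_integrable_on UNIV" "integral UNIV (\<lambda>x. (f (- x))\<^sup>2) = 1"
          using has_absolute_integral_reflect_real[of UNIV UNIV "\<lambda>x. (f x)\<^sup>2" 1] f2 by auto
      qed
      have amp: "amplitude (\<lambda>x. v (- x)) l (\<eta> ^ 3) (\<lambda>x. f (- x)) (\<lambda>x. - f1 (- x)) (- m) = amplitude v l (\<eta> ^ 3) f f1 m"
        by (simp add: amplitude_def)
      have 2: "(\<lambda>x. w (- x) * (f (- x))\<^sup>2) absolutely_integrable_on {- m..}"
        "\<bar>integral {- m..} (\<lambda>x. w (- x) * (f (- x))\<^sup>2) - amplitude v l (\<eta> ^ 3) f f1 m * integral {a..m} ?p\<bar> \<le> CL * \<eta>"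
        using aL[OF \<eta>(1) _ f'] \<eta>(2) unfolding amp pa' by auto
      have 3: "?g absolutely_integrable_on {..m}" "integral {..m} ?g = integral {- m..} (\<lambda>x. w (- x) * (f (- x))\<^sup>2)"
        using has_absolute_integral_reflect_real[of "{- m..}" "{..m}" ?g "integral {- m..} (\<lambda>x. w (- x) * (f (- x))\<^sup>2)"] 2(1)
        by auto
      have U: "UNIV = {..m} \<union> {m..}" by auto
      have 4: "?g absolutely_integrable_on UNIV" unfolding U using 3(1) 1(1) by (intro set_integrable_Un) auto
      have "integral UNIV ?g = integral {..m} ?g + integral {m..} ?g"
        unfolding U
      proof (rule Henstock_Kurzweil_Integration.integral_Un)
        have "{..m} \<inter> {m..} \<subseteq> {m}" by auto
        then show "negligible ({..m} \<inter> {m..})" by (rule negligible_subset[OF negligible_sing])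
      qed (use 3(1) 1(1) set_lebesgue_integral_eq_integral(1) in blast)+
      moreover have "amplitude v l (\<eta> ^ 3) f f1 m * integral {a..b} ?p
         = amplitude v l (\<eta> ^ 3) f f1 m * integral {a..m} ?p + amplitude v l (\<eta> ^ 3) f f1 m * integral {m..b} ?p"
        unfolding pint by (rule distrib_left)
      moreover have "(CR + CL) * \<eta> = CR * \<eta> + CL * \<eta>" by (rule distrib_right)
      ultimately have "\<bar>integral UNIV ?g - amplitude v l (\<eta> ^ 3) f f1 m * integral {a..b} ?p\<bar> \<le> (CR + CL) * \<eta>"
        using 1(2) 2(2) 3(2) by linarith
      with 4 show ?thesis by blast
    qed
    show "\<exists>a b. a < m \<and> m < b \<and> \<bar>a - xm\<bar> < e \<and> \<bar>b - xp\<bar> < e \<and> v a = l \<and> v b = l \<and> v1 a < 0 \<and> v1 b > 0 \<and>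
      (\<forall>x. a < x \<longrightarrow> x < b \<longrightarrow> v x < l) \<and> (\<forall>x. x < a \<or> b < x \<longrightarrow> l < v x) \<and>
      ?p absolutely_integrable_on {a..b} \<and>
      (\<forall>\<eta> f f1. 0 < \<eta> \<longrightarrow> \<eta> \<le> min \<eta>R \<eta>L \<longrightarrow> normalized_state v l (\<eta> ^ 3) f f1 \<longrightarrow>
         (\<lambda>x. w x * (f x)\<^sup>2) absolutely_integrable_on UNIV \<and>
         \<bar>integral UNIV (\<lambda>x. w x * (f x)\<^sup>2) - amplitude v l (\<eta> ^ 3) f f1 m * integral {a..b} ?p\<bar> \<le> (CR + CL) * \<eta>)"
      by (rule exI[of _ a], rule exI[of _ b]) (use a b xa in_ab pab est in blast)
  qed
qed

text \<open>The sign pattern alone determines the level set, so endpoints obtained existentially can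
  be identified with \<open>x_minus\<close> and \<open>x_plus\<close>.\<close>

lemma turning_points:
  assumes "a < b" "v a = l" "v b = l" "\<And>x. a < x \<Longrightarrow> x < b \<Longrightarrow> v x < l" "\<And>x. x < a \<or> b < x \<Longrightarrow> l < v x"
  shows "{x. v x = l} = {a, b}" "x_minus v l = a" "x_plus v l = b"
proof -
  have "x = a \<or> x = b" if "v x = l" for x
    using assms(4)[of x] assms(5)[of x] that by (cases x a rule: linorder_cases; cases x b rule: linorder_cases) auto
  then show "{x. v x = l} = {a, b}" using assms by auto
  then show "x_minus v l = a" "x_plus v l = b" using assms(1) by (simp_all add: x_minus_def x_plus_def)
qed

section \<open>Elimination of the amplitude and passage to the ratio\<close>

theorem proposition4p5:
  fixes v w :: "real \<Rightarrow> real" and l0 :: real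
  assumes A: "assumption_A v l0"
    and B: "assumption_B v l0"
    and w_meas: "w \<in> borel_measurable lebesgue"
    and w_bdd: "\<And>S. bounded S \<Longrightarrow> bounded (w ` S)"
    and w_diff: "\<exists>I F. open I \<and> is_interval I \<and> {x_minus v l0..x_plus v l0} \<subseteq> I \<and> finite F \<and>
                   (\<forall>x\<in>I - F. w field_differentiable (at x)) \<and> bounded (deriv w ` (I - F))"
    and w_growth: "\<exists>N C0 :: real. \<forall>\<^sub>F x in at_infinity.
                     \<bar>w x\<bar> \<le> C0 * qfun v l0 x * qphase v l0 x powr N"
  shows "\<exists>U h0 C. open U \<and> l0 \<in> U \<and> h0 > 0 \<and> C > 0 \<and>
     (\<forall>l\<in>U. assumption_B v l) \<and>
     (\<forall>h\<in>{0<..h0}. \<forall>l\<in>U. \<forall>\<psi> :: real \<Rightarrow> real.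
        is_eigenvalue v h l \<and> eigenfunction v h l \<psi> \<and> (LINT x|lebesgue. (\<psi> x)\<^sup>2) = 1 \<longrightarrow>
          integrable lebesgue (\<lambda>x. w x * (\<psi> x)\<^sup>2) \<and>
          set_integrable lebesgue {x_minus v l..x_plus v l} (\<lambda>x. w x * (l - v x) powr (-1/2)) \<and>
          set_integrable lebesgue {x_minus v l..x_plus v l} (\<lambda>x. (l - v x) powr (-1/2)) \<and>
          \<bar>(LINT x|lebesgue. w x * (\<psi> x)\<^sup>2)
             - (LINT x:{x_minus v l..x_plus v l}|lebesgue. w x * (l - v x) powr (-1/2))
               / (LINT x:{x_minus v l..x_plus v l}|lebesgue. (l - v x) powr (-1/2))\<bar>
          \<le> C * h powr (1/3))"
proof -
  define v1 where "v1 = deriv v"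
  define v2 where "v2 = deriv v1"
  have C2: "\<And>j x. j < 2 \<Longrightarrow> (deriv ^^ j) v field_differentiable (at x)" "continuous_on UNIV ((deriv ^^ 2) v)"
    using A unfolding assumption_A_def Ck_on_def by auto
  have v: "(v has_real_derivative v1 x) (at x)" for x
    using field_differentiable_derivI[OF C2(1)[of 0 x]] by (simp add: v1_def)
  have v1: "(v1 has_real_derivative v2 x) (at x)" for x
    using field_differentiable_derivI[OF C2(1)[of 1 x]] by (simp add: v1_def v2_def)
  have v2: "continuous_on UNIV v2" using C2(2) by (simp add: v1_def v2_def numeral_2_eq_2)
  have vc: "continuous_on UNIV v"
    using v by (intro continuous_at_imp_continuous_on ballI DERIV_isCont) auto
  define xm where "xm = x_minus v l0"
  define xp where "xp = x_plus v l0"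
  have card: "card {x. v x = l0} = 2"
    and inside: "\<And>x. xm < x \<Longrightarrow> x < xp \<Longrightarrow> v x < l0"
    and outside: "\<And>x. x < xm \<Longrightarrow> l0 < v x" "\<And>x. xp < x \<Longrightarrow> l0 < v x"
    and liminf: "ereal l0 < Liminf at_infinity (\<lambda>x. ereal (v x))"
    and slope: "v1 xm < 0" "v1 xp > 0"
    using B unfolding assumption_B_def xm_def xp_def v1_def by auto
  obtain Sm Sp where S: "open Sm" "xm \<in> Sm" "Ck_on 3 v Sm" "open Sp" "xp \<in> Sp" "Ck_on 3 v Sp"
    using B unfolding assumption_B_def xm_def xp_def by blast
  have fin: "finite {x. v x = l0}" "{x. v x = l0} \<noteq> {}"
    using card card.empty by (force intro: card_ge_0_finite)+
  have vx: "v xm = l0" "v xp = l0"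
    using Min_in[OF fin] Max_in[OF fin] by (auto simp: xm_def xp_def x_minus_def x_plus_def)
  have mm: "xm \<le> x \<and> x \<le> xp" if "v x = l0" for x
    using Min_le[OF fin(1), of x] Max_ge[OF fin(1), of x] that by (simp add: xm_def xp_def x_minus_def x_plus_def)
  have "xm \<le> xp" using mm[OF vx(1)] by simp
  moreover have "xm \<noteq> xp"
  proof
    assume "xm = xp"
    then have "{x. v x = l0} \<subseteq> {xm}"
      using mm by force
    then show False using card card_mono[of "{xm}" "{x. v x = l0}"] by simp
  qed
  ultimately have xmp: "xm < xp" by simp
  define m where "m = (xm + xp) / 2"
  have m: "xm < m" "m < xp" using xmp by (simp_all add: m_def)
  obtain z where z: "ereal l0 < ereal z" "ereal z < Liminf at_infinity (\<lambda>x. ereal (v x))"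
    using ereal_dense2[OF liminf] by blast
  obtain R1 where R1: "\<And>x. R1 \<le> \<bar>x\<bar> \<Longrightarrow> z < v x"
    using less_LiminfD[OF z(2)] unfolding eventually_at_infinity by auto
  define k0 where "k0 = z - l0"
  have k0: "k0 > 0" and far: "\<And>x. R1 \<le> \<bar>x\<bar> \<Longrightarrow> l0 + k0 \<le> v x"
    using z R1 by (auto simp: k0_def intro: less_imp_le)
  obtain N C0 R2 where R2: "\<And>x. R2 \<le> \<bar>x\<bar> \<Longrightarrow> \<bar>w x\<bar> \<le> C0 * (v x - l0) * \<bar>LBINT y=0..ereal x. sqrt \<bar>v y - l0\<bar>\<bar> powr N"
    using w_growth unfolding eventually_at_infinity qfun_def qphase_def by auto
  obtain I F where I: "open I" "{xm..xp} \<subseteq> I" "finite F" "\<And>x. x \<in> I - F \<Longrightarrow> w field_differentiable (at x)"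
    "bounded (deriv w ` (I - F))"
    using w_diff unfolding xm_def xp_def by blast
  obtain D where D: "D > 0" "\<And>x. x \<in> I - F \<Longrightarrow> \<bar>deriv w x\<bar> \<le> D"
    using I(5) unfolding bounded_pos by auto
  have near: "\<exists>e>0. \<forall>x. \<bar>x - y\<bar> < e \<longrightarrow> x \<in> T" if "open T" "y \<in> T" for T and y :: real
    using that unfolding open_dist dist_real_def by blast
  have "xm \<in> I \<inter> Sm" "xp \<in> I \<inter> Sp" using I(2) xmp S by auto
  then obtain em ep where em: "em > 0" "\<And>x. \<bar>x - xm\<bar> < em \<Longrightarrow> x \<in> I \<inter> Sm"
    and ep: "ep > 0" "\<And>x. \<bar>x - xp\<bar> < ep \<Longrightarrow> x \<in> I \<inter> Sp"
    using near[of "I \<inter> Sm" xm] near[of "I \<inter> Sp" xp] I(1) S by (meson open_Int)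
  \<comment> \<open>Within \<open>e\<close> of a turning point at \<open>l0\<close>,
    \<open>w\<close> keeps its regularity and \<open>v\<close> is of class C^3. The turning points
    at nearby energies stay in these neighborhoods and so inherit the smoothness demanded by
    \<open>assumption_B\<close>.\<close>
  define e where "e = min em ep"
  have e: "e > 0" using em ep by (simp add: e_def)
  have wI: "w field_differentiable (at x) \<and> \<bar>deriv w x\<bar> \<le> D" if "xm - e < x" "x < xp + e" "x \<notin> F" for x
  proof -
    have "x \<in> I"
    proof (cases "x < xm \<or> xp < x")
      case True
      then have "\<bar>x - xm\<bar> < em \<or> \<bar>x - xp\<bar> < ep" using that by (auto simp: e_def)
      then show ?thesis using em ep by blast
    qed (use I in auto)
    then show ?thesis using I D that by blast
  qed
  define R where "R = max R1 R2"
  have W: "\<exists>\<epsilon>>0. \<exists>\<eta>0>0. \<exists>C. well_estimate v v1 w l0 xm m xp e \<epsilon> \<eta>0 C"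
  proof (rule two_sided_uniform)
    show "\<And>x. R \<le> \<bar>x\<bar> \<Longrightarrow> l0 + k0 \<le> v x" using far by (auto simp: R_def)
    show "\<And>x. R \<le> \<bar>x\<bar> \<Longrightarrow> \<bar>w x\<bar> \<le> C0 * (v x - l0) * \<bar>LBINT y=0..ereal x. sqrt \<bar>v y - l0\<bar>\<bar> powr N"
      by (rule R2) (simp add: R_def)
    show "0 \<le> D" using D by simp
  qed (fact v v1 v2 m vx inside outside slope k0 e w_meas w_bdd I(3) wI)+
  \<comment> \<open>The observable 1 satisfies the growth bound with exponent 0 and constant
    \<open>1 / k0\<close>. The threshold is moved out by \<open>1 / sqrt k0\<close> to make the
    phase nonzero.\<close>
  have one: "\<exists>\<epsilon>>0. \<exists>\<eta>0>0. \<exists>C. well_estimate v v1 (\<lambda>_. 1) l0 xm m xp e \<epsilon> \<eta>0 C"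
  proof (rule two_sided_uniform[where w = "\<lambda>_. 1" and ?v2.0 = v2 and F = "{}" and D = 0 and N = 0 and ?C0.0 = "1 / k0" and R = "max R1 0 + 1 / sqrt k0"])
    have s: "0 < 1 / sqrt k0" using k0 by simp
    show far': "\<And>x. max R1 0 + 1 / sqrt k0 \<le> \<bar>x\<bar> \<Longrightarrow> l0 + k0 \<le> v x"
      by (rule far) (use s in linarith)
    show "\<bar>1\<bar> \<le> 1 / k0 * (v x - l0) * \<bar>LBINT y=0..ereal x. sqrt \<bar>v y - l0\<bar>\<bar> powr 0"
      if "max R1 0 + 1 / sqrt k0 \<le> \<bar>x\<bar>" for x
    proof -
      have "1 \<le> \<bar>LBINT y=0..ereal x. sqrt \<bar>v y - l0\<bar>\<bar>"
        by (rule phase_ge_1[OF vc _ k0 _ that]) (use far in auto)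
      then have "\<bar>LBINT y=0..ereal x. sqrt \<bar>v y - l0\<bar>\<bar> powr 0 = 1" by auto
      moreover have "1 \<le> 1 / k0 * (v x - l0)" using far'[OF that] k0 by (simp add: field_simps)
      ultimately show ?thesis by simp
    qed
    show "bounded ((\<lambda>_. 1::real) ` S)" for S :: "real set" by (simp add: image_constant_conv)
    show "(\<lambda>_. 1) field_differentiable at x \<and> \<bar>deriv (\<lambda>_. 1) x\<bar> \<le> 0" for x :: real by simp
  qed (simp_all add: v v1 v2 m vx inside outside slope k0 e)
  obtain \<epsilon>1 \<eta>1 C1 where P1: "\<epsilon>1 > 0" "\<eta>1 > 0" "well_estimate v v1 w l0 xm m xp e \<epsilon>1 \<eta>1 C1"
    using W by blast
  obtain \<epsilon>2 \<eta>2 C2' where P2: "\<epsilon>2 > 0" "\<eta>2 > 0" "well_estimate v v1 (\<lambda>_. 1) l0 xm m xp e \<epsilon>2 \<eta>2 C2'"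
    using one by blast
  \<comment> \<open>This interval contains the wells of all energies considered, so
    \<open>W0\<close> bounds every classical average of \<open>w\<close>.\<close>
  have "bounded (w ` {xm - e..xp + e})" by (intro w_bdd bounded_closed_interval)
  then obtain W0 where W0: "W0 > 0" "\<forall>y\<in>w ` {xm - e..xp + e}. norm y \<le> W0"
    unfolding bounded_pos by blast
  \<comment> \<open>The bound by \<open>k0\<close> keeps \<open>l\<close> below the lower limit of
    \<open>v\<close> at infinity.\<close>
  define \<epsilon> where "\<epsilon> = min (min \<epsilon>1 \<epsilon>2) k0"
  define \<eta>0 where "\<eta>0 = min \<eta>1 \<eta>2"
  define C where "C = \<bar>C1\<bar> + W0 * \<bar>C2'\<bar> + 1"
  have \<eta>0: "\<eta>0 > 0" using P1 P2 by (simp add: \<eta>0_def)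
  have C: "C > 0" using W0 by (simp add: C_def add_nonneg_pos)
  have well: "assumption_B v l \<and> \<bar>x_minus v l - xm\<bar> < e \<and> \<bar>x_plus v l - xp\<bar> < e \<and>
      (\<lambda>x. w x * (l - v x) powr (-1/2)) absolutely_integrable_on {x_minus v l..x_plus v l} \<and>
      (\<lambda>x. (l - v x) powr (-1/2)) absolutely_integrable_on {x_minus v l..x_plus v l} \<and>
      (\<forall>\<eta> f f1. 0 < \<eta> \<longrightarrow> \<eta> \<le> \<eta>0 \<longrightarrow> normalized_state v l (\<eta> ^ 3) f f1 \<longrightarrow>
         (\<lambda>x. w x * (f x)\<^sup>2) absolutely_integrable_on UNIV \<and>
         \<bar>integral UNIV (\<lambda>x. w x * (f x)\<^sup>2)
           - amplitude v l (\<eta> ^ 3) f f1 m * integral {x_minus v l..x_plus v l} (\<lambda>x. w x * (l - v x) powr (-1/2))\<bar> \<le> C1 * \<eta> \<and>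
         \<bar>1 - amplitude v l (\<eta> ^ 3) f f1 m * integral {x_minus v l..x_plus v l} (\<lambda>x. (l - v x) powr (-1/2))\<bar> \<le> C2' * \<eta>)"
    if l: "\<bar>l - l0\<bar> < \<epsilon>" for l
  proof -
    have l1: "\<bar>l - l0\<bar> < \<epsilon>1" "\<bar>l - l0\<bar> < \<epsilon>2" "l < l0 + k0" using l by (auto simp: \<epsilon>_def)
    obtain a b where ab: "a < m" "m < b" "\<bar>a - xm\<bar> < e" "\<bar>b - xp\<bar> < e" "v a = l" "v b = l" "v1 a < 0" "v1 b > 0"
      "\<And>x. a < x \<Longrightarrow> x < b \<Longrightarrow> v x < l" "\<And>x. x < a \<or> b < x \<Longrightarrow> l < v x"
      and pw: "(\<lambda>x. w x * (l - v x) powr (-1/2)) absolutely_integrable_on {a..b}"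
      and ew: "\<And>\<eta> f f1. 0 < \<eta> \<Longrightarrow> \<eta> \<le> \<eta>1 \<Longrightarrow> normalized_state v l (\<eta> ^ 3) f f1 \<Longrightarrow>
         (\<lambda>x. w x * (f x)\<^sup>2) absolutely_integrable_on UNIV \<and>
         \<bar>integral UNIV (\<lambda>x. w x * (f x)\<^sup>2)
           - amplitude v l (\<eta> ^ 3) f f1 m * integral {a..b} (\<lambda>x. w x * (l - v x) powr (-1/2))\<bar> \<le> C1 * \<eta>"
      using P1(3)[unfolded well_estimate_def, rule_format, OF l1(1)] by blast
    obtain a' b' where ab': "a' < m" "m < b'" "v a' = l" "v b' = l"
      "\<And>x. a' < x \<Longrightarrow> x < b' \<Longrightarrow> v x < l" "\<And>x. x < a' \<or> b' < x \<Longrightarrow> l < v x"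
      and p1: "(\<lambda>x. 1 * (l - v x) powr (-1/2)) absolutely_integrable_on {a'..b'}"
      and e1: "\<And>\<eta> f f1. 0 < \<eta> \<Longrightarrow> \<eta> \<le> \<eta>2 \<Longrightarrow> normalized_state v l (\<eta> ^ 3) f f1 \<Longrightarrow>
         (\<lambda>x. 1 * (f x)\<^sup>2) absolutely_integrable_on UNIV \<and>
         \<bar>integral UNIV (\<lambda>x. 1 * (f x)\<^sup>2)
           - amplitude v l (\<eta> ^ 3) f f1 m * integral {a'..b'} (\<lambda>x. 1 * (l - v x) powr (-1/2))\<bar> \<le> C2' * \<eta>"
      using P2(3)[unfolded well_estimate_def, rule_format, OF l1(2)] by blast
    have lt: "a < b" "a' < b'" using ab ab' by auto
    have tp: "{x. v x = l} = {a, b}" "x_minus v l = a" "x_plus v l = b"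
      by (rule turning_points; fact lt ab)+
    have tp': "x_minus v l = a'" "x_plus v l = b'"
      by (rule turning_points; fact lt ab')+
    \<comment> \<open>The estimates for \<open>w\<close> and for 1 deliver their endpoints
      independently; both pairs are the turning points of \<open>v\<close> at
      \<open>l\<close>.\<close>
    have eq: "a' = a" "b' = b" using tp tp' by auto
    have "assumption_B v l"
      unfolding assumption_B_def tp
    proof (intro conjI)
      show "card {a, b} = 2" using lt by simp
      show "\<forall>x\<in>{a<..<b}. v x < l" "\<forall>x. x \<notin> {a..b} \<longrightarrow> l < v x" using ab(9,10) by auto
      have "eventually (\<lambda>x. ereal (l0 + k0) \<le> ereal (v x)) at_infinity"
        unfolding eventually_at_infinity using far by auto
      then have "ereal (l0 + k0) \<le> Liminf at_infinity (\<lambda>x. ereal (v x))" by (rule Liminf_bounded)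
      then show "ereal l < Liminf at_infinity (\<lambda>x. ereal (v x))"
        using l1(3) by (meson ereal_less_le less_ereal.simps(1) less_le_trans)
      show "\<exists>S. open S \<and> a \<in> S \<and> Ck_on 3 v S" using S em(2)[of a] ab(3) by (auto simp: e_def)
      show "\<exists>S. open S \<and> b \<in> S \<and> Ck_on 3 v S" using S ep(2)[of b] ab(4) by (auto simp: e_def)
      show "deriv v a < 0" "0 < deriv v b" using ab by (auto simp: v1_def)
    qed
    moreover have "\<bar>1 - amplitude v l (\<eta> ^ 3) f f1 m * integral {a..b} (\<lambda>x. (l - v x) powr (-1/2))\<bar> \<le> C2' * \<eta>"
      if "0 < \<eta>" "\<eta> \<le> \<eta>0" "normalized_state v l (\<eta> ^ 3) f f1" for \<eta> f f1
    proof -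
      have "integral UNIV (\<lambda>x. (f x)\<^sup>2) = 1" using that(3) by (simp add: normalized_state_def)
      then show ?thesis using e1[OF that(1) _ that(3)] that(2) unfolding eq by (simp add: \<eta>0_def)
    qed
    moreover have "(\<lambda>x. w x * (f x)\<^sup>2) absolutely_integrable_on UNIV \<and>
         \<bar>integral UNIV (\<lambda>x. w x * (f x)\<^sup>2)
           - amplitude v l (\<eta> ^ 3) f f1 m * integral {a..b} (\<lambda>x. w x * (l - v x) powr (-1/2))\<bar> \<le> C1 * \<eta>"
      if "0 < \<eta>" "\<eta> \<le> \<eta>0" "normalized_state v l (\<eta> ^ 3) f f1" for \<eta> f f1
      using that by (intro ew) (auto simp: \<eta>0_def)
    ultimately show ?thesis
      unfolding tp using ab(3,4) pw p1[unfolded eq mult_1] by blast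
  qed
  have main: "integrable lebesgue (\<lambda>x. w x * (\<psi> x)\<^sup>2) \<and>
          set_integrable lebesgue {x_minus v l..x_plus v l} (\<lambda>x. w x * (l - v x) powr (-1/2)) \<and>
          set_integrable lebesgue {x_minus v l..x_plus v l} (\<lambda>x. (l - v x) powr (-1/2)) \<and>
          \<bar>(LINT x|lebesgue. w x * (\<psi> x)\<^sup>2)
             - (LINT x:{x_minus v l..x_plus v l}|lebesgue. w x * (l - v x) powr (-1/2))
               / (LINT x:{x_minus v l..x_plus v l}|lebesgue. (l - v x) powr (-1/2))\<bar>
          \<le> C * h powr (1/3)"
    if h: "h \<in> {0<..\<eta>0 ^ 3}" and l: "l \<in> ball l0 \<epsilon>"
      and \<psi>: "eigenfunction v h l \<psi>" "(LINT x|lebesgue. (\<psi> x)\<^sup>2) = 1" for h l and \<psi> :: "real \<Rightarrow> real"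
  proof -
    have "\<bar>l - l0\<bar> < \<epsilon>" using l by (simp add: dist_real_def abs_minus_commute)
    note wl = well[OF this]
    define \<eta> where "\<eta> = h powr (1/3)"
    have \<eta>: "0 < \<eta>" "\<eta> ^ 3 = h" using h by (simp_all add: \<eta>_def powr_powr flip: powr_realpow)
    have \<eta>le: "\<eta> \<le> \<eta>0"
      using power_le_imp_le_base[of \<eta> 2 \<eta>0] h \<eta> \<eta>0 by (simp add: numeral_3_eq_3)
    obtain \<psi>' \<psi>'' where ode: "\<And>x. (\<psi> has_vector_derivative \<psi>' x) (at x)" "\<And>x. (\<psi>' has_vector_derivative \<psi>'' x) (at x)"
      "\<And>x. - (h\<^sup>2 *\<^sub>R \<psi>'' x) + v x *\<^sub>R \<psi> x = l *\<^sub>R \<psi> x" and int: "integrable lebesgue (\<lambda>x. (norm (\<psi> x))\<^sup>2)"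
      using \<psi>(1) unfolding eigenfunction_def by blast
    have "\<psi>'' x = (v x - l) * \<psi> x / h\<^sup>2" for x
      using ode(3)[of x] h by (simp add: field_simps)
    then have ode': "(\<psi>' has_real_derivative (v x - l) * \<psi> x / (\<eta> ^ 3)\<^sup>2) (at x)" for x
      using ode(2)[of x] by (simp add: has_real_derivative_iff_has_vector_derivative \<eta>)
    have sq: "(\<lambda>x. (\<psi> x)\<^sup>2) absolutely_integrable_on UNIV"
      using int by (simp add: set_integrable_def)
    have "integral UNIV (\<lambda>x. (\<psi> x)\<^sup>2) = 1"
      using set_lebesgue_integral_eq_integral(2)[OF sq] \<psi>(2) by (simp add: set_lebesgue_integral_def)
    then have st: "normalized_state v l (\<eta> ^ 3) \<psi> \<psi>'"
      unfolding normalized_state_def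
      using ode(1) ode' sq by (simp add: has_real_derivative_iff_has_vector_derivative)
    define c where "c = amplitude v l (\<eta> ^ 3) \<psi> \<psi>' m"
    define T where "T = integral {x_minus v l..x_plus v l} (\<lambda>x. (l - v x) powr (-1/2))"
    define V where "V = integral {x_minus v l..x_plus v l} (\<lambda>x. w x * (l - v x) powr (-1/2))"
    define X where "X = integral UNIV (\<lambda>x. w x * (\<psi> x)\<^sup>2)"
    have pw: "(\<lambda>x. w x * (l - v x) powr (-1/2)) absolutely_integrable_on {x_minus v l..x_plus v l}"
      and p1: "(\<lambda>x. (l - v x) powr (-1/2)) absolutely_integrable_on {x_minus v l..x_plus v l}"
      using wl by blast+
    have gw: "(\<lambda>x. w x * (\<psi> x)\<^sup>2) absolutely_integrable_on UNIV"
      and est: "\<bar>X - c * V\<bar> \<le> C1 * \<eta>" "\<bar>1 - c * T\<bar> \<le> C2' * \<eta>"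
      using wl \<eta>(1) \<eta>le st unfolding X_def c_def T_def V_def by blast+
    have T0: "T \<ge> 0"
      unfolding T_def by (intro Henstock_Kurzweil_Integration.integral_nonneg set_lebesgue_integral_eq_integral(1)[OF p1]) auto
    have VT: "\<bar>V\<bar> \<le> W0 * T"
    proof -
      have g: "((\<lambda>x. W0 * (l - v x) powr (-1/2)) has_integral W0 * T) {x_minus v l..x_plus v l}"
        unfolding T_def by (intro has_integral_mult_right integrable_integral set_lebesgue_integral_eq_integral(1)[OF p1])
      have "norm V \<le> integral {x_minus v l..x_plus v l} (\<lambda>x. W0 * (l - v x) powr (-1/2))"
        unfolding V_def
      proof (rule Henstock_Kurzweil_Integration.integral_norm_bound_integral[OF set_lebesgue_integral_eq_integral(1)[OF pw] has_integral_integrable[OF g]])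
        fix x assume "x \<in> {x_minus v l..x_plus v l}"
        then have "x \<in> {xm - e..xp + e}" using wl by auto
        then have "\<bar>w x\<bar> \<le> W0" using W0(2) by auto
        then show "norm (w x * (l - v x) powr (-1/2)) \<le> W0 * (l - v x) powr (-1/2)"
          by (simp add: abs_mult mult_right_mono)
      qed
      then show ?thesis unfolding integral_unique[OF g] real_norm_def .
    qed
    have final: "\<bar>X - V / T\<bar> \<le> C * \<eta>"
    proof -
      have C1: "C1 * \<eta> \<le> \<bar>C1\<bar> * \<eta>" "C2' * \<eta> \<le> \<bar>C2'\<bar> * \<eta>" using \<eta> by (auto intro: mult_right_mono)
      \<comment> \<open>The difference is \<open>V / T\<close>, an average of \<open>w\<close> and
        hence at most \<open>W0\<close>, times \<open>c * T - 1\<close>, which the observable 1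
        makes small. If \<open>T\<close> were 0, then \<open>VT\<close> would force
        \<open>V = 0\<close> and the bound would be trivial.\<close>
      have "\<bar>c * V - V / T\<bar> \<le> W0 * (\<bar>C2'\<bar> * \<eta>)"
      proof (cases "T = 0")
        case True
        then show ?thesis using VT W0 \<eta> by simp
      next
        case False
        have "c * V - V / T = V / T * (c * T - 1)" using False by (simp add: field_simps)
        then have "\<bar>c * V - V / T\<bar> = \<bar>V / T\<bar> * \<bar>1 - c * T\<bar>" by (simp add: abs_mult abs_minus_commute)
        also have "\<dots> \<le> W0 * (\<bar>C2'\<bar> * \<eta>)"
        proof (rule mult_mono)
          show "\<bar>V / T\<bar> \<le> W0" using VT T0 False by (simp add: abs_divide divide_le_eq)
          show "\<bar>1 - c * T\<bar> \<le> \<bar>C2'\<bar> * \<eta>" using est(2) C1(2) by linarith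
        qed (use W0 in auto)
        finally show ?thesis .
      qed
      then have "\<bar>X - V / T\<bar> \<le> \<bar>C1\<bar> * \<eta> + W0 * (\<bar>C2'\<bar> * \<eta>)" using est(1) C1(1) by linarith
      also have "\<dots> \<le> C * \<eta>" using \<eta> by (simp add: C_def distrib_right)
      finally show ?thesis .
    qed
    have "integrable lebesgue (\<lambda>x. w x * (\<psi> x)\<^sup>2)" using gw by (simp add: set_integrable_def)
    moreover have "(LINT x|lebesgue. w x * (\<psi> x)\<^sup>2) = X"
      using set_lebesgue_integral_eq_integral(2)[OF gw] by (simp add: set_lebesgue_integral_def X_def)
    ultimately show ?thesis
      using pw p1 final set_lebesgue_integral_eq_integral(2)[OF pw] set_lebesgue_integral_eq_integral(2)[OF p1]
      unfolding T_def V_def \<eta>_def by simp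
  qed
  show ?thesis
  proof (intro exI conjI)
    show "open (ball l0 \<epsilon>)" "l0 \<in> ball l0 \<epsilon>" using P1 P2 k0 by (simp_all add: \<epsilon>_def)
    show "\<eta>0 ^ 3 > 0" using \<eta>0 by simp
    show "C > 0" by (rule C)
    show "\<forall>l\<in>ball l0 \<epsilon>. assumption_B v l"
    proof
      fix l assume "l \<in> ball l0 \<epsilon>"
      then have "\<bar>l - l0\<bar> < \<epsilon>" by (simp add: dist_real_def abs_minus_commute)
      then show "assumption_B v l" using well by blast
    qed
  qed (use main in blast)
qed

end
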